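(* Let $\mathbf W^e:\Omega\to\mathbb R^s$ be a smooth enough stationary solution of the balance law $\partial_t\mathbf W+\nabla\cdot\mathbf F(\mathbf W)=\mathbf S(\mathbf W;\mathbf x)$ on the rectangle $\Omega$, i.e. $\partial_{x^1}\mathbf F_1(\mathbf W^e)+\partial_{x^2}\mathbf F_2(\mathbf W^e)=\mathbf S(\mathbf W^e;\mathbf x)$, with exact flux $\mathbf F^e=\mathbf F(\mathbf W^e)$ and exact source $\mathbf S^e=\mathbf S(\mathbf W^e;\cdot)$. Let $\psi\in C^1_0(\Omega)$ be an arbitrary smooth test function with compact support, and set $\psi_\alpha=\psi(\mathbf x_\alpha)$ at the grid nodes $\mathbf x_\alpha$. Let $\Phi^{ij}_\alpha(\mathbf W^e)$ be the steady fluctuations (defined in the context) of the global-flux-quadrature SUPG method (SUPG-GFQ) with continuous $\mathbb Q^K$ Gauss--Lobatto elements, evaluated on the nodal values $\mathbf W_\alpha=\mathbf W^e(\mathbf x_\alpha)$, and define the steady truncation error $$\mathsf E_h=\sum_\alpha \psi_\alpha\sum_{E_{ij}}\Phi^{ij}_\alpha(\mathbf W^e)\in\mathbb R^s .$$ Then there is a constant $C$ independent of $h$ such that $$\|\mathsf E_h\|\le C\,h^{K+1+t},$$ with $t=0$ for polynomial degree $K=1$ and $t=1$ for every polynomial degree $K\ge 2$.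
   Context: Mesh and space. $\Omega=[x^1_0,x^1_0+L_1]\times[x^2_0,x^2_0+L_2]$ is divided into $N_1\times N_2$ elements $E_{ij}=E^1_i\times E^2_j=[x^1_i,x^1_{i+1}]\times[x^2_j,x^2_{j+1}]$ with uniform sizes $h_m=L_m/N_m$, $m=1,2$; $h=\min(h_1,h_2)$, and along mesh refinement $h_1$ and $h_2$ are comparable, so that there are $O(h^{-2})$ elements. Fix $K\ge1$. In every one-dimensional cell $E^m_\ell$ take the $K+1$ Gauss--Lobatto points $x^m_{\ell,0}=x^m_\ell<\dots<x^m_{\ell,K}=x^m_{\ell+1}$ and the associated degree-$K$ Lagrange basis $\varphi^m_{\ell,p}$. $V_h^K$ is the space of continuous functions on $\Omega$ whose restriction to each element is in $\mathbb Q^K$ (degree at most $K$ in each variable). Its nodes $\mathbf x_\alpha$ are the tensor products of the one-dimensional points, and $\varphi_\alpha\in V_h^K$ is the nodal basis, $\varphi_\alpha(\mathbf x_\beta)=\delta_{\alpha\beta}$. Balance law. $\mathbf F=(\mathbf F_1,\mathbf F_2)$ with $\mathbf F_m$ smooth $\mathbb R^s$-valued functions of $\mathbf W$, and $\mathbf S(\mathbf W;\mathbf x)\in\mathbb R^s$ a smooth source. $\mathbf J=(\mathbf J_1,\mathbf J_2)$, $\mathbf J_m=\partial\mathbf F_m/\partial\mathbf W$. $\tau$ is an $s\times s$ matrix stabilization parameter, depending on $\mathbf W$ and the mesh, that is proportional to $h$ (so $\nabla\varphi_\alpha\cdot\mathbf J\,\tau$ is uniformly bounded). Here $\nabla\varphi\cdot\mathbf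 J\,\tau=\partial_{x^1}\varphi\,\mathbf J_1\tau+\partial_{x^2}\varphi\,\mathbf J_2\tau$. Discrete potentials. For nodal values $\mathbf W_\alpha$, let $\mathbf F_{m,h}\in(V_h^K)^s$ and $\mathbf S_h\in(V_h^K)^s$ be the nodal interpolants of $\mathbf F_m(\mathbf W_\alpha)$ and $\mathbf S(\mathbf W_\alpha;\mathbf x_\alpha)$. The potentials $\mathcal F_{1,h},\mathcal F_{2,h},\mathcal S_h\in(V_h^K)^s$ are the functions with the following values at every node $(a,b)$: $$\mathcal F_{1,h}(a,b)=\int_{x^2_0}^{b}\mathbf F_{1,h}(a,\eta)\,d\eta,\quad \mathcal F_{2,h}(a,b)=\int_{x^1_0}^{a}\mathbf F_{2,h}(\xi,b)\,d\xi,\quad \mathcal S_h(a,b)=-\int_{x^1_0}^{a}\int_{x^2_0}^{b}\mathbf S_h\,d\eta\, d\xi .$$ Steady fluctuations of SUPG-GFQ: for an element $E_{ij}$ and a node $\mathbf x_\alpha\in E_{ij}$, $$\Phi^{ij}_\alpha=\int_{E_{ij}}\big(\varphi_\alpha+\nabla\varphi_\alpha\cdot\mathbf J\,\tau\big)\,\partial_{x^1}\partial_{x^2}\big(\mathcal F_{1,h}+\mathcal F_{2,h}+\mathcal S_h\big)\,d\mathbf x,$$ with $\Phi^{ij}_\alpha=0$ if $\mathbf x_\alpha\notin E_{ij}$. Derivatives are taken element-wise and the integrals are evaluated with the tensor-product Gauss--Lobatto quadrature based on the interpolation nodes of the element. The steady limit of the method reads $\sum_{E_{ij}}\Phi^{ij}_\alpha=0$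 for all $\alpha$. The truncation error is obtained by inserting exact nodal values instead of the discrete solution. *)

theory Defs
  imports "HOL-Analysis.Analysis" "HOL-Computational_Algebra.Polynomial"
begin

section \<open>Partial derivatives and classes of differentiability\<close>

text \<open>
  All derivatives are taken within a set. On an open set this is the usual derivative; on a
  nondegenerate closed box (or a product of an open set with such a box) it is still unique and is
  one-sided at the boundary. Only such sets are used below. For a function which is polynomial on an
  element \<open>E\<close>, the partial derivatives within \<open>E\<close> are the element-wise derivatives.
\<close>

definition partial1 :: "(real \<times> real) set \<Rightarrow> (real \<times> real \<Rightarrow> 'b::real_normed_vector) \<Rightarrow> real \<times> real \<Rightarrow> 'b"
  where "partial1 A f x = frechet_derivative f (at x within A) (1, 0)"

definition partial2 :: "(real \<times> real) set \<Rightarrow> (real \<times> real \<Rightarrow> 'b::real_normed_vector) \<Rightarrow> real \<times> real \<Rightarrow> 'b"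
  where "partial2 A f x = frechet_derivative f (at x within A) (0, 1)"

primrec Ck_on :: "nat \<Rightarrow> 'a::euclidean_space set \<Rightarrow> ('a \<Rightarrow> 'b::real_normed_vector) \<Rightarrow> bool"
  where
    "Ck_on 0 A f \<longleftrightarrow> continuous_on A f"
  | "Ck_on (Suc k) A f \<longleftrightarrow>
       f differentiable_on A \<and> (\<forall>v. Ck_on k A (\<lambda>x. frechet_derivative f (at x within A) v))"

definition smooth_on :: "'a::euclidean_space set \<Rightarrow> ('a \<Rightarrow> 'b::real_normed_vector) \<Rightarrow> bool"
  where "smooth_on A f \<longleftrightarrow> (\<forall>k. Ck_on k A f)"

section \<open>Gauss--Lobatto points and Lagrange bases in one dimension\<close>

text \<open>Rodrigues' formula.\<close>

definition legendre :: "nat \<Rightarrow> real poly"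
  where "legendre n = smult (1 / (2 ^ n * fact n)) ((pderiv ^^ n) ([:-1, 0, 1:] ^ n))"

text \<open>
  For \<open>K \<ge> 1\<close> the \<open>K + 1\<close> Gauss--Lobatto points of \<open>[-1, 1]\<close>, in increasing order, are the end points
  and the \<open>K - 1\<close> roots of the derivative of the Legendre polynomial of degree \<open>K\<close>.
\<close>

definition gl_point :: "nat \<Rightarrow> nat \<Rightarrow> real"
  where "gl_point K p =
    sorted_list_of_set ({-1, 1} \<union> {x. poly (pderiv (legendre K)) x = 0}) ! p"

text \<open>The \<open>p\<close>-th point of the cell \<open>[a + \<ell> h, a + (\<ell> + 1) h]\<close>.\<close>

definition cell_point :: "real \<Rightarrow> real \<Rightarrow> nat \<Rightarrow> nat \<Rightarrow> nat \<Rightarrow> real"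
  where "cell_point a h K l p = a + h * (real l + (1 + gl_point K p) / 2)"

definition lagrange :: "(nat \<Rightarrow> real) \<Rightarrow> nat \<Rightarrow> nat \<Rightarrow> real \<Rightarrow> real"
  where "lagrange z K p x = (\<Prod>q\<in>{..K} - {p}. (x - z q) / (z p - z q))"

definition cell_weight :: "real \<Rightarrow> real \<Rightarrow> nat \<Rightarrow> nat \<Rightarrow> nat \<Rightarrow> real"
  where "cell_weight a h K l p =
    integral {a + h * real l .. a + h * real (Suc l)} (lagrange (cell_point a h K l) K p)"

section \<open>Meshes and the finite element space\<close>

record mesh =
  org1 :: real
  org2 :: real
  len1 :: real
  len2 :: real
  num1 :: nat
  num2 :: nat

definition step1 :: "mesh \<Rightarrow> real"
  where "step1 G = len1 G / real (num1 G)"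

definition step2 :: "mesh \<Rightarrow> real"
  where "step2 G = len2 G / real (num2 G)"

definition mesh_size :: "mesh \<Rightarrow> real"
  where "mesh_size G = min (step1 G) (step2 G)"

definition rectangle :: "real \<Rightarrow> real \<Rightarrow> real \<Rightarrow> real \<Rightarrow> (real \<times> real) set"
  where "rectangle a b l m = {a .. a + l} \<times> {b .. b + m}"

definition mesh_domain :: "mesh \<Rightarrow> (real \<times> real) set"
  where "mesh_domain G = rectangle (org1 G) (org2 G) (len1 G) (len2 G)"

definition elem :: "mesh \<Rightarrow> nat \<Rightarrow> nat \<Rightarrow> (real \<times> real) set"
  where "elem G i j =
    {org1 G + step1 G * real i .. org1 G + step1 G * real (Suc i)} \<times>
    {org2 G + step2 G * real j .. org2 G + step2 G * real (Suc j)}"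

definition node1 :: "mesh \<Rightarrow> nat \<Rightarrow> nat \<Rightarrow> nat \<Rightarrow> real"
  where "node1 G = cell_point (org1 G) (step1 G)"

definition node2 :: "mesh \<Rightarrow> nat \<Rightarrow> nat \<Rightarrow> nat \<Rightarrow> real"
  where "node2 G = cell_point (org2 G) (step2 G)"

text \<open>
  Degrees of freedom \<open>\<alpha>\<close> are identified with their nodes \<open>x\<^sub>\<alpha>\<close>, so that a node shared by several
  elements occurs only once.
\<close>

definition nodes :: "nat \<Rightarrow> mesh \<Rightarrow> (real \<times> real) set"
  where "nodes K G =
    {(node1 G K i p, node2 G K j q) | i p j q. i < num1 G \<and> p \<le> K \<and> j < num2 G \<and> q \<le> K}"

text \<open>Functions on the rectangle are represented by their extension by \<open>0\<close>.\<close>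

definition fe_space :: "nat \<Rightarrow> mesh \<Rightarrow> (real \<times> real \<Rightarrow> real) set"
  where "fe_space K G =
    {f. continuous_on (mesh_domain G) f \<and> (\<forall>z. z \<notin> mesh_domain G \<longrightarrow> f z = 0) \<and>
        (\<forall>i<num1 G. \<forall>j<num2 G. \<exists>c::nat \<Rightarrow> nat \<Rightarrow> real. \<forall>(x, y)\<in>elem G i j.
           f (x, y) = (\<Sum>p\<le>K. \<Sum>q\<le>K. c p q * x ^ p * y ^ q))}"

definition nodal_basis :: "nat \<Rightarrow> mesh \<Rightarrow> real \<times> real \<Rightarrow> real \<times> real \<Rightarrow> real"
  where "nodal_basis K G \<alpha> =
    (THE \<phi>. \<phi> \<in> fe_space K G \<and> (\<forall>\<beta>\<in>nodes K G. \<phi> \<beta> = (if \<beta> = \<alpha> then 1 else 0)))"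

definition interpolant ::
    "nat \<Rightarrow> mesh \<Rightarrow> (real \<times> real \<Rightarrow> 'b::real_normed_vector) \<Rightarrow> real \<times> real \<Rightarrow> 'b"
  where "interpolant K G g x = (\<Sum>\<alpha>\<in>nodes K G. nodal_basis K G \<alpha> x *\<^sub>R g \<alpha>)"

definition quadrature ::
    "nat \<Rightarrow> mesh \<Rightarrow> nat \<Rightarrow> nat \<Rightarrow> (real \<times> real \<Rightarrow> 'b::real_normed_vector) \<Rightarrow> 'b"
  where "quadrature K G i j f =
    (\<Sum>p\<le>K. \<Sum>q\<le>K.
       (cell_weight (org1 G) (step1 G) K i p * cell_weight (org2 G) (step2 G) K j q) *\<^sub>R
         f (node1 G K i p, node2 G K j q))"

section \<open>The SUPG method with global flux quadrature\<close>

definition jacobian_matrix :: "(real^'s \<Rightarrow> real^'s) \<Rightarrow> real^'s \<Rightarrow> real^'s^'s::finite"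
  where "jacobian_matrix F w = matrix (frechet_derivative F (at w))"

text \<open>
  In the following, \<open>W\<close> gives the nodal values of the state; it is only evaluated at nodes, which
  are also the quadrature points.
\<close>

definition flux_potential1 ::
    "nat \<Rightarrow> mesh \<Rightarrow> (real^'s \<Rightarrow> real^'s) \<Rightarrow> (real \<times> real \<Rightarrow> real^'s) \<Rightarrow> real \<times> real \<Rightarrow> real^'s::finite"
  where "flux_potential1 K G F1 W =
    interpolant K G (\<lambda>(a, b).
      integral {org2 G .. b} (\<lambda>\<eta>. interpolant K G (\<lambda>x. F1 (W x)) (a, \<eta>)))"

definition flux_potential2 ::
    "nat \<Rightarrow> mesh \<Rightarrow> (real^'s \<Rightarrow> real^'s) \<Rightarrow> (real \<times> real \<Rightarrow> real^'s) \<Rightarrow> real \<times> real \<Rightarrow> real^'s::finite"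
  where "flux_potential2 K G F2 W =
    interpolant K G (\<lambda>(a, b).
      integral {org1 G .. a} (\<lambda>\<xi>. interpolant K G (\<lambda>x. F2 (W x)) (\<xi>, b)))"

definition source_potential ::
    "nat \<Rightarrow> mesh \<Rightarrow> (real^'s \<Rightarrow> real \<times> real \<Rightarrow> real^'s) \<Rightarrow> (real \<times> real \<Rightarrow> real^'s) \<Rightarrow>
     real \<times> real \<Rightarrow> real^'s::finite"
  where "source_potential K G S W =
    interpolant K G (\<lambda>(a, b).
      - integral {org1 G .. a} (\<lambda>\<xi>.
          integral {org2 G .. b} (\<lambda>\<eta>. interpolant K G (\<lambda>x. S (W x) x) (\<xi>, \<eta>))))"

definition fluctuation ::
    "nat \<Rightarrow> mesh \<Rightarrow> (real^'s \<Rightarrow> real^'s) \<Rightarrow> (real^'s \<Rightarrow> real^'s) \<Rightarrow>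
     (real^'s \<Rightarrow> real \<times> real \<Rightarrow> real^'s) \<Rightarrow> (nat \<Rightarrow> nat \<Rightarrow> real \<times> real \<Rightarrow> real^'s \<Rightarrow> real^'s^'s) \<Rightarrow>
     (real \<times> real \<Rightarrow> real^'s) \<Rightarrow> nat \<Rightarrow> nat \<Rightarrow> real \<times> real \<Rightarrow> real^'s::finite"
  where "fluctuation K G F1 F2 S \<tau> W i j \<alpha> =
    (if \<alpha> \<in> elem G i j then
       quadrature K G i j (\<lambda>x.
         (nodal_basis K G \<alpha> x *\<^sub>R mat 1
           + (partial1 (elem G i j) (nodal_basis K G \<alpha>) x *\<^sub>R (jacobian_matrix F1 (W x) ** \<tau> i j x (W x))
             + partial2 (elem G i j) (nodal_basis K G \<alpha>) x *\<^sub>R (jacobian_matrix F2 (W x) ** \<tau> i j x (W x))))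
         *v partial1 (elem G i j) (partial2 (elem G i j)
              (\<lambda>y. flux_potential1 K G F1 W y + flux_potential2 K G F2 W y
                   + source_potential K G S W y)) x)
     else 0)"

definition truncation_error ::
    "nat \<Rightarrow> mesh \<Rightarrow> (real^'s \<Rightarrow> real^'s) \<Rightarrow> (real^'s \<Rightarrow> real^'s) \<Rightarrow>
     (real^'s \<Rightarrow> real \<times> real \<Rightarrow> real^'s) \<Rightarrow> (nat \<Rightarrow> nat \<Rightarrow> real \<times> real \<Rightarrow> real^'s \<Rightarrow> real^'s^'s) \<Rightarrow>
     (real \<times> real \<Rightarrow> real^'s) \<Rightarrow> (real \<times> real \<Rightarrow> real) \<Rightarrow> real^'s::finite"
  where "truncation_error K G F1 F2 S \<tau> W \<psi> =
    (\<Sum>\<alpha>\<in>nodes K G. \<psi> \<alpha> *\<^sub>R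
       (\<Sum>i<num1 G. \<Sum>j<num2 G. fluctuation K G F1 F2 S \<tau> W i j \<alpha>))"

section \<open>Hypotheses\<close>

definition stationary_solution ::
    "(real \<times> real) set \<Rightarrow> (real^'s \<Rightarrow> real^'s) \<Rightarrow> (real^'s \<Rightarrow> real^'s) \<Rightarrow>
     (real^'s \<Rightarrow> real \<times> real \<Rightarrow> real^'s) \<Rightarrow> (real \<times> real \<Rightarrow> real^'s::finite) \<Rightarrow> bool"
  where "stationary_solution \<Omega> F1 F2 S W \<longleftrightarrow>
    (\<forall>x\<in>\<Omega>. partial1 \<Omega> (\<lambda>y. F1 (W y)) x + partial2 \<Omega> (\<lambda>y. F2 (W y)) x = S (W x) x)"

definition test_function :: "(real \<times> real) set \<Rightarrow> (real \<times> real \<Rightarrow> real) \<Rightarrow> bool"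
  where "test_function \<Omega> \<psi> \<longleftrightarrow>
    Ck_on 1 \<Omega> \<psi> \<and> compact (closure {x\<in>\<Omega>. \<psi> x \<noteq> 0}) \<and> closure {x\<in>\<Omega>. \<psi> x \<noteq> 0} \<subseteq> interior \<Omega>"

text \<open>
  A family of meshes of one rectangle along which the two step sizes are comparable; all constants
  called ``independent of the mesh size'' are uniform over such a family.
\<close>

definition mesh_family ::
    "real \<Rightarrow> real \<Rightarrow> real \<Rightarrow> real \<Rightarrow> mesh set \<Rightarrow> bool"
  where "mesh_family a b l m \<M> \<longleftrightarrow>
    (\<forall>G\<in>\<M>. org1 G = a \<and> org2 G = b \<and> len1 G = l \<and> len2 G = m \<and> num1 G \<ge> 1 \<and> num2 G \<ge> 1) \<and>
    (\<exists>\<kappa>. \<forall>G\<in>\<M>. step1 G \<le> \<kappa> * step2 G \<and> step2 G \<le> \<kappa> * step1 G)"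

text \<open>
  The stabilization parameter \<open>\<tau> G i j x w\<close> may vary from element to element and within an element.
  It is of the size of \<open>h\<close>, uniformly for states \<open>w\<close> in compact subsets of the set \<open>D\<close> of admissible
  states. This covers \<open>\<tau> G i j x w = mesh_size G *\<^sub>R T w\<close> with \<open>T\<close> continuous on \<open>D\<close>.
\<close>

definition stabilization_scaling ::
    "(real^'s) set \<Rightarrow> mesh set \<Rightarrow>
     (mesh \<Rightarrow> nat \<Rightarrow> nat \<Rightarrow> real \<times> real \<Rightarrow> real^'s \<Rightarrow> real^'s^'s::finite) \<Rightarrow> bool"
  where "stabilization_scaling D \<M> \<tau> \<longleftrightarrow>
    (\<forall>Q. compact Q \<and> Q \<subseteq> D \<longrightarrow>
       (\<exists>c. \<forall>G\<in>\<M>. \<forall>i<num1 G. \<forall>j<num2 G. \<forall>x\<in>elem G i j. \<forall>w\<in>Q.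
          norm (\<tau> G i j x w) \<le> c * mesh_size G))"

end

theory Submission
  imports Defs
begin

text \<open>
  On an element the residual is \<open>D\<^sub>1 D\<^sub>2\<close> applied to nodal values of the potential, where
  \<open>D\<^sub>m\<close> annihilates functions that do not depend on the \<open>m\<close>-th index. Integrating an interpolant up
  to the nodes is Lobatto IIIA collocation, so replacing the source by the flux divergence leaves only
  the collocation errors of \<open>F\<^sub>1\<close> along \<open>x\<^sup>1\<close> and of \<open>F\<^sub>2\<close> along \<open>x\<^sup>2\<close>. These are \<open>O(h\<^bsup>K+2\<^esup>)\<close> at every
  node, and \<open>O(h\<^bsup>K+3\<^esup>)\<close> at the right end point if \<open>K \<ge> 2\<close>, since Gauss--Lobatto quadrature is then exact
  on polynomials of degree \<open>K + 1\<close>. The residual is thus \<open>O(h\<^bsup>K+1\<^esup>)\<close>, but its quadrature over an element,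
  which only involves corner values of the potential, has mean value \<open>O(h\<^bsup>K+2\<^esup>)\<close> for \<open>K \<ge> 2\<close>. The
  variation of \<open>\<psi>\<close> over an element and the SUPG term with \<open>\<tau> = O(h)\<close> each contribute a further factor
  \<open>h\<close>. Summation over \<open>O(h\<^bsup>-2\<^esup>)\<close> elements of area \<open>O(h\<^sup>2)\<close> gives the claim.
\<close>

section \<open>Gauss--Lobatto points\<close>

text \<open>The potentials are integrals from the corner of the mesh, so data of all elements below
  and to the left enter them. What keeps the analysis local is that these distant contributions
  depend on only one of the two node indices of an element and therefore disappear in the mixed
  derivative. The gain for \<open>K \<ge> 2\<close> arises at the corners: the weights integrate
  derivatives of basis polynomials exactly, so the quadrature of the residual is a second difference
  of four corner values, and collocation errors vanish at the left and lower edges. Only the upper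
  right corner remains, where they are pure quadrature errors. For \<open>K = 1\<close> the rule is
  the trapezoidal rule, which is not exact in degree \<open>K + 1\<close>, so nothing is gained. In
  the SUPG term a single basis function has a gradient of size \<open>1/h\<close>; summing against
  \<open>\<psi>\<close> first leaves the gradient of the interpolated test function, which is
  bounded. The nodes are given as entries of a sorted list of roots and the basis by a definite
  description, so the number of roots and the unique existence of the basis must be settled before
  any estimate.\<close>

lemma poly_Rolle_card:
  fixes p :: "real poly"
  assumes "finite A" "card A = Suc n" "A \<subseteq> {u..v}" "\<And>x. x \<in> A \<Longrightarrow> poly p x = 0"
  shows "\<exists>B. finite B \<and> card B = n \<and> B \<subseteq> {u<..<v} \<and> (\<forall>x\<in>B. poly (pderiv p) x = 0)"
  using assms
proof (induction n arbitrary: A v)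
  case 0
  show ?case by (rule exI[of _ "{}"]) simp
next
  case (Suc n)
  define M where "M = Max A"
  define A' where "A' = A - {M}"
  define M' where "M' = Max A'"
  have "A \<noteq> {}" using Suc.prems by auto
  then have M: "M \<in> A" unfolding M_def using Suc.prems by simp
  have A': "finite A'" "card A' = Suc n" unfolding A'_def using Suc.prems M by auto
  then have "A' \<noteq> {}" by auto
  then have M': "M' \<in> A'" unfolding M'_def using A' by simp
  then have "M' \<in> A" "M' \<noteq> M" by (auto simp: A'_def)
  then have lt: "M' < M" using Suc.prems(1) unfolding M_def by (simp add: order_less_le)
  \<comment> \<open>The interval is cut at the second largest zero, so the zeros from the induction
    hypothesis lie left of \<open>M'\<close> and differ from the new one in \<open>(M', M)\<close>.
    This is why \<open>v\<close> is arbitrary in the induction.\<close>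
  have "A' \<subseteq> {u..M'}"
  proof
    fix x assume x: "x \<in> A'"
    then show "x \<in> {u..M'}" using Suc.prems(3) Max_ge[OF A'(1) x] by (auto simp: M'_def A'_def)
  qed
  then obtain B where B: "finite B" "card B = n" "B \<subseteq> {u<..<M'}" "\<forall>x\<in>B. poly (pderiv p) x = 0"
    using Suc.IH[of A' M'] A' Suc.prems unfolding A'_def by auto
  have "\<exists>z. M' < z \<and> z < M \<and> poly (pderiv p) z = 0"
  proof -
    have "poly p M' = poly p M" using Suc.prems M \<open>M' \<in> A\<close> by simp
    then have "\<exists>z. M' < z \<and> z < M \<and> (\<lambda>h. poly (pderiv p) z * h) = (\<lambda>v. 0)"
      by (intro Rolle_deriv[where f = "poly p"] lt)
        (auto intro!: continuous_intros has_field_derivative_imp_has_derivative)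
    then obtain z where z: "M' < z" "z < M" "(\<lambda>h. poly (pderiv p) z * h) = (\<lambda>v. 0)" by blast
    have "poly (pderiv p) z = 0" using fun_cong[OF z(3), of 1] by simp
    with z show ?thesis by blast
  qed
  then obtain z where z: "M' < z" "z < M" "poly (pderiv p) z = 0" by blast
  have "u \<le> M'" "M \<le> v" using Suc.prems(3) M \<open>M' \<in> A\<close> by auto
  then show ?case
    using B z by (intro exI[of _ "insert z B"]) (subst card_insert_disjoint, auto)
qed

text \<open>Each differentiation lowers the multiplicity of a factor by at most one.\<close>

lemma power_dvd_higher_pderiv:
  fixes p q :: "real poly"
  assumes "p ^ (j + k) dvd q"
  shows "p ^ j dvd (pderiv ^^ k) q"
  using assms
proof (induction k arbitrary: j)
  case (Suc k)
  from Suc.IH[of "Suc j"] Suc.prems have "p ^ Suc j dvd (pderiv ^^ k) q" by simp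
  then obtain r where r: "(pderiv ^^ k) q = p ^ Suc j * r" by (auto elim: dvdE)
  have "(pderiv ^^ Suc k) q = p ^ Suc j * pderiv r + r * (smult (of_nat (Suc j)) (p ^ j) * pderiv p)"
    using r by (simp add: pderiv_mult pderiv_power_Suc del: power_Suc)
  also have "\<dots> = p ^ j * (p * pderiv r + smult (of_nat (Suc j)) (r * pderiv p))"
    by (simp add: algebra_simps)
  finally show ?case by simp
qed simp

text \<open>The Legendre polynomial of degree \<open>n\<close> is a multiple of the
  \<open>n\<close>-th derivative of this power; the scalar does not affect the zeros.\<close>

abbreviation rodrigues :: "nat \<Rightarrow> real poly"
  where "rodrigues n \<equiv> [:-1, 0, 1:] ^ n"

lemma rodrigues_end:
  assumes "k < n" "x = 1 \<or> x = -1"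
  shows "poly ((pderiv ^^ k) (rodrigues n)) x = 0"
proof -
  have "[:-1, 0, 1:] ^ 1 dvd (pderiv ^^ k) (rodrigues n)"
    by (rule power_dvd_higher_pderiv) (use assms in \<open>intro le_imp_power_dvd, simp\<close>)
  then obtain r where "(pderiv ^^ k) (rodrigues n) = [:-1, 0, 1:] * r" by (auto elim: dvdE)
  with assms show ?thesis by auto
qed

text \<open>The end points stay zeros of the derivatives of order below \<open>n\<close>. Together
  with \<open>k\<close> interior zeros they make \<open>k + 2\<close>, so Rolle gains one interior
  zero per differentiation. At \<open>k = n\<close> these are the zeros of the Legendre
  polynomial.\<close>

lemma rodrigues_zeros:
  assumes "k \<le> n"
  shows "\<exists>B. finite B \<and> card B = k \<and> B \<subseteq> {-1<..<1::real} \<and>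
    (\<forall>x\<in>B. poly ((pderiv ^^ k) (rodrigues n)) x = 0)"
  using assms
proof (induction k)
  case 0
  show ?case by (rule exI[of _ "{}"]) simp
next
  case (Suc k)
  then obtain B where B: "finite B" "card B = k" "B \<subseteq> {-1<..<1}"
    "\<forall>x\<in>B. poly ((pderiv ^^ k) (rodrigues n)) x = 0" by auto
  define A where "A = insert (-1) (insert 1 B)"
  have "1 \<notin> B" "-1 \<notin> B" using B by auto
  then have "finite A" "card A = Suc (Suc k)" using B by (auto simp: A_def)
  moreover have "A \<subseteq> {-1..1}" using B by (auto simp: A_def)
  moreover have "poly ((pderiv ^^ k) (rodrigues n)) x = 0" if "x \<in> A" for x
    using that B rodrigues_end[of k n x] Suc.prems by (auto simp: A_def)
  ultimately show ?case
    using poly_Rolle_card[of A "Suc k" "-1" 1] by auto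
qed

lemma degree_legendre: "degree (legendre n) = n"
  by (simp add: legendre_def degree_higher_pderiv degree_power_eq)

definition gl_set :: "nat \<Rightarrow> real set"
  where "gl_set K = {-1, 1} \<union> {x. poly (pderiv (legendre K)) x = 0}"

text \<open>Rolle yields \<open>K - 1\<close> interior zeros of the derivative of the Legendre
  polynomial, and its degree allows no more. Only this count makes the list access in
  \<open>gl_point\<close> meaningful for all indices up to \<open>K\<close>.\<close>

lemma gl_set:
  assumes "K \<ge> 1"
  shows "finite (gl_set K)" "card (gl_set K) = Suc K" "gl_set K \<subseteq> {-1..1}"
proof -
  obtain B where B: "finite B" "card B = K" "B \<subseteq> {-1<..<1::real}"
    "\<forall>x\<in>B. poly ((pderiv ^^ K) (rodrigues K)) x = 0"
    using rodrigues_zeros[of K K] by auto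
  then have "poly (legendre K) x = 0" if "x \<in> B" for x
    using that by (simp add: legendre_def)
  moreover have "B \<subseteq> {-1..1}" using B(3) by auto
  ultimately obtain B' where B': "finite B'" "card B' = K - 1" "B' \<subseteq> {-1<..<1::real}"
    "\<forall>x\<in>B'. poly (pderiv (legendre K)) x = 0"
    using poly_Rolle_card[of B "K - 1" "-1" 1 "legendre K"] B(1,2) assms by auto
  let ?R = "{x. poly (pderiv (legendre K)) x = 0}"
  have nz: "pderiv (legendre K) \<noteq> 0"
    using assms by (simp add: pderiv_eq_0_iff degree_legendre)
  have "card ?R \<le> K - 1"
    using card_poly_roots_bound[OF nz] by (simp add: degree_pderiv degree_legendre)
  moreover have "finite ?R" using poly_roots_finite[OF nz] .
  ultimately have "B' = ?R"
    using B' by (intro card_seteq) auto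
  then have *: "gl_set K = insert (-1) (insert 1 B')" by (auto simp: gl_set_def)
  have "1 \<notin> B'" "-1 \<notin> B'" using B' by auto
  then show "finite (gl_set K)" "card (gl_set K) = Suc K" "gl_set K \<subseteq> {-1..1}"
    using B' assms by (auto simp: *)
qed

lemma gl_point_image:
  assumes "K \<ge> 1"
  shows "gl_point K ` {..K} = gl_set K"
proof -
  let ?l = "sorted_list_of_set (gl_set K)"
  have "set ?l = gl_set K" "length ?l = Suc K" using gl_set[OF assms] by auto
  then have "gl_set K = (!) ?l ` {..<Suc K}"
    by (metis list.set_map map_nth set_upt lessThan_atLeast0)
  then show ?thesis
    by (simp add: gl_point_def[abs_def] gl_set_def lessThan_Suc_atMost)
qed

lemma gl_point_less:
  assumes "K \<ge> 1" "p < q" "q \<le> K"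
  shows "gl_point K p < gl_point K q"
  using sorted_wrt_nth_less[of "(<)" "sorted_list_of_set (gl_set K)" p q] gl_set[OF assms(1)] assms
  by (simp add: gl_point_def gl_set_def)

lemma gl_point_mono:
  assumes "K \<ge> 1" "p \<le> q" "q \<le> K"
  shows "gl_point K p \<le> gl_point K q"
  using gl_point_less[of K p q] assms by (cases "p = q") auto

lemma gl_point_ends:
  assumes "K \<ge> 1"
  shows "gl_point K 0 = -1" "gl_point K K = 1"
proof -
  have im: "gl_point K ` {..K} = gl_set K" by (rule gl_point_image[OF assms])
  have "gl_point K 0 \<in> gl_set K" "gl_point K K \<in> gl_set K" using im by auto
  then have b: "-1 \<le> gl_point K 0" "gl_point K K \<le> 1" using gl_set(3)[OF assms] by auto
  have "-1 \<in> gl_point K ` {..K}" "1 \<in> gl_point K ` {..K}" unfolding im by (auto simp: gl_set_def)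
  then obtain p q where "gl_point K p = -1" "p \<le> K" "gl_point K q = 1" "q \<le> K" by fastforce
  then show "gl_point K 0 = -1" "gl_point K K = 1"
    using b gl_point_mono[OF assms, of 0 p] gl_point_mono[OF assms, of q K] by auto
qed

text \<open>
  \<open>(x\<^sup>2 - 1) P\<^sub>K'\<close> integrates by parts to a multiple of \<open>\<integral> x D\<^sup>K (x\<^sup>2 - 1)\<^sup>K\<close>,
  and \<open>x D\<^sup>K w = (x D\<^bsup>K-1\<^esup> w - D\<^bsup>K-2\<^esup> w)'\<close>. All boundary terms vanish when \<open>K \<ge> 2\<close>.
\<close>

lemma gl_antiderivative:
  assumes "K \<ge> 2"
  shows "\<exists>G. pderiv G = [:-1, 0, 1:] * pderiv (legendre K) \<and> poly G 1 = poly G (-1)"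
proof -
  define D where "D k = (pderiv ^^ k) (rodrigues K)" for k
  have D: "pderiv (D k) = D (Suc k)" for k by (simp add: D_def)
  obtain k where k: "K = Suc (Suc k)" using assms by (auto dest!: le_Suc_ex)
  define c :: real where "c = 1 / (2 ^ K * fact K)"
  have leg: "legendre K = smult c (D K)" by (simp add: legendre_def c_def D_def)
  \<comment> \<open>Differentiating the first product gives, besides the wanted term,
    \<open>2 x\<close> times the Legendre polynomial; the subtracted part is an antiderivative of
    exactly that.\<close>
  define G where "G = [:-1, 0, 1:] * legendre K - smult (2 * c) ([:0, 1:] * D (Suc k) - D k)"
  have "pderiv G = [:-1, 0, 1:] * pderiv (legendre K) + legendre K * [:0, 2:]
      - smult (2 * c) ([:0, 1:] * D K)"
    unfolding G_def pderiv_diff pderiv_mult pderiv_smult D k by (simp add: pderiv_pCons)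
  also have "legendre K * [:0, 2:] = smult (2 * c) ([:0, 1:] * D K)"
    unfolding leg by (simp add: mult.commute)
  finally have "pderiv G = [:-1, 0, 1:] * pderiv (legendre K)" by simp
  moreover have "poly (D k) x = 0 \<and> poly (D (Suc k)) x = 0" if "x = 1 \<or> x = -1" for x
    using rodrigues_end[of _ K x] that by (simp add: D_def k del: funpow.simps)
  then have "poly G 1 = 0" "poly G (-1) = 0" by (auto simp: G_def)
  ultimately show ?thesis by metis
qed

section \<open>Exactness of Gauss--Lobatto quadrature on the unit interval\<close>

definition ref_point :: "nat \<Rightarrow> nat \<Rightarrow> real"
  where "ref_point K p = (1 + gl_point K p) / 2"

lemma ref_point_less: "K \<ge> 1 \<Longrightarrow> p < q \<Longrightarrow> q \<le> K \<Longrightarrow> ref_point K p < ref_point K q"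
  using gl_point_less by (simp add: ref_point_def)

lemma ref_point_inj: "K \<ge> 1 \<Longrightarrow> inj_on (ref_point K) {..K}"
  by (rule inj_onI) (metis atMost_iff less_irrefl linorder_neqE_nat ref_point_less)

lemma ref_point_ends: "K \<ge> 1 \<Longrightarrow> ref_point K 0 = 0" "K \<ge> 1 \<Longrightarrow> ref_point K K = 1"
  by (simp_all add: ref_point_def gl_point_ends)

lemma ref_point_range: "K \<ge> 1 \<Longrightarrow> p \<le> K \<Longrightarrow> ref_point K p \<in> {0..1}"
  using gl_point_image[of K] gl_set(3)[of K] by (fastforce simp: ref_point_def)

lemma integral_poly:
  fixes p :: "real poly"
  assumes "pderiv G = p" "a \<le> b"
  shows "integral {a..b} (poly p) = poly G b - poly G a"
  using assms by (intro integral_unique fundamental_theorem_of_calculus)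
    (auto intro!: has_field_derivative_at_within[OF poly_DERIV]
      simp flip: has_real_derivative_iff_has_vector_derivative)

text \<open>Vanishing at all nodes forces \<open>Q\<close> to be a multiple of the node polynomial,
  whose integral is zero by \<open>gl_antiderivative\<close>. Applied to an interpolation error,
  this is exactness of the quadrature in degree \<open>K + 1\<close>.\<close>

lemma ref_integral_eq_0:
  assumes K: "K \<ge> 2" and deg: "degree Q \<le> Suc K"
    and 0: "\<And>p. p \<le> K \<Longrightarrow> poly Q (ref_point K p) = 0"
  shows "integral {0..1} (poly Q) = 0"
proof -
  have K1: "K \<ge> 1" using K by linarith
  define W where "W = [:-1, 0, 1:] * pderiv (legendre K)"
  define Q' where "Q' = pcompose Q [:1/2, 1/2:]"
  have nz: "pderiv (legendre K) \<noteq> 0"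
    using K by (simp add: pderiv_eq_0_iff degree_legendre)
  then have degW: "degree W = Suc K"
    using K unfolding W_def by (subst degree_mult_eq) (auto simp: degree_pderiv degree_legendre)
  then have lcW: "coeff W (Suc K) \<noteq> 0" by (metis leading_coeff_0_iff degree_0 nat.distinct(1))
  \<comment> \<open>The \<open>K + 1\<close> nodes alone do not determine a polynomial of degree
    \<open>K + 1\<close>; matching the leading coefficient closes the gap.\<close>
  define c where "c = coeff Q' (Suc K) / coeff W (Suc K)"
  have QW: "Q' = smult c W"
  proof (rule poly_eqI_degree_lead_coeff[where A = "gl_set K" and n = "Suc K"])
    show "coeff Q' (Suc K) = coeff (smult c W) (Suc K)" using lcW by (simp add: c_def)
    show "Suc K \<le> card (gl_set K)" using gl_set[OF K1] by simp
    show "degree Q' \<le> Suc K" using deg by (simp add: Q'_def degree_pcompose)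
    show "degree (smult c W) \<le> Suc K" using degW by (metis degree_smult_le)
    fix z assume z: "z \<in> gl_set K"
    then obtain p where "p \<le> K" "z = gl_point K p" using gl_point_image[OF K1] by auto
    then have "poly Q' z = 0" using 0[of p] by (simp add: Q'_def poly_pcompose ref_point_def add_divide_distrib)
    moreover have "poly W z = 0" using z by (auto simp: W_def gl_set_def)
    ultimately show "poly Q' z = poly (smult c W) z" by simp
  qed
  obtain G where G: "pderiv G = W" "poly G 1 = poly G (-1)"
    using gl_antiderivative[OF K] by (auto simp: W_def)
  \<comment> \<open>The factor \<open>1/2\<close> cancels the inner derivative of the map
    \<open>t \<mapsto> 2 t - 1\<close> from \<open>[0, 1]\<close> back to
    \<open>[-1, 1]\<close>.\<close>
  define H where "H = smult (c/2) (pcompose G [:-1, 2:])"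
  have "pderiv H = smult c (pcompose W [:-1, 2:])"
    using G by (simp add: H_def pderiv_smult pderiv_pcompose pderiv_pCons mult.commute)
  also have "\<dots> = pcompose Q' [:-1, 2:]"
    using QW by (simp add: pcompose_smult)
  also have "\<dots> = Q"
    by (simp add: Q'_def pcompose_assoc[symmetric] pcompose_pCons)
  finally have "pderiv H = Q" .
  then show ?thesis
    using integral_poly[of H Q 0 1] G by (simp add: H_def poly_pcompose)
qed

section \<open>The reference cell\<close>

text \<open>The Lagrange basis as polynomials instead of functions, which gives access to degrees,
  derivatives and antiderivatives.\<close>

definition ref_lag :: "nat \<Rightarrow> nat \<Rightarrow> real poly"
  where "ref_lag K p =
    (\<Prod>q\<in>{..K} - {p}. smult (1 / (ref_point K p - ref_point K q)) [:- ref_point K q, 1:])"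

lemma poly_ref_lag: "poly (ref_lag K p) t = lagrange (ref_point K) K p t"
  unfolding ref_lag_def lagrange_def poly_prod by (intro prod.cong) (auto simp: diff_divide_distrib)

lemma degree_ref_lag:
  assumes "p \<le> K"
  shows "degree (ref_lag K p) \<le> K"
proof -
  have "degree (ref_lag K p) \<le> (\<Sum>q\<in>{..K} - {p}.
      degree (smult (1 / (ref_point K p - ref_point K q)) [:- ref_point K q, 1:]))"
    unfolding ref_lag_def by (rule degree_prod_sum_le[unfolded comp_def]) simp
  also have "\<dots> \<le> (\<Sum>q\<in>{..K} - {p}. 1)"
    by (intro sum_mono order_trans[OF degree_smult_le]) simp
  finally show ?thesis using assms by simp
qed

lemma lagrange_node:
  assumes "inj_on z {..K}" "p \<le> K" "q \<le> K"
  shows "lagrange z K p (z q) = (if p = q then 1 else 0)"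
proof (cases "p = q")
  case True
  have "z p - z r \<noteq> 0" if "r \<in> {..K} - {p}" for r
    using that assms(2) inj_onD[OF assms(1), of p r] by auto
  with True show ?thesis unfolding lagrange_def by (intro trans[OF prod.neutral]) auto
next
  case False
  then have "lagrange z K p (z q) = 0"
    unfolding lagrange_def using assms by (intro prod_zero) auto
  with False show ?thesis by simp
qed

lemma ref_lag_node:
  "K \<ge> 1 \<Longrightarrow> p \<le> K \<Longrightarrow> q \<le> K \<Longrightarrow> poly (ref_lag K p) (ref_point K q) = (if p = q then 1 else 0)"
  unfolding poly_ref_lag by (intro lagrange_node ref_point_inj)

lemma cell_point_ref: "cell_point a h K l p = (a + h * real l) + h * ref_point K p"
  by (simp add: cell_point_def ref_point_def algebra_simps add_divide_distrib)

lemma lagrange_cell: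
  assumes "h \<noteq> 0"
  shows "lagrange (cell_point a h K l) K p x = poly (ref_lag K p) ((x - (a + h * real l)) / h)"
proof -
  have "(x - cell_point a h K l q) / (cell_point a h K l p - cell_point a h K l q)
      = ((x - (a + h * real l)) / h - ref_point K q) / (ref_point K p - ref_point K q)" for q
  proof -
    have "x - cell_point a h K l q = h * ((x - (a + h * real l)) / h - ref_point K q)"
      using assms by (simp add: cell_point_ref field_simps)
    moreover have "cell_point a h K l p - cell_point a h K l q = h * (ref_point K p - ref_point K q)"
      by (simp add: cell_point_ref algebra_simps)
    ultimately show ?thesis using assms by simp
  qed
  then show ?thesis by (simp add: poly_ref_lag lagrange_def)
qed

lemma ref_interpolation:
  assumes "K \<ge> 1" "degree P \<le> K"
  shows "P = (\<Sum>r\<le>K. smult (poly P (ref_point K r)) (ref_lag K r))" (is "P = ?Q")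
proof (rule poly_eqI_degree[where A = "ref_point K ` {..K}"])
  have c: "card (ref_point K ` {..K}) = Suc K"
    using ref_point_inj[OF assms(1)] by (simp add: card_image)
  have "degree ?Q \<le> K"
    by (intro degree_sum_le) (auto simp: degree_ref_lag)
  then show "degree ?Q < card (ref_point K ` {..K})" "degree P < card (ref_point K ` {..K})"
    using c assms by auto
  fix x assume "x \<in> ref_point K ` {..K}"
  then obtain q where q: "q \<le> K" "x = ref_point K q" by auto
  have "poly ?Q x = (\<Sum>r\<le>K. if r = q then poly P (ref_point K r) else 0)"
    unfolding poly_sum using q assms by (intro sum.cong) (auto simp: ref_lag_node)
  then show "poly P x = poly ?Q x" using q by simp
qed

text \<open>
  \<open>dmat\<close> differentiates nodal values. \<open>bmat\<close> is the Butcher matrix of the Lobatto IIIA collocation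
  method, and its last row consists of the quadrature weights.
\<close>

definition dmat :: "nat \<Rightarrow> nat \<Rightarrow> nat \<Rightarrow> real"
  where "dmat K p r = poly (pderiv (ref_lag K r)) (ref_point K p)"

definition bmat :: "nat \<Rightarrow> nat \<Rightarrow> nat \<Rightarrow> real"
  where "bmat K r r' = integral {0..ref_point K r} (poly (ref_lag K r'))"

lemma poly_integrable: "poly p integrable_on {a..b}" for p :: "real poly"
  by (intro integrable_continuous_real) (auto intro: continuous_intros)

text \<open>The basis sums to 1, and this is differentiated. It makes \<open>mixed\<close> blind to
  functions of one index and later turns differentiated values of \<open>\<psi>\<close> into
  differences.\<close>

lemma dmat_sum: "K \<ge> 1 \<Longrightarrow> (\<Sum>r\<le>K. dmat K p r) = 0"
proof -
  assume K: "K \<ge> 1"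
  have "1 = (\<Sum>r\<le>K. ref_lag K r)" using ref_interpolation[OF K, of 1] by simp
  then have "pderiv 1 = (\<Sum>r\<le>K. pderiv (ref_lag K r))" 
    using higher_pderiv_sum[of 1 "ref_lag K" "{..K}"] by simp
  then show ?thesis by (simp add: dmat_def flip: poly_sum)
qed

lemma bmat_0: "K \<ge> 1 \<Longrightarrow> bmat K 0 r = 0"
  by (simp add: bmat_def ref_point_ends)

lemma bmat_interpolate:
  "(\<Sum>r'\<le>K. bmat K r r' * c r') =
    integral {0..ref_point K r} (poly (\<Sum>r'\<le>K. smult (c r') (ref_lag K r')))"
proof -
  have "(\<Sum>r'\<le>K. bmat K r r' * c r') =
      (\<Sum>r'\<le>K. integral {0..ref_point K r} (\<lambda>x. c r' * poly (ref_lag K r') x))"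
    by (simp add: bmat_def mult.commute)
  also have "\<dots> = integral {0..ref_point K r} (\<lambda>x. \<Sum>r'\<le>K. c r' * poly (ref_lag K r') x)"
    by (subst integral_sum) (auto intro!: integrable_on_mult_right poly_integrable)
  also have "(\<lambda>x. \<Sum>r'\<le>K. c r' * poly (ref_lag K r') x)
      = poly (\<Sum>r'\<le>K. smult (c r') (ref_lag K r'))"
    by (simp add: poly_sum fun_eq_iff)
  finally show ?thesis .
qed

lemma integral_monom:
  assumes "t \<ge> 0"
  shows "integral {0..t} (poly (monom 1 n)) = t ^ Suc n / real (Suc n)"
proof -
  have "pderiv (monom (1 / real (Suc n)) (Suc n)) = monom 1 n" by (simp add: pderiv_monom)
  from integral_poly[OF this assms] show ?thesis by (simp add: poly_monom)
qed

text \<open>Up to degree \<open>K\<close> a monomial is its own interpolant, so every row is exact.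
  One degree higher only the last row survives, by \<open>ref_integral_eq_0\<close>; this is the
  only source of the extra order.\<close>

lemma bmat_exact:
  assumes K: "K \<ge> 1" and r: "r \<le> K" and n: "n \<le> K \<or> n = Suc K \<and> r = K \<and> K \<ge> 2"
  shows "(\<Sum>r'\<le>K. bmat K r r' * ref_point K r' ^ n) = ref_point K r ^ Suc n / real (Suc n)"
proof -
  let ?M = "monom 1 n :: real poly"
  define P where "P = (\<Sum>r'\<le>K. smult (ref_point K r' ^ n) (ref_lag K r'))"
  have t: "0 \<le> ref_point K r" using ref_point_range[OF K r] by simp
  have "integral {0..ref_point K r} (poly P) = integral {0..ref_point K r} (poly ?M)"
  proof (cases "n \<le> K")
    case True
    then have "?M = P"
      using ref_interpolation[OF K, of ?M] by (simp add: P_def degree_monom_eq poly_monom)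
    then show ?thesis by simp
  next
    case False
    with n have n: "n = Suc K" "r = K" "K \<ge> 2" by auto
    have "integral {0..1} (poly (?M - P)) = 0"
    proof (rule ref_integral_eq_0[OF n(3)])
      have "degree P \<le> K" unfolding P_def
        by (intro degree_sum_le) (auto simp: degree_ref_lag)
      then show "degree (?M - P) \<le> Suc K"
        using n by (intro degree_diff_le) (auto simp: degree_monom_eq)
      fix q assume q: "q \<le> K"
      have "poly P (ref_point K q) = (\<Sum>r'\<le>K. if r' = q then ref_point K r' ^ n else 0)"
        unfolding P_def poly_sum using q K by (intro sum.cong) (auto simp: ref_lag_node)
      then show "poly (?M - P) (ref_point K q) = 0" using q by (simp add: poly_monom)
    qed
    then have "integral {0..1} (\<lambda>x. poly ?M x - poly P x) = 0" by (simp add: poly_diff[abs_def])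
    then show ?thesis
      using n ref_point_ends[OF K] by (subst (asm) integral_diff) (auto simp: poly_integrable)
  qed
  then show ?thesis
    unfolding bmat_interpolate P_def[symmetric] integral_monom[OF t] by simp
qed

text \<open>A discrete fundamental theorem of calculus: the weights integrate the derivative of a
  basis polynomial exactly, leaving its values at the two end nodes.\<close>

lemma bmat_dmat:
  assumes K: "K \<ge> 1" and r: "r \<le> K"
  shows "(\<Sum>p\<le>K. bmat K K p * dmat K p r) = (if r = K then 1 else 0) - (if r = 0 then 1 else 0)"
proof -
  have "degree (pderiv (ref_lag K r)) \<le> K"
    using degree_ref_lag[OF r] by (simp add: degree_pderiv)
  from ref_interpolation[OF K this]
  have "(\<Sum>p\<le>K. bmat K K p * dmat K p r) = integral {0..ref_point K K} (poly (pderiv (ref_lag K r)))"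
    unfolding bmat_interpolate by (simp add: dmat_def)
  also have "\<dots> = poly (ref_lag K r) (ref_point K K) - poly (ref_lag K r) (ref_point K 0)"
    using K integral_poly[OF refl, of 0 1 "ref_lag K r"] by (simp add: ref_point_ends)
  also have "\<dots> = (if r = K then 1 else 0) - (if r = 0 then 1 else 0)"
    using K r by (simp add: ref_lag_node)
  finally show ?thesis .
qed

text \<open>The bound depends on \<open>K\<close> only, hence not on the mesh. Being at least 1, it
  allows lower powers of \<open>\<Lambda>\<close> to be absorbed into higher ones.\<close>

lemma ref_bounds: "\<exists>\<Lambda>\<ge>1. \<forall>p\<le>K. \<forall>r\<le>K. \<bar>dmat K p r\<bar> \<le> \<Lambda> \<and> \<bar>bmat K p r\<bar> \<le> \<Lambda>"
proof -
  let ?S = "(\<Sum>p\<le>K. \<Sum>r\<le>K. \<bar>dmat K p r\<bar> + \<bar>bmat K p r\<bar>)"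
  have "\<bar>dmat K p r\<bar> + \<bar>bmat K p r\<bar> \<le> ?S" if "p \<le> K" "r \<le> K" for p r
  proof -
    have "\<bar>dmat K p r\<bar> + \<bar>bmat K p r\<bar> \<le> (\<Sum>r\<le>K. \<bar>dmat K p r\<bar> + \<bar>bmat K p r\<bar>)"
      using that member_le_sum[of r "{..K}" "\<lambda>r. \<bar>dmat K p r\<bar> + \<bar>bmat K p r\<bar>"] by simp
    also have "\<dots> \<le> ?S"
      using that member_le_sum[of p "{..K}" "\<lambda>p. \<Sum>r\<le>K. \<bar>dmat K p r\<bar> + \<bar>bmat K p r\<bar>"]
      by (simp add: sum_nonneg)
    finally show ?thesis .
  qed
  then have "\<bar>dmat K p r\<bar> \<le> max 1 ?S \<and> \<bar>bmat K p r\<bar> \<le> max 1 ?S" if "p \<le> K" "r \<le> K" for p r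
    using that by (smt (verit, best))
  then show ?thesis by (intro exI[of _ "max 1 ?S"]) simp
qed

text \<open>
  Inserting Taylor polynomials at the left end point leaves only the remainders, because the
  collocation rule \<open>bmat\<close> integrates the intermediate terms exactly.
\<close>

lemma collocation_error:
  fixes Df :: "nat \<Rightarrow> real \<Rightarrow> 'b::banach"
  assumes K: "K \<ge> 1" and r: "r \<le> K" and h: "h > 0" and P: "P \<ge> 2"
    and ex: "P \<le> K + 2 \<or> P = K + 3 \<and> r = K \<and> K \<ge> 2"
    and D: "\<And>n t. n < P \<Longrightarrow> t \<in> {c..c + h} \<Longrightarrow>
      (Df n has_vector_derivative Df (Suc n) t) (at t within {c..c + h})"
    and M: "\<And>t. t \<in> {c..c + h} \<Longrightarrow> norm (Df P t) \<le> M"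
    and \<Lambda>: "\<And>r'. r' \<le> K \<Longrightarrow> \<bar>bmat K r r'\<bar> \<le> \<Lambda>"
  shows "norm (Df 0 (c + h * ref_point K r) - Df 0 c
      - h *\<^sub>R (\<Sum>r'\<le>K. bmat K r r' *\<^sub>R Df 1 (c + h * ref_point K r')))
    \<le> (1 + (real K + 1) * \<Lambda>) * M * h ^ P"
proof -
  define \<theta> where "\<theta> = ref_point K"
  have \<theta>: "0 \<le> \<theta> q" "\<theta> q \<le> 1" if "q \<le> K" for q
    using ref_point_range[OF K that] by (auto simp: \<theta>_def)
  have M0: "0 \<le> M" using M[of c] h by (auto intro: order_trans[OF norm_ge_zero])
  \<comment> \<open>Taylor expansion with integral remainder, applied with \<open>j = 0\<close> to
    the function and with \<open>j = 1\<close> to its derivative; the factorial in the remainder is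
    bounded below by 1.\<close>
  have taylor: "norm (Df j (c + h * \<theta> q) - (\<Sum>i<P - j. ((h * \<theta> q) ^ i / fact i) *\<^sub>R Df (i + j) c))
      \<le> M * h ^ (P - j)" if j: "j < P" and q: "q \<le> K" for j q
  proof -
    define b where "b = c + h * \<theta> q"
    have b: "c \<le> b" "b \<le> c + h" using \<theta>[OF q] h mult_left_le[of "\<theta> q" h] by (auto simp: b_def)
    have "((\<lambda>x. ((b - x) ^ (P - j - 1) / fact (P - j - 1)) *\<^sub>R Df (P - j + j) x) has_integral
        Df j b - (\<Sum>i<P - j. ((b - c) ^ i / fact i) *\<^sub>R Df (i + j) c)) {c..b}"
    proof (rule Taylor_has_integral[where f = "Df j"])
      show "(Df (m + j) has_vector_derivative Df (Suc m + j) t) (at t within {c..b})"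
        if "m < P - j" "c \<le> t" "t \<le> b" for m t
      proof (rule has_vector_derivative_within_subset)
        show "(Df (m + j) has_vector_derivative Df (Suc m + j) t) (at t within {c..c + h})"
          using D[of "m + j" t] that b by auto
      qed (use b in auto)
    qed (use j b in auto)
    then have "norm (Df j b - (\<Sum>i<P - j. ((b - c) ^ i / fact i) *\<^sub>R Df (i + j) c))
        \<le> (h ^ (P - j - 1) * M) * measure lborel {c..b}"
    proof (rule has_integral_bound_real[OF _ finite.emptyI, rotated])
      fix x assume "x \<in> {c..b} - {}"
      then have x: "x \<in> {c..b}" by simp
      have "\<bar>(b - x) ^ (P - j - 1) / fact (P - j - 1)\<bar> \<le> h ^ (P - j - 1) / 1"
        unfolding abs_divide using x b by (intro frac_le) (auto simp: power_abs intro!: power_mono)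
      then show "norm (((b - x) ^ (P - j - 1) / fact (P - j - 1)) *\<^sub>R Df (P - j + j) x)
          \<le> h ^ (P - j - 1) * M"
        unfolding norm_scaleR real_norm_def using M[of x] x b j h by (intro mult_mono) auto
    qed (use h M0 in auto)
    also have "\<dots> \<le> (h ^ (P - j - 1) * M) * h"
      using b h M0 by (intro mult_left_mono) auto
    also have "\<dots> = M * h ^ (P - j)"
      using j by (cases "P - j") auto
    finally show ?thesis by (simp add: b_def)
  qed
  define T0 where "T0 q = (\<Sum>i<P. ((h * \<theta> q) ^ i / fact i) *\<^sub>R Df i c)" for q
  define T1 where "T1 q = (\<Sum>i<P - 1. ((h * \<theta> q) ^ i / fact i) *\<^sub>R Df (i + 1) c)" for q
  have exact: "h *\<^sub>R (\<Sum>r'\<le>K. bmat K r r' *\<^sub>R T1 r') = T0 r - Df 0 c"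
  proof -
    have "h *\<^sub>R (\<Sum>r'\<le>K. bmat K r r' *\<^sub>R T1 r')
        = (\<Sum>r'\<le>K. \<Sum>i<P - 1. (h ^ Suc i / fact i * (bmat K r r' * \<theta> r' ^ i)) *\<^sub>R Df (i + 1) c)"
      unfolding T1_def scaleR_sum_right
      by (intro sum.cong refl) (simp add: power_mult_distrib field_simps)
    also have "\<dots> = (\<Sum>i<P - 1. \<Sum>r'\<le>K. (h ^ Suc i / fact i * (bmat K r r' * \<theta> r' ^ i)) *\<^sub>R Df (i + 1) c)"
      by (rule sum.swap)
    also have "\<dots> = (\<Sum>i<P - 1. (h ^ Suc i / fact i * (\<Sum>r'\<le>K. bmat K r r' * \<theta> r' ^ i)) *\<^sub>R Df (i + 1) c)"
      by (simp add: sum_distrib_left scaleR_sum_left)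
    also have "\<dots> = (\<Sum>i<P - 1. ((h * \<theta> r) ^ Suc i / fact (Suc i)) *\<^sub>R Df (Suc i) c)"
    proof (intro sum.cong refl)
      \<comment> \<open>The expansion of the derivative stops at degree \<open>P - 2\<close>, which
        is at most \<open>K\<close>, or \<open>K + 1\<close> in the last row: the range of
        \<open>bmat_exact\<close>.\<close>
      fix i assume "i \<in> {..<P - 1}"
      then have "i \<le> K \<or> i = Suc K \<and> r = K \<and> K \<ge> 2" using ex by auto
      from bmat_exact[OF K r this]
      have *: "(\<Sum>r'\<le>K. bmat K r r' * \<theta> r' ^ i) = \<theta> r ^ Suc i / real (Suc i)" by (simp add: \<theta>_def)
      show "(h ^ Suc i / fact i * (\<Sum>r'\<le>K. bmat K r r' * \<theta> r' ^ i)) *\<^sub>R Df (i + 1) c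
          = ((h * \<theta> r) ^ Suc i / fact (Suc i)) *\<^sub>R Df (Suc i) c"
        unfolding * by (simp add: power_mult_distrib field_simps)
    qed
    \<comment> \<open>Integration raises each index by one, so only the term of index 0 of
      \<open>T0\<close> is missing.\<close>
    also have "\<dots> = T0 r - Df 0 c"
    proof -
      have "P = Suc (P - 1)" using P by simp
      then have "T0 r = (\<Sum>i<Suc (P - 1). ((h * \<theta> r) ^ i / fact i) *\<^sub>R Df i c)"
        unfolding T0_def by simp
      then show ?thesis unfolding sum.lessThan_Suc_shift by (simp del: power_Suc fact_Suc)
    qed
    finally show ?thesis .
  qed
  \<comment> \<open>Subtracting the exact identity leaves one remainder of order \<open>P\<close>
    for the function, and \<open>K + 1\<close> remainders of order \<open>P - 1\<close> for the
    derivative, weighted by at most \<open>\<Lambda>\<close> and multiplied by \<open>h\<close>.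
    This is the constant of the claim.\<close>
  have "Df 0 (c + h * \<theta> r) - Df 0 c - h *\<^sub>R (\<Sum>r'\<le>K. bmat K r r' *\<^sub>R Df 1 (c + h * \<theta> r'))
      = (Df 0 (c + h * \<theta> r) - T0 r) - h *\<^sub>R (\<Sum>r'\<le>K. bmat K r r' *\<^sub>R (Df 1 (c + h * \<theta> r') - T1 r'))"
    using exact by (simp add: sum_subtractf scaleR_diff_right)
  also have "norm \<dots> \<le> M * h ^ P + h * (\<Sum>r'\<le>K. \<Lambda> * (M * h ^ (P - 1)))"
  proof (rule order_trans[OF norm_triangle_ineq4 add_mono])
    show "norm (Df 0 (c + h * \<theta> r) - T0 r) \<le> M * h ^ P"
      using taylor[of 0 r] P r by (simp add: T0_def)
    have "norm (\<Sum>r'\<le>K. bmat K r r' *\<^sub>R (Df 1 (c + h * \<theta> r') - T1 r')) \<le> (\<Sum>r'\<le>K. \<Lambda> * (M * h ^ (P - 1)))"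
    proof (rule sum_norm_le)
      fix r' assume "r' \<in> {..K}"
      then show "norm (bmat K r r' *\<^sub>R (Df 1 (c + h * \<theta> r') - T1 r')) \<le> \<Lambda> * (M * h ^ (P - 1))"
        using taylor[of 1 r'] P \<Lambda>[of r'] unfolding norm_scaleR T1_def
        by (intro mult_mono) auto
    qed
    then show "norm (h *\<^sub>R (\<Sum>r'\<le>K. bmat K r r' *\<^sub>R (Df 1 (c + h * \<theta> r') - T1 r')))
        \<le> h * (\<Sum>r'\<le>K. \<Lambda> * (M * h ^ (P - 1)))"
      using h by simp
  qed
  also have "\<dots> = (1 + (real K + 1) * \<Lambda>) * M * h ^ P"
    using P by (cases P) (auto simp: algebra_simps)
  finally show ?thesis by (simp add: \<theta>_def add.commute)
qed

text \<open>
  \<open>V r q\<close> are the nodal values of a global flux potential on an element with steps \<open>h1\<close> and \<open>h2\<close>,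
  and \<open>mixed K V p s / (h1 h2)\<close> is its mixed derivative at a node.
\<close>

definition mixed :: "nat \<Rightarrow> (nat \<Rightarrow> nat \<Rightarrow> 'b::real_vector) \<Rightarrow> nat \<Rightarrow> nat \<Rightarrow> 'b"
  where "mixed K V p s = (\<Sum>r\<le>K. \<Sum>q\<le>K. (dmat K p r * dmat K s q) *\<^sub>R V r q)"

lemma mixed_add: "mixed K (\<lambda>r q. V r q + V' r q) p s = mixed K V p s + mixed K V' p s"
  by (simp add: mixed_def scaleR_add_right sum.distrib)

lemma mixed_function_of_fst: "K \<ge> 1 \<Longrightarrow> mixed K (\<lambda>r q. c r) p s = 0"
proof -
  assume K: "K \<ge> 1"
  have "mixed K (\<lambda>r q. c r) p s = (\<Sum>r\<le>K. (dmat K p r * (\<Sum>q\<le>K. dmat K s q)) *\<^sub>R c r)"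
    by (simp add: mixed_def sum_distrib_left scaleR_sum_left)
  then show ?thesis by (simp add: dmat_sum[OF K])
qed

lemma mixed_function_of_snd: "K \<ge> 1 \<Longrightarrow> mixed K (\<lambda>r q. c q) p s = 0"
proof -
  assume K: "K \<ge> 1"
  have "mixed K (\<lambda>r q. c q) p s = (\<Sum>q\<le>K. \<Sum>r\<le>K. (dmat K p r * dmat K s q) *\<^sub>R c q)"
    unfolding mixed_def by (rule sum.swap)
  also have "\<dots> = (\<Sum>q\<le>K. ((\<Sum>r\<le>K. dmat K p r) * dmat K s q) *\<^sub>R c q)"
    by (simp add: sum_distrib_right scaleR_sum_left)
  finally show ?thesis by (simp add: dmat_sum[OF K])
qed

lemma mixed_cong:
  "(\<And>r q. r \<le> K \<Longrightarrow> q \<le> K \<Longrightarrow> V r q = V' r q) \<Longrightarrow> mixed K V p s = mixed K V' p s"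
  unfolding mixed_def by (intro sum.cong refl) auto

lemma sum_scaleR_delta_diff:
  fixes V :: "nat \<Rightarrow> 'b::real_vector"
  shows "(\<Sum>r\<le>K. ((if r = K then 1 else 0) - (if r = 0 then 1 else (0::real))) *\<^sub>R V r) = V K - V 0"
proof -
  have "((if r = K then 1 else 0) - (if r = 0 then 1 else (0::real))) *\<^sub>R V r =
      (if r = K then V r else 0) - (if r = 0 then V r else 0)" for r
    by (auto simp: scaleR_diff_left)
  then show ?thesis by (simp add: sum_subtractf)
qed

text \<open>By \<open>bmat_dmat\<close>, differentiating and then integrating in one direction
  leaves the difference of the end values. Doing so in both directions leaves the second difference
  over the corners.\<close>

lemma mixed_quadrature:
  assumes K: "K \<ge> 1"
  shows "(\<Sum>p\<le>K. \<Sum>s\<le>K. (bmat K K p * bmat K K s) *\<^sub>R mixed K V p s)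
    = (V K K - V K 0) - (V 0 K - V 0 0)"
proof -
  have inner: "(\<Sum>s\<le>K. bmat K K s *\<^sub>R (\<Sum>q\<le>K. dmat K s q *\<^sub>R U q)) = U K - U 0"
    for U :: "nat \<Rightarrow> 'a"
  proof -
    have "(\<Sum>s\<le>K. bmat K K s *\<^sub>R (\<Sum>q\<le>K. dmat K s q *\<^sub>R U q))
        = (\<Sum>s\<le>K. \<Sum>q\<le>K. (bmat K K s * dmat K s q) *\<^sub>R U q)"
      by (simp add: scaleR_sum_right)
    also have "\<dots> = (\<Sum>q\<le>K. (\<Sum>s\<le>K. bmat K K s * dmat K s q) *\<^sub>R U q)"
      by (subst sum.swap) (simp add: scaleR_sum_left)
    also have "\<dots> = (\<Sum>q\<le>K. ((if q = K then 1 else 0) - (if q = 0 then 1 else (0::real))) *\<^sub>R U q)"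
      by (intro sum.cong refl) (simp only: bmat_dmat[OF K] atMost_iff)
    finally show ?thesis by (simp only: sum_scaleR_delta_diff)
  qed
  have "(\<Sum>p\<le>K. \<Sum>s\<le>K. (bmat K K p * bmat K K s) *\<^sub>R mixed K V p s)
      = (\<Sum>p\<le>K. bmat K K p *\<^sub>R (\<Sum>r\<le>K. dmat K p r *\<^sub>R
          (\<Sum>s\<le>K. bmat K K s *\<^sub>R (\<Sum>q\<le>K. dmat K s q *\<^sub>R V r q))))"
  proof (intro sum.cong refl)
    fix p
    have "(\<Sum>s\<le>K. (bmat K K p * bmat K K s) *\<^sub>R mixed K V p s)
        = (\<Sum>s\<le>K. \<Sum>r\<le>K. \<Sum>q\<le>K. (bmat K K p * bmat K K s * dmat K p r * dmat K s q) *\<^sub>R V r q)"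
      by (simp add: mixed_def scaleR_sum_right mult.assoc)
    also have "\<dots> = (\<Sum>r\<le>K. \<Sum>s\<le>K. \<Sum>q\<le>K. (bmat K K p * bmat K K s * dmat K p r * dmat K s q) *\<^sub>R V r q)"
      by (rule sum.swap)
    also have "\<dots> = bmat K K p *\<^sub>R (\<Sum>r\<le>K. dmat K p r *\<^sub>R
          (\<Sum>s\<le>K. bmat K K s *\<^sub>R (\<Sum>q\<le>K. dmat K s q *\<^sub>R V r q)))"
      by (simp add: scaleR_sum_right mult_ac)
    finally show "(\<Sum>s\<le>K. (bmat K K p * bmat K K s) *\<^sub>R mixed K V p s) = \<dots>" .
  qed
  also have "\<dots> = (V K K - V K 0) - (V 0 K - V 0 0)"
    by (simp only: inner)
  finally show ?thesis .
qed

text \<open>The defect of Lobatto IIIA for the equation \<open>f' = g\<close> at node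
  \<open>r\<close>. Values of \<open>f\<close> and \<open>g\<close> are independent arguments, so
  that the following algebra is free of calculus.\<close>

definition coll_err :: "nat \<Rightarrow> real \<Rightarrow> (nat \<Rightarrow> 'b::real_vector) \<Rightarrow> (nat \<Rightarrow> 'b) \<Rightarrow> nat \<Rightarrow> 'b"
  where "coll_err K h f g r = f r - f 0 - h *\<^sub>R (\<Sum>r'\<le>K. bmat K r r' *\<^sub>R g r')"

text \<open>
  Since the source is the divergence of the flux, the source potential cancels against the flux
  potentials up to the collocation errors \<open>e1\<close>, \<open>e2\<close> in each direction and functions of one index.
\<close>

lemma mixed_potential:
  fixes f1 f2 g1 g2 :: "nat \<Rightarrow> nat \<Rightarrow> 'b::real_vector" and K :: nat and h1 h2 :: real
  defines "e1 \<equiv> \<lambda>r q. coll_err K h1 (\<lambda>r'. f1 r' q) (\<lambda>r'. g1 r' q) r"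
    and "e2 \<equiv> \<lambda>r q. coll_err K h2 (f2 r) (g2 r) q"
  assumes K: "K \<ge> 1"
    and V: "\<And>r q. r \<le> K \<Longrightarrow> q \<le> K \<Longrightarrow> V r q = h2 *\<^sub>R (\<Sum>q'\<le>K. bmat K q q' *\<^sub>R f1 r q')
        + h1 *\<^sub>R (\<Sum>r'\<le>K. bmat K r r' *\<^sub>R f2 r' q)
        - (h1 * h2) *\<^sub>R (\<Sum>r'\<le>K. \<Sum>q'\<le>K. (bmat K r r' * bmat K q q') *\<^sub>R (g1 r' q' + g2 r' q'))
        + c r + c' q"
  shows "mixed K V p s = mixed K (\<lambda>r q. h2 *\<^sub>R (\<Sum>q'\<le>K. bmat K q q' *\<^sub>R e1 r q')
      + h1 *\<^sub>R (\<Sum>r'\<le>K. bmat K r r' *\<^sub>R e2 r' q)) p s"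
proof -
  \<comment> \<open>Collocation in the second direction measures \<open>f2\<close> from its value at
    index 0. That value, integrated along the first direction, depends on \<open>r\<close> alone and
    joins \<open>c\<close>; symmetrically for \<open>f1\<close> and \<open>c'\<close>.\<close>
  define d where "d r = c r + h1 *\<^sub>R (\<Sum>r'\<le>K. bmat K r r' *\<^sub>R f2 r' 0)" for r
  define d' where "d' q = c' q + h2 *\<^sub>R (\<Sum>q'\<le>K. bmat K q q' *\<^sub>R f1 0 q')" for q
  have "V r q = h2 *\<^sub>R (\<Sum>q'\<le>K. bmat K q q' *\<^sub>R e1 r q')
      + h1 *\<^sub>R (\<Sum>r'\<le>K. bmat K r r' *\<^sub>R e2 r' q) + d r + d' q" if "r \<le> K" "q \<le> K" for r q
  proof -
    have 1: "h2 *\<^sub>R (\<Sum>q'\<le>K. bmat K q q' *\<^sub>R e1 r q') =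
        h2 *\<^sub>R (\<Sum>q'\<le>K. bmat K q q' *\<^sub>R f1 r q') - h2 *\<^sub>R (\<Sum>q'\<le>K. bmat K q q' *\<^sub>R f1 0 q')
        - (h1 * h2) *\<^sub>R (\<Sum>r'\<le>K. \<Sum>q'\<le>K. (bmat K r r' * bmat K q q') *\<^sub>R g1 r' q')"
    proof -
      have "(\<Sum>q'\<le>K. bmat K q q' *\<^sub>R h1 *\<^sub>R (\<Sum>r'\<le>K. bmat K r r' *\<^sub>R g1 r' q'))
          = h1 *\<^sub>R (\<Sum>q'\<le>K. \<Sum>r'\<le>K. (bmat K r r' * bmat K q q') *\<^sub>R g1 r' q')"
        by (simp add: scaleR_sum_right mult_ac)
      also have "\<dots> = h1 *\<^sub>R (\<Sum>r'\<le>K. \<Sum>q'\<le>K. (bmat K r r' * bmat K q q') *\<^sub>R g1 r' q')"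
        by (subst sum.swap) (rule refl)
      finally show ?thesis
        by (simp add: e1_def coll_err_def scaleR_diff_right sum_subtractf mult.commute)
    qed
    have 2: "h1 *\<^sub>R (\<Sum>r'\<le>K. bmat K r r' *\<^sub>R e2 r' q) =
        h1 *\<^sub>R (\<Sum>r'\<le>K. bmat K r r' *\<^sub>R f2 r' q) - h1 *\<^sub>R (\<Sum>r'\<le>K. bmat K r r' *\<^sub>R f2 r' 0)
        - (h1 * h2) *\<^sub>R (\<Sum>r'\<le>K. \<Sum>q'\<le>K. (bmat K r r' * bmat K q q') *\<^sub>R g2 r' q')"
    proof -
      have "(\<Sum>r'\<le>K. bmat K r r' *\<^sub>R h2 *\<^sub>R (\<Sum>q'\<le>K. bmat K q q' *\<^sub>R g2 r' q'))
          = h2 *\<^sub>R (\<Sum>r'\<le>K. \<Sum>q'\<le>K. (bmat K r r' * bmat K q q') *\<^sub>R g2 r' q')"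
        by (simp add: scaleR_sum_right mult_ac)
      then show ?thesis
        by (simp add: e2_def coll_err_def scaleR_diff_right sum_subtractf)
    qed
    show ?thesis
      unfolding V[OF that] 1 2 d_def d'_def
      by (simp add: scaleR_add_right sum.distrib algebra_simps)
  qed
  then have "mixed K V p s = mixed K (\<lambda>r q. h2 *\<^sub>R (\<Sum>q'\<le>K. bmat K q q' *\<^sub>R e1 r q')
      + h1 *\<^sub>R (\<Sum>r'\<le>K. bmat K r r' *\<^sub>R e2 r' q) + d r + d' q) p s"
    by (intro mixed_cong) simp
  then show ?thesis by (simp only: mixed_add mixed_function_of_fst[OF K] mixed_function_of_snd[OF K] add_0_right)
qed

lemma coll_err_0: "K \<ge> 1 \<Longrightarrow> coll_err K h f g 0 = 0"
  by (simp add: coll_err_def bmat_0)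

text \<open>The estimate in terms of nodal values only. \<open>Z\<close> stands for the SUPG term at
  a quadrature node, which is smaller than the residual by a factor \<open>h\<close>.
  \<open>\<epsilon>\<close> bounds all collocation errors, \<open>\<epsilon>'\<close> those at the
  last node; only the mean value of the residual profits from \<open>\<epsilon>'\<close>.\<close>

lemma element_estimate:
  fixes f1 f2 g1 g2 :: "nat \<Rightarrow> nat \<Rightarrow> 'b::real_normed_vector" and Z :: "nat \<Rightarrow> nat \<Rightarrow> 'b"
    and K :: nat and h1 h2 :: real
  defines "e1 \<equiv> \<lambda>r q. coll_err K h1 (\<lambda>r'. f1 r' q) (\<lambda>r'. g1 r' q) r"
    and "e2 \<equiv> \<lambda>r q. coll_err K h2 (f2 r) (g2 r) q"
  assumes K: "K \<ge> 1"
    and \<Lambda>: "\<Lambda> \<ge> 1" "\<And>p r. p \<le> K \<Longrightarrow> r \<le> K \<Longrightarrow> \<bar>dmat K p r\<bar> \<le> \<Lambda> \<and> \<bar>bmat K p r\<bar> \<le> \<Lambda>"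
    and h: "0 < h" "0 < h1" "0 < h2" "h1 \<le> \<kappa> * h" "h2 \<le> \<kappa> * h"
    and V: "\<And>r q. r \<le> K \<Longrightarrow> q \<le> K \<Longrightarrow> V r q = h2 *\<^sub>R (\<Sum>q'\<le>K. bmat K q q' *\<^sub>R f1 r q')
        + h1 *\<^sub>R (\<Sum>r'\<le>K. bmat K r r' *\<^sub>R f2 r' q)
        - (h1 * h2) *\<^sub>R (\<Sum>r'\<le>K. \<Sum>q'\<le>K. (bmat K r r' * bmat K q q') *\<^sub>R (g1 r' q' + g2 r' q'))
        + c r + c' q"
    and e: "\<And>r q. r \<le> K \<Longrightarrow> q \<le> K \<Longrightarrow> norm (e1 r q) \<le> \<epsilon>"
      "\<And>r q. r \<le> K \<Longrightarrow> q \<le> K \<Longrightarrow> norm (e2 r q) \<le> \<epsilon>"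
    and e': "\<And>q. q \<le> K \<Longrightarrow> norm (e1 K q) \<le> \<epsilon>'" "\<And>r. r \<le> K \<Longrightarrow> norm (e2 r K) \<le> \<epsilon>'"
    and B: "0 \<le> B" "0 \<le> B'"
    and \<psi>: "\<bar>\<psi> 0 0\<bar> \<le> M" "\<And>p s. p \<le> K \<Longrightarrow> s \<le> K \<Longrightarrow> \<bar>\<psi> p s - \<psi> 0 0\<bar> \<le> B * h"
    and Z: "\<And>p s. p \<le> K \<Longrightarrow> s \<le> K \<Longrightarrow>
      norm (Z p s) \<le> B' * h * norm ((1 / (h1 * h2)) *\<^sub>R mixed K V p s)"
  shows "norm (\<Sum>p\<le>K. \<Sum>s\<le>K. (h1 * bmat K K p * (h2 * bmat K K s)) *\<^sub>R
      (\<psi> p s *\<^sub>R (1 / (h1 * h2)) *\<^sub>R mixed K V p s + Z p s))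
    \<le> 2 * (real K + 1) ^ 5 * \<Lambda> ^ 5 * \<kappa> * (M * h * \<epsilon>' + (B + B') * h * h * \<epsilon>)"
proof -
  \<comment> \<open>\<open>V\<close> without its parts that depend on one index: the mixed
    differences are the same, but these nodal values are small.\<close>
  define V' where "V' r q = h2 *\<^sub>R (\<Sum>q'\<le>K. bmat K q q' *\<^sub>R e1 r q')
      + h1 *\<^sub>R (\<Sum>r'\<le>K. bmat K r r' *\<^sub>R e2 r' q)" for r q
  define R where "R p s = mixed K V p s" for p s
  define k where "k = real K + 1"
  have k: "k \<ge> 1" by (simp add: k_def)
  have \<kappa>: "\<kappa> > 0" using h by (smt (verit) mult_nonpos_nonneg)
  have RV': "R p s = mixed K V' p s" for p s
    unfolding R_def V'_def e1_def e2_def using mixed_potential[OF K V] by blast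
  have \<epsilon>: "0 \<le> \<epsilon>" "0 \<le> \<epsilon>'" using e(1)[of 0 0] e'(1)[of 0] by (auto intro: order_trans[OF norm_ge_zero])
  have sum1: "norm (\<Sum>q'\<le>K. bmat K q q' *\<^sub>R x q') \<le> k * \<Lambda> * \<eta>"
    if "q \<le> K" "\<And>q'. q' \<le> K \<Longrightarrow> norm (x q') \<le> \<eta>" for x :: "nat \<Rightarrow> 'b" and \<eta> q
  proof -
    have "norm (\<Sum>q'\<le>K. bmat K q q' *\<^sub>R x q') \<le> (\<Sum>q'\<le>K. \<Lambda> * \<eta>)"
    proof (rule sum_norm_le)
      fix q' assume "q' \<in> {..K}"
      then show "norm (bmat K q q' *\<^sub>R x q') \<le> \<Lambda> * \<eta>"
        unfolding norm_scaleR using that \<Lambda> by (intro mult_mono) auto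
    qed
    then show ?thesis by (simp add: k_def algebra_simps)
  qed
  have V'b: "norm (V' r q) \<le> 2 * (k * \<Lambda> * \<kappa> * h * \<eta>)"
    if "r \<le> K" "q \<le> K" "\<And>q'. q' \<le> K \<Longrightarrow> norm (e1 r q') \<le> \<eta>" "\<And>r'. r' \<le> K \<Longrightarrow> norm (e2 r' q) \<le> \<eta>"
    for r q \<eta>
  proof -
    have \<eta>: "0 \<le> \<eta>" using that(3)[of 0] by (auto intro: order_trans[OF norm_ge_zero])
    have "norm (V' r q) \<le> h2 * (k * \<Lambda> * \<eta>) + h1 * (k * \<Lambda> * \<eta>)"
      unfolding V'_def
    proof (rule order_trans[OF norm_triangle_ineq add_mono])
      show "norm (h2 *\<^sub>R (\<Sum>q'\<le>K. bmat K q q' *\<^sub>R e1 r q')) \<le> h2 * (k * \<Lambda> * \<eta>)"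
        using sum1[of q "e1 r" \<eta>] that h by simp
      show "norm (h1 *\<^sub>R (\<Sum>r'\<le>K. bmat K r r' *\<^sub>R e2 r' q)) \<le> h1 * (k * \<Lambda> * \<eta>)"
        using sum1[of r "\<lambda>r'. e2 r' q" \<eta>] that h by simp
    qed
    also have "\<dots> \<le> (\<kappa> * h) * (k * \<Lambda> * \<eta>) + (\<kappa> * h) * (k * \<Lambda> * \<eta>)"
      using h k \<Lambda>(1) \<eta> by (intro add_mono mult_right_mono) auto
    finally show ?thesis by (simp add: algebra_simps)
  qed
  have Rb: "norm (R p s) \<le> k\<^sup>2 * \<Lambda>\<^sup>2 * (2 * (k * \<Lambda> * \<kappa> * h * \<epsilon>))" if ps: "p \<le> K" "s \<le> K" for p s
  proof -
    have "norm (R p s) \<le> (\<Sum>r\<le>K. \<Sum>q\<le>K. (\<Lambda> * \<Lambda>) * (2 * (k * \<Lambda> * \<kappa> * h * \<epsilon>)))"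
      unfolding RV' mixed_def
    proof (intro sum_norm_le)
      fix r q assume "r \<in> {..K}" "q \<in> {..K}"
      then show "norm ((dmat K p r * dmat K s q) *\<^sub>R V' r q) \<le> (\<Lambda> * \<Lambda>) * (2 * (k * \<Lambda> * \<kappa> * h * \<epsilon>))"
        unfolding norm_scaleR abs_mult real_norm_def using \<Lambda> ps V'b[of r q \<epsilon>] e
        by (intro mult_mono) auto
    qed
    also have "\<dots> = k\<^sup>2 * \<Lambda>\<^sup>2 * (2 * (k * \<Lambda> * \<kappa> * h * \<epsilon>))"
      by (simp add: k_def power2_eq_square algebra_simps)
    finally show ?thesis .
  qed
  \<comment> \<open>At index 0 the row of \<open>bmat\<close> and the collocation errors in the
    respective direction vanish, so three of the corners contribute nothing. At the remaining corner
    only errors at the last node occur, which are bounded by \<open>\<epsilon>'\<close>.\<close>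
  have main: "norm (\<Sum>p\<le>K. \<Sum>s\<le>K. (bmat K K p * bmat K K s) *\<^sub>R R p s) \<le> 2 * (k * \<Lambda> * \<kappa> * h * \<epsilon>')"
  proof -
    have "V' K 0 = h2 *\<^sub>R 0 + h1 *\<^sub>R (\<Sum>r'\<le>K. bmat K K r' *\<^sub>R e2 r' 0)" "V' 0 0 = 0"
      "V' 0 K = h1 *\<^sub>R 0 + h2 *\<^sub>R (\<Sum>q'\<le>K. bmat K K q' *\<^sub>R e1 0 q')"
      using bmat_0[OF K] by (auto simp: V'_def)
    moreover have "e1 0 q = 0" "e2 q 0 = 0" for q
      by (simp_all add: e1_def e2_def coll_err_0[OF K])
    ultimately have "V' K 0 = 0" "V' 0 0 = 0" "V' 0 K = 0"
      by simp_all
    then have "(\<Sum>p\<le>K. \<Sum>s\<le>K. (bmat K K p * bmat K K s) *\<^sub>R R p s) = V' K K"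
      unfolding RV' mixed_quadrature[OF K] by simp
    then show ?thesis using V'b[of K K \<epsilon>'] e' by simp
  qed
  \<comment> \<open>Freezing \<open>\<psi>\<close> at one corner isolates the mean value of the
    residual; its variation and the SUPG term each carry a factor \<open>h\<close> and tolerate the
    weaker bound \<open>\<epsilon>\<close>.\<close>
  have split: "(h1 * bmat K K p * (h2 * bmat K K s)) *\<^sub>R
      (\<psi> p s *\<^sub>R (1 / (h1 * h2)) *\<^sub>R mixed K V p s + Z p s)
    = \<psi> 0 0 *\<^sub>R (bmat K K p * bmat K K s) *\<^sub>R R p s + (bmat K K p * bmat K K s) *\<^sub>R
      ((\<psi> p s - \<psi> 0 0) *\<^sub>R R p s + (h1 * h2) *\<^sub>R Z p s)" for p s
    using h by (simp add: R_def algebra_simps scaleR_add_right scaleR_diff_left)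
  have Wb: "norm ((bmat K K p * bmat K K s) *\<^sub>R ((\<psi> p s - \<psi> 0 0) *\<^sub>R R p s + (h1 * h2) *\<^sub>R Z p s))
      \<le> (\<Lambda> * \<Lambda>) * ((B + B') * h * (k\<^sup>2 * \<Lambda>\<^sup>2 * (2 * (k * \<Lambda> * \<kappa> * h * \<epsilon>))))"
    if ps: "p \<le> K" "s \<le> K" for p s
  proof -
    have "norm ((h1 * h2) *\<^sub>R Z p s) = h1 * h2 * norm (Z p s)" using h by simp
    also have "\<dots> \<le> h1 * h2 * (B' * h * norm ((1 / (h1 * h2)) *\<^sub>R mixed K V p s))"
      using Z[OF ps] h by (intro mult_left_mono) auto
    also have "\<dots> = B' * h * norm (R p s)" using h by (simp add: R_def)
    finally have 1: "norm ((h1 * h2) *\<^sub>R Z p s) \<le> B' * h * norm (R p s)" .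
    have 2: "norm ((\<psi> p s - \<psi> 0 0) *\<^sub>R R p s) \<le> B * h * norm (R p s)"
      using \<psi>(2)[OF ps] by (simp add: mult_right_mono)
    have "norm ((\<psi> p s - \<psi> 0 0) *\<^sub>R R p s + (h1 * h2) *\<^sub>R Z p s) \<le> (B + B') * h * norm (R p s)"
      using norm_triangle_mono[OF 2 1] by (simp add: algebra_simps)
    also have "(B + B') * h * norm (R p s) \<le> (B + B') * h * (k\<^sup>2 * \<Lambda>\<^sup>2 * (2 * (k * \<Lambda> * \<kappa> * h * \<epsilon>)))"
      using Rb[OF ps] B h by (intro mult_left_mono) auto
    finally show ?thesis
      unfolding norm_scaleR abs_mult using \<Lambda> ps by (intro mult_mono) auto
  qed
  have "norm (\<Sum>p\<le>K. \<Sum>s\<le>K. (h1 * bmat K K p * (h2 * bmat K K s)) *\<^sub>R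
      (\<psi> p s *\<^sub>R (1 / (h1 * h2)) *\<^sub>R mixed K V p s + Z p s))
    = norm (\<psi> 0 0 *\<^sub>R (\<Sum>p\<le>K. \<Sum>s\<le>K. (bmat K K p * bmat K K s) *\<^sub>R R p s)
      + (\<Sum>p\<le>K. \<Sum>s\<le>K. (bmat K K p * bmat K K s) *\<^sub>R
      ((\<psi> p s - \<psi> 0 0) *\<^sub>R R p s + (h1 * h2) *\<^sub>R Z p s)))"
    unfolding split sum.distrib scaleR_sum_right ..
  also have "\<dots> \<le> M * (2 * (k * \<Lambda> * \<kappa> * h * \<epsilon>'))
      + k\<^sup>2 * ((\<Lambda> * \<Lambda>) * ((B + B') * h * (k\<^sup>2 * \<Lambda>\<^sup>2 * (2 * (k * \<Lambda> * \<kappa> * h * \<epsilon>)))))"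
  proof (rule order_trans[OF norm_triangle_ineq add_mono])
    show "norm (\<psi> 0 0 *\<^sub>R (\<Sum>p\<le>K. \<Sum>s\<le>K. (bmat K K p * bmat K K s) *\<^sub>R R p s))
        \<le> M * (2 * (k * \<Lambda> * \<kappa> * h * \<epsilon>'))"
      unfolding norm_scaleR using \<psi>(1) main by (intro mult_mono) auto
    have "norm (\<Sum>p\<le>K. \<Sum>s\<le>K. (bmat K K p * bmat K K s) *\<^sub>R
        ((\<psi> p s - \<psi> 0 0) *\<^sub>R R p s + (h1 * h2) *\<^sub>R Z p s))
      \<le> (\<Sum>p\<le>K. \<Sum>s\<le>K. (\<Lambda> * \<Lambda>) * ((B + B') * h * (k\<^sup>2 * \<Lambda>\<^sup>2 * (2 * (k * \<Lambda> * \<kappa> * h * \<epsilon>)))))"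
      by (intro sum_norm_le Wb) auto
    then show "norm (\<Sum>p\<le>K. \<Sum>s\<le>K. (bmat K K p * bmat K K s) *\<^sub>R
        ((\<psi> p s - \<psi> 0 0) *\<^sub>R R p s + (h1 * h2) *\<^sub>R Z p s))
      \<le> k\<^sup>2 * ((\<Lambda> * \<Lambda>) * ((B + B') * h * (k\<^sup>2 * \<Lambda>\<^sup>2 * (2 * (k * \<Lambda> * \<kappa> * h * \<epsilon>)))))"
      by (simp add: k_def power2_eq_square mult.assoc add.commute)
  qed
  \<comment> \<open>Quadrature and mixed differences each contribute
    \<open>k\<^sup>2 \<Lambda>\<^sup>2\<close>, and the integration inside \<open>V'\<close> one
    more \<open>k \<Lambda>\<close>: hence the fifth powers. The mean value term, with a single
    \<open>k \<Lambda>\<close>, is enlarged to the same constant.\<close>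
  also have "\<dots> = 2 * (k * \<Lambda>) * \<kappa> * (M * h * \<epsilon>') + 2 * (k ^ 5 * \<Lambda> ^ 5) * \<kappa> * ((B + B') * h * h * \<epsilon>)"
    by (simp add: power2_eq_square eval_nat_numeral mult_ac)
  also have "\<dots> \<le> 2 * (k ^ 5 * \<Lambda> ^ 5) * \<kappa> * (M * h * \<epsilon>') + 2 * (k ^ 5 * \<Lambda> ^ 5) * \<kappa> * ((B + B') * h * h * \<epsilon>)"
  proof -
    have "k ^ 1 \<le> k ^ 5" "\<Lambda> ^ 1 \<le> \<Lambda> ^ 5" using k \<Lambda>(1) by (intro power_increasing; simp)+
    then have "k * \<Lambda> \<le> k ^ 5 * \<Lambda> ^ 5" using k \<Lambda>(1) by (intro mult_mono) auto
    moreover have "0 \<le> M" using \<psi>(1) by linarith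
    ultimately show ?thesis
      using h \<epsilon> \<kappa> by (intro add_right_mono mult_right_mono mult_left_mono) auto
  qed
  finally show ?thesis by (simp add: k_def algebra_simps)
qed

section \<open>The nodal basis\<close>

lemma poly_antiderivative: "\<exists>G. pderiv G = p" for p :: "real poly"
proof
  let ?G = "\<Sum>i\<le>degree p. monom (coeff p i / real (Suc i)) (Suc i)"
  have "pderiv ?G = (\<Sum>i\<le>degree p. pderiv (monom (coeff p i / real (Suc i)) (Suc i)))"
    using higher_pderiv_sum[of 1] by simp
  also have "\<dots> = p" by (simp add: pderiv_monom poly_as_sum_of_monoms del: of_nat_Suc)
  finally show "pderiv ?G = p" .
qed

lemma poly_sum_coeff:
  fixes P :: "real poly"
  assumes "degree P \<le> K"
  shows "poly P x = (\<Sum>k\<le>K. coeff P k * x ^ k)"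
  unfolding poly_altdef using assms
  by (intro sum.mono_neutral_left) (auto simp: coeff_eq_0)

section \<open>Lagrange elements on a uniform one-dimensional grid\<close>

locale grid =
  fixes K :: nat and a h :: real and N :: nat
  assumes K: "K \<ge> 1" and h: "h > 0"
begin

abbreviation pt :: "nat \<Rightarrow> nat \<Rightarrow> real" where "pt \<equiv> cell_point a h K"

definition cell :: "nat \<Rightarrow> real set" where "cell i = {a + h * real i .. a + h * real (Suc i)}"

definition lag :: "nat \<Rightarrow> nat \<Rightarrow> real \<Rightarrow> real"
  where "lag i p x = poly (ref_lag K p) ((x - (a + h * real i)) / h)"

lemma pt_ends: "pt i 0 = a + h * real i" "pt i K = a + h * real (Suc i)"
  using K by (simp_all add: cell_point_ref ref_point_ends algebra_simps)

lemma pt_cell: "p \<le> K \<Longrightarrow> pt i p \<in> cell i"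
  using ref_point_range[OF K, of p] h mult_left_le[of "ref_point K p" h]
  by (auto simp: cell_def cell_point_ref algebra_simps)

lemma pt_inj: "p \<le> K \<Longrightarrow> q \<le> K \<Longrightarrow> pt i p = pt i q \<longleftrightarrow> p = q"
  using inj_onD[OF ref_point_inj[OF K], of p q] h by (auto simp: cell_point_ref)

lemma lag_pt: "p \<le> K \<Longrightarrow> q \<le> K \<Longrightarrow> lag i p (pt i q) = (if p = q then 1 else 0)"
  using h K by (simp add: lag_def cell_point_ref ref_lag_node)

lemma continuous_lag: "continuous_on A (lag i p)"
  unfolding lag_def using h by (intro continuous_intros) auto

lemma lag_interpolation:
  assumes "degree P \<le> K"
  shows "poly P x = (\<Sum>p\<le>K. lag i p x * poly P (pt i p))"
proof -
  let ?Q = "pcompose P [:a + h * real i, h:]"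
  have "degree ?Q \<le> K" using assms h by (simp add: degree_pcompose)
  from arg_cong[OF ref_interpolation[OF K this], of "\<lambda>p. poly p ((x - (a + h * real i)) / h)"]
  show ?thesis
    using h by (simp add: poly_pcompose poly_sum lag_def cell_point_ref mult.commute)
qed

lemma lag_poly:
  assumes "p \<le> K"
  shows "\<exists>P. degree P \<le> K \<and> (\<forall>x. poly P x = lag i p x)"
proof (intro exI[of _ "pcompose (ref_lag K p) [:- (a + h * real i) / h, 1 / h:]"] conjI allI)
  show "degree (pcompose (ref_lag K p) [:- (a + h * real i) / h, 1 / h:]) \<le> K"
    using degree_ref_lag[OF assms] h by (simp add: degree_pcompose)
  show "poly (pcompose (ref_lag K p) [:- (a + h * real i) / h, 1 / h:]) x = lag i p x" for x
    unfolding lag_def poly_pcompose using h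
    by (intro arg_cong[where f = "poly (ref_lag K p)"]) (simp add: field_simps)
qed

lemma lag_has_field_derivative:
  "(lag i p has_field_derivative poly (pderiv (ref_lag K p)) ((x - (a + h * real i)) / h) / h) (at x)"
  unfolding lag_def using h by (auto intro!: derivative_eq_intros)

lemma lag_integral:
  assumes "r \<le> K"
  shows "integral {a + h * real i .. pt i r} (lag i p) = h * bmat K r p"
proof -
  obtain G where G: "pderiv G = ref_lag K p" using poly_antiderivative by blast
  have 0: "0 \<le> ref_point K r" using ref_point_range[OF K assms] by simp
  let ?H = "\<lambda>x. h * poly G ((x - (a + h * real i)) / h)"
  have "(lag i p has_integral ?H (pt i r) - ?H (a + h * real i)) {a + h * real i .. pt i r}"
  proof (rule fundamental_theorem_of_calculus)
    show "a + h * real i \<le> pt i r" using 0 h by (simp add: cell_point_ref)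
    show "(?H has_vector_derivative lag i p x) (at x within {a + h * real i .. pt i r})" for x
      using h unfolding has_real_derivative_iff_has_vector_derivative[symmetric] lag_def
      by (auto intro!: derivative_eq_intros simp: G)
  qed
  moreover have "bmat K r p = poly G (ref_point K r) - poly G 0"
    unfolding bmat_def by (rule integral_poly[OF G 0])
  ultimately show ?thesis
    using h by (simp add: integral_unique cell_point_ref right_diff_distrib)
qed

lemma cell_weight_bmat: "cell_weight a h K l p = h * bmat K K p"
proof -
  have "lagrange (cell_point a h K l) K p = lag l p"
    using h by (simp add: lagrange_cell lag_def fun_eq_iff)
  then show ?thesis using lag_integral[of K l p] by (simp add: cell_weight_def pt_ends)
qed

text \<open>The basis function is selected by the position \<open>z\<close> of its node, as degrees
  of freedom are identified with positions. At most one summand is active, and none if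
  \<open>z\<close> is not a node of the cell.\<close>

definition local_basis :: "nat \<Rightarrow> real \<Rightarrow> real \<Rightarrow> real"
  where "local_basis i z x = (\<Sum>p\<le>K. if pt i p = z then lag i p x else 0)"

text \<open>A point shared by two cells is assigned to the left one; by \<open>basis1_cell\<close>
  the other choice gives the same value.\<close>

definition basis1 :: "real \<Rightarrow> real \<Rightarrow> real"
  where "basis1 z x = (if \<exists>i<N. x \<in> cell i then local_basis (LEAST i. x \<in> cell i) z x else 0)"

lemma local_basis_pt: "r \<le> K \<Longrightarrow> local_basis i z (pt i r) = (if pt i r = z then 1 else 0)"
proof -
  assume r: "r \<le> K"
  have "local_basis i z (pt i r) = (\<Sum>p\<le>K. if p = r then (if pt i r = z then 1 else 0) else 0)"
    unfolding local_basis_def using r by (intro sum.cong) (auto simp: lag_pt)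
  then show ?thesis using r by simp
qed

text \<open>Different cells share at most an end point, which is a node of both, and at a node the
  value only records whether it equals \<open>z\<close>. Continuity across cells thus rests on the
  end points being Gauss--Lobatto points.\<close>

lemma basis1_cell:
  assumes "i < N" "x \<in> cell i"
  shows "basis1 z x = local_basis i z x"
proof -
  define k where "k = (LEAST i. x \<in> cell i)"
  have k: "x \<in> cell k" "k \<le> i" unfolding k_def using assms(2) by (auto intro: LeastI Least_le)
  have "local_basis k z x = local_basis i z x"
  proof (cases "k = i")
    case False
    have "h * real i \<le> h * real (Suc k)" using k assms(2) by (auto simp: cell_def)
    then have "i = Suc k" using k False h by simp
    then have "x = pt k K" "x = pt i 0" using k assms(2) by (auto simp: cell_def pt_ends)
    then show ?thesis using local_basis_pt[of K k z] local_basis_pt[of 0 i z] by simp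
  qed simp
  then show ?thesis using assms by (auto simp: basis1_def k_def)
qed

lemma cells_Un: "N \<ge> 1 \<Longrightarrow> {a .. a + h * real N} = (\<Union>i<N. cell i)"
proof (induction N rule: nat_induct_at_least)
  case base
  show ?case by (simp add: cell_def lessThan_Suc)
next
  case (Suc n)
  have "{a .. a + h * real (Suc n)} = {a .. a + h * real n} \<union> cell n"
    unfolding cell_def using h by (intro ivl_disj_un_two_touch(4)[symmetric]) auto
  then show ?case using Suc by (simp add: lessThan_Suc Un_commute)
qed

lemma continuous_basis1: "N \<ge> 1 \<Longrightarrow> continuous_on {a .. a + h * real N} (basis1 z)"
proof -
  assume "N \<ge> 1"
  have "continuous_on (cell i) (\<lambda>x. if pt i p = z then lag i p x else 0)" for i p
    by (cases "pt i p = z") (simp_all add: continuous_lag)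
  then have "continuous_on (cell i) (local_basis i z)" for i
    unfolding local_basis_def[abs_def] by (intro continuous_on_sum)
  then have "continuous_on (cell i) (basis1 z)" if "i < N" for i
    using basis1_cell[OF that] by (simp cong: continuous_on_cong)
  then have "continuous_on (\<Union>i\<in>{..<N}. cell i) (basis1 z)"
    by (intro continuous_on_closed_Union) (auto simp: cell_def)
  then show ?thesis using cells_Un[OF \<open>N \<ge> 1\<close>] by simp
qed

lemma basis1_outside: "N \<ge> 1 \<Longrightarrow> x \<notin> {a .. a + h * real N} \<Longrightarrow> basis1 z x = 0"
  using cells_Un by (auto simp: basis1_def)

lemma basis1_poly:
  assumes "i < N"
  obtains P where "degree P \<le> K" "\<And>x. x \<in> cell i \<Longrightarrow> basis1 z x = poly P x"
proof -
  from lag_poly[of _ i] obtain P where P: "\<And>p. p \<le> K \<Longrightarrow> degree (P p) \<le> K" "\<And>p x. p \<le> K \<Longrightarrow> poly (P p) x = lag i p x"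
    by metis
  let ?P = "\<Sum>p\<le>K. if pt i p = z then P p else 0"
  have "degree ?P \<le> K" by (intro degree_sum_le) (auto simp: P)
  moreover have "poly ?P x = local_basis i z x" for x
    unfolding poly_sum local_basis_def by (intro sum.cong) (auto simp: P)
  ultimately show ?thesis using that basis1_cell[OF assms] by metis
qed

lemma basis1_pt: "i < N \<Longrightarrow> p \<le> K \<Longrightarrow> basis1 z (pt i p) = (if pt i p = z then 1 else 0)"
  using basis1_cell[of i "pt i p"] pt_cell local_basis_pt by simp

lemma local_basis_of_pt: "p \<le> K \<Longrightarrow> local_basis i (pt i p) x = lag i p x"
proof -
  assume p: "p \<le> K"
  have "local_basis i (pt i p) x = (\<Sum>q\<le>K. if q = p then lag i q x else 0)"
    unfolding local_basis_def using p by (intro sum.cong) (auto simp: pt_inj)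
  then show ?thesis using p by simp
qed

end

section \<open>Tensor-product basis and interpolation on the mesh\<close>

locale admissible_mesh =
  fixes K :: nat and G :: mesh
  assumes K1: "K \<ge> 1" and st: "step1 G > 0" "step2 G > 0" and nm: "num1 G \<ge> 1" "num2 G \<ge> 1"
begin

sublocale X: grid K "org1 G" "step1 G" "num1 G" using K1 st by unfold_locales auto
sublocale Y: grid K "org2 G" "step2 G" "num2 G" using K1 st by unfold_locales auto

lemma elem_eq: "elem G i j = X.cell i \<times> Y.cell j"
  by (simp add: elem_def X.cell_def Y.cell_def)

lemma len: "len1 G = step1 G * real (num1 G)" "len2 G = step2 G * real (num2 G)"
  using nm by (auto simp: step1_def step2_def)

lemma domain_eq: "mesh_domain G =
    {org1 G .. org1 G + step1 G * real (num1 G)} \<times> {org2 G .. org2 G + step2 G * real (num2 G)}"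
  by (simp add: mesh_domain_def rectangle_def len)

lemma domain_elem: "z \<in> mesh_domain G \<longleftrightarrow> (\<exists>i<num1 G. \<exists>j<num2 G. z \<in> elem G i j)"
  using nm by (cases z) (auto simp: domain_eq X.cells_Un Y.cells_Un elem_eq)

definition elem_node :: "nat \<Rightarrow> nat \<Rightarrow> nat \<Rightarrow> nat \<Rightarrow> real \<times> real"
  where "elem_node i j p q = (X.pt i p, Y.pt j q)"

lemma nodes_eq_elem_nodes: "nodes K G = {elem_node i j p q | i p j q. i < num1 G \<and> p \<le> K \<and> j < num2 G \<and> q \<le> K}"
  by (simp add: nodes_def elem_node_def node1_def node2_def)

lemma elem_node_in_elem: "p \<le> K \<Longrightarrow> q \<le> K \<Longrightarrow> elem_node i j p q \<in> elem G i j"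
  by (simp add: elem_node_def elem_eq X.pt_cell Y.pt_cell)

lemma elem_node_in_nodes: "i < num1 G \<Longrightarrow> j < num2 G \<Longrightarrow> p \<le> K \<Longrightarrow> q \<le> K \<Longrightarrow> elem_node i j p q \<in> nodes K G"
  by (auto simp: nodes_eq_elem_nodes)

lemma nodes_domain: "nodes K G \<subseteq> mesh_domain G"
proof
  fix z assume "z \<in> nodes K G"
  then obtain i p j q where "i < num1 G" "p \<le> K" "j < num2 G" "q \<le> K" "z = elem_node i j p q"
    unfolding nodes_eq_elem_nodes by blast
  then show "z \<in> mesh_domain G" using elem_node_in_elem domain_elem by blast
qed

lemma finite_nodes: "finite (nodes K G)"
proof -
  have "nodes K G \<subseteq> (\<lambda>(i, p, j, q). elem_node i j p q) ` ({..<num1 G} \<times> {..K} \<times> {..<num2 G} \<times> {..K})"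
    by (force simp: nodes_eq_elem_nodes)
  then show ?thesis by (rule finite_subset) auto
qed

text \<open>Freezing one variable leaves a polynomial of degree at most \<open>K\<close> in the
  other, which one-dimensional interpolation reproduces; this is done in each variable in
  turn.\<close>

lemma fe_space_elem:
  assumes f: "f \<in> fe_space K G" and i: "i < num1 G" "j < num2 G" and xy: "(x, y) \<in> elem G i j"
  shows "f (x, y) = (\<Sum>p\<le>K. \<Sum>q\<le>K. X.lag i p x * Y.lag j q y * f (elem_node i j p q))"
proof -
  obtain c where c: "\<And>x y. (x, y) \<in> elem G i j \<Longrightarrow> f (x, y) = (\<Sum>p\<le>K. \<Sum>q\<le>K. c p q * x ^ p * y ^ q)"
    using f i unfolding fe_space_def by blast
  have xy: "x \<in> X.cell i" "y \<in> Y.cell j" using xy by (auto simp: elem_eq)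
  have s1: "f (x, y) = (\<Sum>p\<le>K. X.lag i p x * f (X.pt i p, y))" if x: "x \<in> X.cell i" and y: "y \<in> Y.cell j" for x y
  proof -
    define P where "P = (\<Sum>p\<le>K. monom (\<Sum>q\<le>K. c p q * y ^ q) p)"
    have "degree P \<le> K" unfolding P_def
      by (intro degree_sum_le) (auto intro: order_trans[OF degree_monom_le])
    moreover have "f (x', y) = poly P x'" if "x' \<in> X.cell i" for x'
    proof -
      have "f (x', y) = (\<Sum>p\<le>K. \<Sum>q\<le>K. c p q * y ^ q * x' ^ p)"
        using c[of x' y] that y by (simp add: elem_eq mult.assoc mult.commute[of "x' ^ _"])
      then show ?thesis by (simp add: P_def poly_sum poly_monom sum_distrib_right)
    qed
    ultimately show ?thesis using X.lag_interpolation[of P x i] x X.pt_cell by simp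
  qed
  have s2: "f (x, y) = (\<Sum>q\<le>K. Y.lag j q y * f (x, Y.pt j q))" if x: "x \<in> X.cell i" and y: "y \<in> Y.cell j" for x y
  proof -
    define P where "P = (\<Sum>q\<le>K. monom (\<Sum>p\<le>K. c p q * x ^ p) q)"
    have "degree P \<le> K" unfolding P_def
      by (intro degree_sum_le) (auto intro: order_trans[OF degree_monom_le])
    moreover have "f (x, y') = poly P y'" if "y' \<in> Y.cell j" for y'
    proof -
      have "f (x, y') = (\<Sum>q\<le>K. \<Sum>p\<le>K. c p q * x ^ p * y' ^ q)"
        using c[of x y'] that x by (simp add: elem_eq) (rule sum.swap)
      then show ?thesis by (simp add: P_def poly_sum poly_monom sum_distrib_right)
    qed
    ultimately show ?thesis using Y.lag_interpolation[of P y j] y Y.pt_cell by simp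
  qed
  have "f (x, y) = (\<Sum>p\<le>K. X.lag i p x * (\<Sum>q\<le>K. Y.lag j q y * f (X.pt i p, Y.pt j q)))"
    unfolding s1[OF xy] using s2[OF X.pt_cell xy(2)] by (intro sum.cong) auto
  then show ?thesis by (simp add: elem_node_def sum_distrib_left mult.assoc)
qed

lemma fe_space_eqI:
  assumes "f \<in> fe_space K G" "g \<in> fe_space K G" "\<And>\<beta>. \<beta> \<in> nodes K G \<Longrightarrow> f \<beta> = g \<beta>"
  shows "f = g"
proof
  fix z :: "real \<times> real"
  show "f z = g z"
  proof (cases "z \<in> mesh_domain G")
    case False
    then have "f z = 0" "g z = 0" using assms(1,2) unfolding fe_space_def by blast+
    then show ?thesis by simp
  next
    case True
    then obtain i j where ij: "i < num1 G" "j < num2 G" "z \<in> elem G i j" using domain_elem by auto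
    obtain x y where z: "z = (x, y)" by (cases z)
    show ?thesis
      using fe_space_elem[OF assms(1) ij(1,2), of x y] fe_space_elem[OF assms(2) ij(1,2), of x y]
        assms(3) elem_node_in_nodes[OF ij(1,2)] ij(3) z by simp
  qed
qed

text \<open>The explicit witness for the definite description in \<open>nodal_basis\<close>;
  uniqueness is \<open>fe_space_eqI\<close>.\<close>

definition tensor_basis :: "real \<times> real \<Rightarrow> real \<times> real \<Rightarrow> real"
  where "tensor_basis \<alpha> z = X.basis1 (fst \<alpha>) (fst z) * Y.basis1 (snd \<alpha>) (snd z)"

lemma continuous_tensor_basis: "continuous_on (mesh_domain G) (tensor_basis \<alpha>)"
  unfolding tensor_basis_def domain_eq using X.continuous_basis1[OF nm(1)] Y.continuous_basis1[OF nm(2)]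
  by (intro continuous_intros)
    (auto intro!: continuous_on_compose2[of _ "X.basis1 _" _ fst] continuous_on_compose2[of _ "Y.basis1 _" _ snd] continuous_intros)

lemma tensor_basis_fe_space: "tensor_basis \<alpha> \<in> fe_space K G"
proof -
  have "\<exists>c::nat \<Rightarrow> nat \<Rightarrow> real. \<forall>(x, y)\<in>elem G i j. tensor_basis \<alpha> (x, y) = (\<Sum>p\<le>K. \<Sum>q\<le>K. c p q * x ^ p * y ^ q)"
    if ij: "i < num1 G" "j < num2 G" for i j
  proof -
    obtain P where P: "degree P \<le> K" "\<And>x. x \<in> X.cell i \<Longrightarrow> X.basis1 (fst \<alpha>) x = poly P x"
      using X.basis1_poly[OF ij(1)] by metis
    obtain Q where Q: "degree Q \<le> K" "\<And>x. x \<in> Y.cell j \<Longrightarrow> Y.basis1 (snd \<alpha>) x = poly Q x"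
      using Y.basis1_poly[OF ij(2)] by metis
    have "tensor_basis \<alpha> (x, y) = (\<Sum>p\<le>K. \<Sum>q\<le>K. coeff P p * coeff Q q * x ^ p * y ^ q)"
      if "(x, y) \<in> elem G i j" for x y
    proof -
      have "tensor_basis \<alpha> (x, y) = (\<Sum>p\<le>K. coeff P p * x ^ p) * (\<Sum>q\<le>K. coeff Q q * y ^ q)"
        using that by (simp add: tensor_basis_def elem_eq P(2) Q(2) poly_sum_coeff[OF P(1)] poly_sum_coeff[OF Q(1)])
      then show ?thesis unfolding sum_product by (simp add: mult.assoc mult.left_commute)
    qed
    then show ?thesis
      by (intro exI[of _ "\<lambda>p q. coeff P p * coeff Q q"]) auto
  qed
  moreover have "tensor_basis \<alpha> z = 0" if "z \<notin> mesh_domain G" for z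
    using that X.basis1_outside[OF nm(1)] Y.basis1_outside[OF nm(2)]
    by (cases z) (auto simp: domain_eq tensor_basis_def)
  ultimately show ?thesis by (simp add: fe_space_def continuous_tensor_basis)
qed

lemma tensor_basis_node: "\<beta> \<in> nodes K G \<Longrightarrow> tensor_basis \<alpha> \<beta> = (if \<beta> = \<alpha> then 1 else 0)"
  by (cases \<alpha>) (auto simp: nodes_eq_elem_nodes elem_node_def tensor_basis_def X.basis1_pt Y.basis1_pt split: if_splits)

lemma nodal_basis_tensor_basis: "nodal_basis K G \<alpha> = tensor_basis \<alpha>"
  unfolding nodal_basis_def
proof (rule the1_equality')
  show "\<exists>\<^sub>\<le>\<^sub>1\<phi>. \<phi> \<in> fe_space K G \<and> (\<forall>\<beta>\<in>nodes K G. \<phi> \<beta> = (if \<beta> = \<alpha> then 1 else 0))"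
    by (rule Uniq_I) (auto intro: fe_space_eqI)
qed (use tensor_basis_fe_space tensor_basis_node in auto)

lemma tensor_basis_on_elem:
  "i < num1 G \<Longrightarrow> j < num2 G \<Longrightarrow> (x, y) \<in> elem G i j \<Longrightarrow>
    tensor_basis \<alpha> (x, y) = X.local_basis i (fst \<alpha>) x * Y.local_basis j (snd \<alpha>) y"
  by (simp add: tensor_basis_def elem_eq X.basis1_cell Y.basis1_cell)

lemma tensor_basis_elem_node:
  "i < num1 G \<Longrightarrow> j < num2 G \<Longrightarrow> p \<le> K \<Longrightarrow> q \<le> K \<Longrightarrow> (x, y) \<in> elem G i j \<Longrightarrow>
    tensor_basis (elem_node i j p q) (x, y) = X.lag i p x * Y.lag j q y"
  by (simp add: tensor_basis_on_elem elem_node_def X.local_basis_of_pt Y.local_basis_of_pt)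

text \<open>One coordinate of such an \<open>\<alpha>\<close> is not a node coordinate of the
  element, so the corresponding factor is zero throughout the cell.\<close>

lemma tensor_basis_not_elem_node:
  assumes "i < num1 G" "j < num2 G" "(x, y) \<in> elem G i j"
    "\<And>p q. p \<le> K \<Longrightarrow> q \<le> K \<Longrightarrow> \<alpha> \<noteq> elem_node i j p q"
  shows "tensor_basis \<alpha> (x, y) = 0"
proof (cases "\<exists>p\<le>K. X.pt i p = fst \<alpha>")
  case True
  then have "\<not> (\<exists>q\<le>K. Y.pt j q = snd \<alpha>)" using assms(4) by (metis elem_node_def prod.collapse)
  then have "Y.local_basis j (snd \<alpha>) y = 0" by (simp add: Y.local_basis_def)
  then show ?thesis using tensor_basis_on_elem[OF assms(1-3)] by simp
next
  case False
  then have "X.local_basis i (fst \<alpha>) x = 0" by (simp add: X.local_basis_def)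
  then show ?thesis using tensor_basis_on_elem[OF assms(1-3)] by simp
qed

text \<open>A node of a neighbour that lies in this element is one of its own nodes: otherwise its
  basis function would vanish on the element, although it has the value 1 at that very node.\<close>

lemma nodes_elem:
  assumes "i < num1 G" "j < num2 G"
  shows "{\<alpha>\<in>nodes K G. \<alpha> \<in> elem G i j} = (\<lambda>(p, q). elem_node i j p q) ` ({..K} \<times> {..K})"
proof -
  have "\<exists>p\<le>K. \<exists>q\<le>K. \<alpha> = elem_node i j p q" if "\<alpha> \<in> nodes K G" "\<alpha> \<in> elem G i j" for \<alpha>
    using tensor_basis_not_elem_node[OF assms, of "fst \<alpha>" "snd \<alpha>" \<alpha>] tensor_basis_node[OF that(1), of \<alpha>] that by auto
  moreover have "elem_node i j p q \<in> nodes K G \<and> elem_node i j p q \<in> elem G i j" if "p \<le> K" "q \<le> K" for p q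
    using that elem_node_in_elem elem_node_in_nodes[OF assms] by blast
  ultimately show ?thesis by (force simp: image_iff)
qed

lemma elem_node_inj: "inj_on (\<lambda>(p, q). elem_node i j p q) ({..K} \<times> {..K})"
  by (auto simp: inj_on_def elem_node_def X.pt_inj Y.pt_inj)

lemma sum_nodes_elem:
  assumes "i < num1 G" "j < num2 G"
  shows "(\<Sum>\<alpha>\<in>{\<alpha>\<in>nodes K G. \<alpha> \<in> elem G i j}. g \<alpha>) = (\<Sum>p\<le>K. \<Sum>q\<le>K. g (elem_node i j p q))"
  unfolding nodes_elem[OF assms]
  by (subst sum.reindex[OF elem_node_inj]) (simp add: sum.cartesian_product case_prod_unfold comp_def)

lemma interpolant_elem:
  assumes "i < num1 G" "j < num2 G" "(x, y) \<in> elem G i j"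
  shows "interpolant K G g (x, y) = (\<Sum>p\<le>K. \<Sum>q\<le>K. (X.lag i p x * Y.lag j q y) *\<^sub>R g (elem_node i j p q))"
proof -
  have "interpolant K G g (x, y) = (\<Sum>\<alpha>\<in>nodes K G. tensor_basis \<alpha> (x, y) *\<^sub>R g \<alpha>)"
    by (simp add: interpolant_def nodal_basis_tensor_basis)
  also have "\<dots> = (\<Sum>\<alpha>\<in>{\<alpha>\<in>nodes K G. \<alpha> \<in> elem G i j}. tensor_basis \<alpha> (x, y) *\<^sub>R g \<alpha>)"
  proof (rule sum.mono_neutral_right[OF finite_nodes])
    show "\<forall>\<alpha>\<in>nodes K G - {\<alpha>\<in>nodes K G. \<alpha> \<in> elem G i j}. tensor_basis \<alpha> (x, y) *\<^sub>R g \<alpha> = 0"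
    proof
      fix \<alpha> assume "\<alpha> \<in> nodes K G - {\<alpha>\<in>nodes K G. \<alpha> \<in> elem G i j}"
      then have "\<alpha> \<notin> elem G i j" by simp
      then have "tensor_basis \<alpha> (x, y) = 0" using elem_node_in_elem by (intro tensor_basis_not_elem_node[OF assms]) metis
      then show "tensor_basis \<alpha> (x, y) *\<^sub>R g \<alpha> = 0" by simp
    qed
  qed auto
  also have "\<dots> = (\<Sum>p\<le>K. \<Sum>q\<le>K. tensor_basis (elem_node i j p q) (x, y) *\<^sub>R g (elem_node i j p q))"
    by (rule sum_nodes_elem[OF assms(1,2)])
  also have "\<dots> = (\<Sum>p\<le>K. \<Sum>q\<le>K. (X.lag i p x * Y.lag j q y) *\<^sub>R g (elem_node i j p q))"
    by (intro sum.cong) (auto simp: tensor_basis_elem_node assms)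
  finally show ?thesis .
qed

lemma interpolant_node: "\<alpha> \<in> nodes K G \<Longrightarrow> interpolant K G g \<alpha> = g \<alpha>"
proof -
  assume \<alpha>: "\<alpha> \<in> nodes K G"
  have "interpolant K G g \<alpha> = (\<Sum>\<beta>\<in>nodes K G. if \<alpha> = \<beta> then g \<beta> else 0)"
    unfolding interpolant_def by (intro sum.cong) (auto simp: nodal_basis_tensor_basis tensor_basis_node[OF \<alpha>])
  then show ?thesis using \<alpha> by (simp add: finite_nodes)
qed

lemma continuous_interpolant: "continuous_on (mesh_domain G) (interpolant K G g)"
  unfolding interpolant_def[abs_def] nodal_basis_tensor_basis by (intro continuous_intros continuous_tensor_basis)

end

section \<open>Functions of class \<open>C\<^sup>k\<close> on a box\<close>

text \<open>Nondegeneracy makes derivatives within the box unique at every point, including the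
  boundary.\<close>

definition proper_box :: "'a::euclidean_space set \<Rightarrow> bool"
  where "proper_box A \<longleftrightarrow> (\<exists>u v. A = cbox u v \<and> (\<forall>i\<in>Basis. u \<bullet> i < v \<bullet> i))"

lemma frechet_derivative_proper_box:
  fixes f :: "'a::euclidean_space \<Rightarrow> 'b::real_normed_vector"
  assumes "proper_box A" "x \<in> A" "(f has_derivative f') (at x within A)"
  shows "frechet_derivative f (at x within A) = f'"
proof -
  obtain u v where A: "A = cbox u v" "\<And>i. i\<in>Basis \<Longrightarrow> u \<bullet> i < v \<bullet> i"
    using assms(1) by (auto simp: proper_box_def)
  have "(f has_derivative frechet_derivative f (at x within A)) (at x within A)"
    using assms(3) frechet_derivative_works differentiableI by blast
  then show ?thesis
    using frechet_derivative_unique_within_closed_interval[of u v x f] A assms(2,3) by blast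
qed

lemma Ck_on_cong:
  assumes "\<And>x. x \<in> A \<Longrightarrow> f x = g x"
  shows "Ck_on k A f \<longleftrightarrow> Ck_on k A g"
  using assms
proof (induction k arbitrary: f g)
  case 0
  then show ?case by (simp cong: continuous_on_cong)
next
  case (Suc k)
  have hd: "(f has_derivative f') (at x within A) \<longleftrightarrow> (g has_derivative f') (at x within A)"
    if "x \<in> A" for x f'
    using Suc.prems that by (metis has_derivative_transform)
  have d: "f differentiable_on A \<longleftrightarrow> g differentiable_on A"
    using hd by (auto simp: differentiable_on_def differentiable_def)
  have "frechet_derivative f (at x within A) = frechet_derivative g (at x within A)"
    if "x \<in> A" for x
    using hd[OF that] by (simp add: frechet_derivative_def)
  then have "Ck_on k A (\<lambda>x. frechet_derivative f (at x within A) v) \<longleftrightarrow>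
      Ck_on k A (\<lambda>x. frechet_derivative g (at x within A) v)" for v
    by (intro Suc.IH) simp
  then show ?case using d by simp
qed

lemma Ck_on_SucD: "Ck_on (Suc k) A f \<Longrightarrow> Ck_on k A f"
proof (induction k arbitrary: f)
  case 0
  then show ?case by (simp add: differentiable_imp_continuous_on)
next
  case (Suc k)
  then show ?case by (metis Ck_on.simps(2))
qed

lemma Ck_on_le: "j \<le> k \<Longrightarrow> Ck_on k A f \<Longrightarrow> Ck_on j A f"
  by (induction rule: inc_induct) (auto dest: Ck_on_SucD simp del: Ck_on.simps)

lemma Ck_on_imp_continuous_on: "Ck_on k A f \<Longrightarrow> continuous_on A f"
  using Ck_on_le[of 0 k A f] by simp

text \<open>Uniqueness allows any explicit derivative \<open>f'\<close> to stand in for the chosen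
  \<open>frechet_derivative\<close>. The closure properties below all use this as their induction
  step.\<close>

lemma Ck_on_SucI:
  fixes f :: "'a::euclidean_space \<Rightarrow> 'b::real_normed_vector"
  assumes "proper_box A" "\<And>x. x \<in> A \<Longrightarrow> (f has_derivative f' x) (at x within A)"
    "\<And>v. Ck_on k A (\<lambda>x. f' x v)"
  shows "Ck_on (Suc k) A f"
proof -
  have "Ck_on k A (\<lambda>x. frechet_derivative f (at x within A) v)" for v
    using assms(3)[of v] frechet_derivative_proper_box[OF assms(1) _ assms(2)]
      Ck_on_cong[of A "\<lambda>x. frechet_derivative f (at x within A) v" "\<lambda>x. f' x v" k]
    by simp
  then show ?thesis using assms(2) by (auto simp: differentiable_on_def differentiable_def)
qed

lemma Ck_on_has_derivative:
  "Ck_on (Suc k) A f \<Longrightarrow> x \<in> A \<Longrightarrow>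
    (f has_derivative frechet_derivative f (at x within A)) (at x within A)"
  by (simp add: differentiable_on_def frechet_derivative_works)

lemma Ck_on_frechet: "Ck_on (Suc k) A f \<Longrightarrow> Ck_on k A (\<lambda>x. frechet_derivative f (at x within A) v)"
  by simp

lemma Ck_on_const: "proper_box A \<Longrightarrow> Ck_on k A (\<lambda>x. c)"
proof (induction k arbitrary: c)
  case (Suc k)
  show ?case by (rule Ck_on_SucI[OF Suc.prems, where f' = "\<lambda>x v. 0"]) (use Suc in auto)
qed simp

lemma Ck_on_add:
  "proper_box A \<Longrightarrow> Ck_on k A f \<Longrightarrow> Ck_on k A g \<Longrightarrow> Ck_on k A (\<lambda>x. f x + g x)"
proof (induction k arbitrary: f g)
  case 0
  then show ?case by (auto intro: continuous_intros)
next
  case (Suc k)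
  show ?case
  proof (rule Ck_on_SucI[OF Suc.prems(1), where f' = "\<lambda>x v. frechet_derivative f (at x within A) v + frechet_derivative g (at x within A) v"])
    show "Ck_on k A (\<lambda>x. (\<lambda>x v. frechet_derivative f (at x within A) v + frechet_derivative g (at x within A) v) x v)" for v
      using Suc.prems by (auto simp del: Ck_on.simps intro!: Suc.IH Ck_on_frechet)
  qed (use Suc.prems in \<open>auto simp del: Ck_on.simps intro!: has_derivative_add Ck_on_has_derivative\<close>)
qed

lemma Ck_on_sum:
  "proper_box A \<Longrightarrow> (\<And>i. i \<in> I \<Longrightarrow> Ck_on k A (f i)) \<Longrightarrow> Ck_on k A (\<lambda>x. \<Sum>i\<in>I. f i x)"
  by (induction I rule: infinite_finite_induct) (auto intro: Ck_on_const Ck_on_add)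

lemma Ck_on_bounded_linear:
  "proper_box A \<Longrightarrow> bounded_linear L \<Longrightarrow> Ck_on k A f \<Longrightarrow> Ck_on k A (\<lambda>x. L (f x))"
proof (induction k arbitrary: f)
  case 0
  then show ?case by (auto intro: bounded_linear.continuous_on)
next
  case (Suc k)
  show ?case
  proof (rule Ck_on_SucI[OF Suc.prems(1), where f' = "\<lambda>x v. L (frechet_derivative f (at x within A) v)"])
    show "Ck_on k A (\<lambda>x. (\<lambda>x v. L (frechet_derivative f (at x within A) v)) x v)" for v
      using Suc.prems by (auto simp del: Ck_on.simps intro!: Suc.IH Ck_on_frechet)
  qed (use Suc.prems in \<open>auto simp del: Ck_on.simps intro!: bounded_linear.has_derivative[OF Suc.prems(2)] Ck_on_has_derivative\<close>)
qed

lemma Ck_on_scaleR: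
  fixes f :: "'a::euclidean_space \<Rightarrow> real" and g :: "'a \<Rightarrow> 'b::real_normed_vector"
  shows "proper_box A \<Longrightarrow> Ck_on k A f \<Longrightarrow> Ck_on k A g \<Longrightarrow> Ck_on k A (\<lambda>x. f x *\<^sub>R g x)"
proof (induction k arbitrary: f g)
  case 0
  then show ?case by (auto intro: continuous_intros)
next
  case (Suc k)
  show ?case
  proof (rule Ck_on_SucI[OF Suc.prems(1), where f' = "\<lambda>x v. f x *\<^sub>R frechet_derivative g (at x within A) v + frechet_derivative f (at x within A) v *\<^sub>R g x"])
    show "Ck_on k A (\<lambda>x. (\<lambda>x v. f x *\<^sub>R frechet_derivative g (at x within A) v + frechet_derivative f (at x within A) v *\<^sub>R g x) x v)" for v
      using Suc.prems by (auto simp del: Ck_on.simps intro!: Ck_on_add Suc.IH Ck_on_frechet intro: Ck_on_SucD)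
  qed (use Suc.prems in \<open>auto simp del: Ck_on.simps intro!: has_derivative_scaleR Ck_on_has_derivative\<close>)
qed

text \<open>\<open>Ck_on\<close> speaks of derivatives in fixed directions, but the chain rule
  differentiates \<open>F\<close> in a direction that varies with \<open>x\<close>. Expanding this
  direction in basis vectors gives products of scalar functions with fixed directional derivatives
  of \<open>F\<close>, to which the induction hypothesis applies.\<close>

lemma Ck_on_compose:
  fixes F :: "'b::euclidean_space \<Rightarrow> 'c::real_normed_vector" and W :: "'a::euclidean_space \<Rightarrow> 'b"
  shows "proper_box A \<Longrightarrow> Ck_on k D F \<Longrightarrow> Ck_on k A W \<Longrightarrow> W ` A \<subseteq> D \<Longrightarrow> Ck_on k A (\<lambda>x. F (W x))"
proof (induction k arbitrary: F)
  case 0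
  then show ?case by (auto intro: continuous_on_compose2)
next
  case (Suc k)
  let ?DF = "\<lambda>x. frechet_derivative F (at x within D)"
  let ?DW = "\<lambda>x. frechet_derivative W (at x within A)"
  have D: "((\<lambda>x. F (W x)) has_derivative (\<lambda>v. ?DF (W x) (?DW x v))) (at x within A)"
    if x: "x \<in> A" for x
  proof (rule has_derivative_in_compose2[where t = D and g = F])
    show "(F has_derivative ?DF y) (at y within D)" if "y \<in> D" for y
      by (rule Ck_on_has_derivative[OF Suc.prems(2) that])
    show "(W has_derivative ?DW x) (at x within A)"
      by (rule Ck_on_has_derivative[OF Suc.prems(3) x])
  qed (use Suc.prems x in auto)
  have "Ck_on k A (\<lambda>x. ?DF (W x) (?DW x v))" for v
  proof -
    have eq: "?DF (W x) (?DW x v) = (\<Sum>i\<in>Basis. (?DW x v \<bullet> i) *\<^sub>R ?DF (W x) i)" if "x \<in> A" for x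
    proof -
      have "linear (?DF (W x))"
        using Ck_on_has_derivative[OF Suc.prems(2), of "W x"] Suc.prems(4) that
        by (auto dest: has_derivative_linear)
      then have "?DF (W x) (\<Sum>i\<in>Basis. (?DW x v \<bullet> i) *\<^sub>R i)
          = (\<Sum>i\<in>Basis. (?DW x v \<bullet> i) *\<^sub>R ?DF (W x) i)"
        by (simp add: linear_sum linear_scale)
      then show ?thesis by (simp add: euclidean_representation)
    qed
    have "Ck_on k A (\<lambda>x. \<Sum>i\<in>Basis. (?DW x v \<bullet> i) *\<^sub>R ?DF (W x) i)"
      using Suc.prems
      by (intro Ck_on_sum Ck_on_scaleR Suc.IH Ck_on_frechet Ck_on_SucD[of k _ W]
          Ck_on_bounded_linear[where L = "\<lambda>y. y \<bullet> _"] bounded_linear_inner_left)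
        auto
    with Ck_on_cong[of A "\<lambda>x. ?DF (W x) (?DW x v)", OF eq] show ?thesis by blast
  qed
  with D show ?case by (rule Ck_on_SucI[OF Suc.prems(1)])
qed

section \<open>Iterated directional derivatives\<close>

primrec iter_deriv :: "'a::euclidean_space set \<Rightarrow> 'a \<Rightarrow> ('a \<Rightarrow> 'b::real_normed_vector) \<Rightarrow> nat \<Rightarrow> 'a \<Rightarrow> 'b"
  where
    "iter_deriv A v f 0 = f"
  | "iter_deriv A v f (Suc n) = (\<lambda>x. frechet_derivative (iter_deriv A v f n) (at x within A) v)"

lemma Ck_on_iter_deriv: "Ck_on (n + k) A f \<Longrightarrow> Ck_on k A (iter_deriv A v f n)"
proof (induction n arbitrary: k)
  case (Suc n)
  from Suc.IH[of "Suc k"] Suc.prems show ?case by (simp add: Ck_on_frechet)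
qed simp

lemma iter_deriv_bounded:
  assumes "Ck_on k A f" "compact A" "n \<le> k"
  shows "\<exists>M. \<forall>x\<in>A. norm (iter_deriv A v f n x) \<le> M"
proof -
  have "continuous_on A (iter_deriv A v f n)"
    using Ck_on_iter_deriv[of n 0 A f v] Ck_on_le[OF assms(3,1)] by simp
  then have "bounded (iter_deriv A v f n ` A)"
    using assms(2) compact_continuous_image compact_imp_bounded by blast
  then show ?thesis by (auto simp: bounded_iff)
qed

text \<open>Restricts iterated derivatives to a path of constant velocity \<open>v\<close>, which
  supplies the sequence \<open>Df\<close> of \<open>collocation_error\<close> along mesh
  lines.\<close>

lemma iter_deriv_along:
  fixes \<gamma> :: "real \<Rightarrow> 'a::euclidean_space"
  assumes "Ck_on k A f" "n < k"
    and "\<And>t. t \<in> T \<Longrightarrow> (\<gamma> has_vector_derivative v) (at t within T)" "\<gamma> ` T \<subseteq> A" "t \<in> T"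
  shows "((\<lambda>t. iter_deriv A v f n (\<gamma> t)) has_vector_derivative iter_deriv A v f (Suc n) (\<gamma> t))
    (at t within T)"
proof -
  let ?g = "iter_deriv A v f n"
  have C: "Ck_on (Suc 0) A ?g"
    using Ck_on_iter_deriv[of n 1 A f v] Ck_on_le[of "n + 1" k A f] assms(1,2) by simp
  have "((\<lambda>t. ?g (\<gamma> t)) has_derivative
      (\<lambda>h. frechet_derivative ?g (at (\<gamma> t) within A) (h *\<^sub>R v))) (at t within T)"
  proof (rule has_derivative_in_compose2[where t = A and g = ?g])
    show "(?g has_derivative frechet_derivative ?g (at y within A)) (at y within A)" if "y \<in> A" for y
      by (rule Ck_on_has_derivative[OF C that])
    show "(\<gamma> has_derivative (\<lambda>h. h *\<^sub>R v)) (at t within T)"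
      using assms(3,5) by (auto simp: has_vector_derivative_def)
  qed (use assms in auto)
  moreover have "linear (frechet_derivative ?g (at (\<gamma> t) within A))"
    using Ck_on_has_derivative[OF C, of "\<gamma> t"] assms(4,5) by (auto dest: has_derivative_linear)
  ultimately show ?thesis
    by (simp add: has_vector_derivative_def linear_scale)
qed

section \<open>The residual on an element\<close>

lemma tensor_has_derivative:
  fixes \<phi> \<xi> :: "real \<Rightarrow> real" and v :: "'b::real_normed_vector"
  assumes "(\<phi> has_field_derivative \<phi>') (at (fst z))" "(\<xi> has_field_derivative \<xi>') (at (snd z))"
  shows "((\<lambda>z. (\<phi> (fst z) * \<xi> (snd z)) *\<^sub>R v) has_derivative
    (\<lambda>d. (\<phi>' * fst d * \<xi> (snd z) + \<phi> (fst z) * (\<xi>' * snd d)) *\<^sub>R v)) (at z within A)"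
proof -
  have 1: "((\<lambda>z. \<phi> (fst z)) has_derivative (\<lambda>d. \<phi>' * fst d)) (at z within A)"
    using has_derivative_compose[OF has_derivative_fst[OF has_derivative_ident]
      has_field_derivative_imp_has_derivative[OF assms(1)]] by blast
  have 2: "((\<lambda>z. \<xi> (snd z)) has_derivative (\<lambda>d. \<xi>' * snd d)) (at z within A)"
    using has_derivative_compose[OF has_derivative_snd[OF has_derivative_ident]
      has_field_derivative_imp_has_derivative[OF assms(2)]] by blast
  show ?thesis
    using has_derivative_scaleR_left[OF has_derivative_mult[OF 1 2], of v] by (simp add: add.commute)
qed

text \<open>The factors are arbitrary so that the lemma can be applied twice, the second time to
  factors that are already differentiated. Agreement of \<open>U\<close> with the sum on the element
  suffices, as derivatives within it are unique.\<close>

lemma tensor_sum_partial: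
  fixes \<phi> \<xi> \<phi>' \<xi>' :: "nat \<Rightarrow> real \<Rightarrow> real" and V :: "nat \<Rightarrow> nat \<Rightarrow> 'b::real_normed_vector"
  assumes A: "proper_box A" "z \<in> A"
    and U: "\<And>z. z \<in> A \<Longrightarrow> U z = (\<Sum>p\<le>K. \<Sum>q\<le>K. (\<phi> p (fst z) * \<xi> q (snd z)) *\<^sub>R V p q)"
    and \<phi>: "\<And>p x. (\<phi> p has_field_derivative \<phi>' p x) (at x)"
    and \<xi>: "\<And>q x. (\<xi> q has_field_derivative \<xi>' q x) (at x)"
  shows "partial1 A U z = (\<Sum>p\<le>K. \<Sum>q\<le>K. (\<phi>' p (fst z) * \<xi> q (snd z)) *\<^sub>R V p q)"
    and "partial2 A U z = (\<Sum>p\<le>K. \<Sum>q\<le>K. (\<phi> p (fst z) * \<xi>' q (snd z)) *\<^sub>R V p q)"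
proof -
  have "((\<lambda>z. \<Sum>p\<le>K. \<Sum>q\<le>K. (\<phi> p (fst z) * \<xi> q (snd z)) *\<^sub>R V p q) has_derivative
    (\<lambda>d. \<Sum>p\<le>K. \<Sum>q\<le>K. (\<phi>' p (fst z) * fst d * \<xi> q (snd z)
        + \<phi> p (fst z) * (\<xi>' q (snd z) * snd d)) *\<^sub>R V p q)) (at z within A)"
    by (intro has_derivative_sum tensor_has_derivative \<phi> \<xi>)
  then have "(U has_derivative
    (\<lambda>d. \<Sum>p\<le>K. \<Sum>q\<le>K. (\<phi>' p (fst z) * fst d * \<xi> q (snd z)
        + \<phi> p (fst z) * (\<xi>' q (snd z) * snd d)) *\<^sub>R V p q)) (at z within A)"
    by (rule has_derivative_transform[OF A(2), rotated]) (rule U)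
  from frechet_derivative_proper_box[OF A this]
  show "partial1 A U z = (\<Sum>p\<le>K. \<Sum>q\<le>K. (\<phi>' p (fst z) * \<xi> q (snd z)) *\<^sub>R V p q)"
    "partial2 A U z = (\<Sum>p\<le>K. \<Sum>q\<le>K. (\<phi> p (fst z) * \<xi>' q (snd z)) *\<^sub>R V p q)"
    by (simp_all add: partial1_def partial2_def)
qed

lemma proper_box_rectangle: "a < b \<Longrightarrow> c < d \<Longrightarrow> proper_box ({a..b} \<times> {c..d})" for a b c d :: real
  unfolding proper_box_def
  by (intro exI[of _ "(a, c)"] exI[of _ "(b, d)"]) (auto simp: Basis_prod_def cbox_Pair_eq)

context grid
begin

definition dlag :: "nat \<Rightarrow> nat \<Rightarrow> real \<Rightarrow> real"
  where "dlag i p x = poly (pderiv (ref_lag K p)) ((x - (a + h * real i)) / h) / h"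

lemma lag_deriv: "(lag i p has_field_derivative dlag i p x) (at x)"
  unfolding dlag_def by (rule lag_has_field_derivative)

lemma dlag_deriv:
  "(dlag i p has_field_derivative poly (pderiv (pderiv (ref_lag K p))) ((x - (a + h * real i)) / h) / h / h) (at x)"
  unfolding dlag_def using h by (auto intro!: derivative_eq_intros)

lemma dlag_pt: "dlag i r (pt i p) = dmat K p r / h"
  using h by (simp add: dlag_def dmat_def cell_point_ref)

lemma lag_has_integral:
  "r \<le> K \<Longrightarrow> (lag i p has_integral h * bmat K r p) {a + h * real i .. pt i r}"
  by (metis lag_integral integrable_integral integrable_continuous_real continuous_lag)

lemma pt_bounds:
  assumes "p \<le> K" "i < N"
  shows "a \<le> a + h * real i" "a + h * real i \<le> pt i p" "pt i p \<le> a + h * real (Suc i)"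
    "pt i p \<le> a + h * real N"
proof -
  have le: "a + h * real (Suc i) \<le> a + h * real N" using assms h by simp
  have c: "a + h * real i \<le> pt i p" "pt i p \<le> a + h * real (Suc i)"
    using pt_cell[OF assms(1), of i] unfolding cell_def by auto
  show "a \<le> a + h * real i" using h by simp
  show "a + h * real i \<le> pt i p" "pt i p \<le> a + h * real (Suc i)" by (rule c)+
  show "pt i p \<le> a + h * real N" by (rule order_trans[OF c(2) le])
qed

end

section \<open>Localization of the global potentials\<close>

context admissible_mesh
begin

lemma proper_box_elem: "proper_box (elem G i j)"
  unfolding elem_def using st by (intro proper_box_rectangle) auto

text \<open>The integral is split at the lower edge of the element. The part below the edge is
  independent of \<open>q\<close>; the rest integrates basis polynomials up to a node, which is a
  row of \<open>bmat\<close>.\<close>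

lemma integral_interpolant_snd:
  fixes g :: "real \<times> real \<Rightarrow> 'b::banach"
  assumes i: "i < num1 G" "j < num2 G" "q \<le> K" and x: "x \<in> X.cell i"
  shows "integral {org2 G .. Y.pt j q} (\<lambda>y. interpolant K G g (x, y))
    = integral {org2 G .. org2 G + step2 G * real j} (\<lambda>y. interpolant K G g (x, y))
      + step2 G *\<^sub>R (\<Sum>q'\<le>K. bmat K q q' *\<^sub>R (\<Sum>p\<le>K. X.lag i p x *\<^sub>R g (elem_node i j p q')))"
proof -
  let ?c = "org2 G + step2 G * real j"
  note b = Y.pt_bounds[OF i(3,2)]
  have "x \<in> {org1 G .. org1 G + step1 G * real (num1 G)}"
    using x i nm X.cells_Un by auto
  then have "continuous_on {org2 G .. Y.pt j q} (\<lambda>y. interpolant K G g (x, y))"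
    using b by (intro continuous_on_compose2[OF continuous_interpolant] continuous_intros)
      (auto simp: domain_eq)
  then have "(\<lambda>y. interpolant K G g (x, y)) integrable_on {org2 G .. Y.pt j q}"
    by (rule integrable_continuous_real)
  then have "integral {org2 G .. Y.pt j q} (\<lambda>y. interpolant K G g (x, y))
      = integral {org2 G .. ?c} (\<lambda>y. interpolant K G g (x, y))
        + integral {?c .. Y.pt j q} (\<lambda>y. interpolant K G g (x, y))"
    using b by (intro Henstock_Kurzweil_Integration.integral_combine[symmetric]) auto
  moreover have "integral {?c .. Y.pt j q} (\<lambda>y. interpolant K G g (x, y)) = (\<Sum>q'\<le>K. (step2 G * bmat K q q') *\<^sub>R (\<Sum>p\<le>K. X.lag i p x *\<^sub>R g (elem_node i j p q')))"
  proof -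
  have I: "((\<lambda>y. \<Sum>q'\<le>K. Y.lag j q' y *\<^sub>R (\<Sum>p\<le>K. X.lag i p x *\<^sub>R g (elem_node i j p q'))) has_integral
      (\<Sum>q'\<le>K. (step2 G * bmat K q q') *\<^sub>R (\<Sum>p\<le>K. X.lag i p x *\<^sub>R g (elem_node i j p q')))) {?c .. Y.pt j q}"
    by (intro has_integral_sum has_integral_scaleR_left Y.lag_has_integral i) auto
  have eq: "interpolant K G g (x, y) = (\<Sum>q'\<le>K. Y.lag j q' y *\<^sub>R (\<Sum>p\<le>K. X.lag i p x *\<^sub>R g (elem_node i j p q')))"
    if "y \<in> {?c .. Y.pt j q}" for y
  proof -
    have "(x, y) \<in> elem G i j" using that x b by (auto simp: elem_eq Y.cell_def)
    from interpolant_elem[OF i(1,2) this, of g]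
    have "interpolant K G g (x, y) = (\<Sum>q'\<le>K. \<Sum>p\<le>K. (X.lag i p x * Y.lag j q' y) *\<^sub>R g (elem_node i j p q'))"
      by (subst sum.swap) simp
    then show ?thesis by (simp add: scaleR_sum_right mult.commute)
  qed
  show ?thesis using I by (intro integral_unique) (simp only: has_integral_cong[OF eq])
  qed
  ultimately show ?thesis by (simp add: scaleR_sum_right mult.assoc)
qed

lemma integral_interpolant_fst:
  fixes g :: "real \<times> real \<Rightarrow> 'b::banach"
  assumes i: "i < num1 G" "j < num2 G" "p \<le> K" and y: "y \<in> Y.cell j"
  shows "integral {org1 G .. X.pt i p} (\<lambda>x. interpolant K G g (x, y))
    = integral {org1 G .. org1 G + step1 G * real i} (\<lambda>x. interpolant K G g (x, y))
      + step1 G *\<^sub>R (\<Sum>p'\<le>K. bmat K p p' *\<^sub>R (\<Sum>q\<le>K. Y.lag j q y *\<^sub>R g (elem_node i j p' q)))"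
proof -
  let ?c = "org1 G + step1 G * real i"
  note b = X.pt_bounds[OF i(3,1)]
  have "y \<in> {org2 G .. org2 G + step2 G * real (num2 G)}"
    using y i nm Y.cells_Un by auto
  then have "continuous_on {org1 G .. X.pt i p} (\<lambda>x. interpolant K G g (x, y))"
    using b by (intro continuous_on_compose2[OF continuous_interpolant] continuous_intros)
      (auto simp: domain_eq)
  then have "(\<lambda>x. interpolant K G g (x, y)) integrable_on {org1 G .. X.pt i p}"
    by (rule integrable_continuous_real)
  then have "integral {org1 G .. X.pt i p} (\<lambda>x. interpolant K G g (x, y))
      = integral {org1 G .. ?c} (\<lambda>x. interpolant K G g (x, y))
        + integral {?c .. X.pt i p} (\<lambda>x. interpolant K G g (x, y))"
    using b by (intro Henstock_Kurzweil_Integration.integral_combine[symmetric]) auto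
  moreover have "integral {?c .. X.pt i p} (\<lambda>x. interpolant K G g (x, y)) = (\<Sum>p'\<le>K. (step1 G * bmat K p p') *\<^sub>R (\<Sum>q\<le>K. Y.lag j q y *\<^sub>R g (elem_node i j p' q)))"
  proof -
  have I: "((\<lambda>x. \<Sum>p'\<le>K. X.lag i p' x *\<^sub>R (\<Sum>q\<le>K. Y.lag j q y *\<^sub>R g (elem_node i j p' q))) has_integral
      (\<Sum>p'\<le>K. (step1 G * bmat K p p') *\<^sub>R (\<Sum>q\<le>K. Y.lag j q y *\<^sub>R g (elem_node i j p' q)))) {?c .. X.pt i p}"
    by (intro has_integral_sum has_integral_scaleR_left X.lag_has_integral i) auto
  have eq: "interpolant K G g (x, y) = (\<Sum>p'\<le>K. X.lag i p' x *\<^sub>R (\<Sum>q\<le>K. Y.lag j q y *\<^sub>R g (elem_node i j p' q)))"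
    if "x \<in> {?c .. X.pt i p}" for x
  proof -
    have "(x, y) \<in> elem G i j" using that y b by (auto simp: elem_eq X.cell_def)
    from interpolant_elem[OF i(1,2) this, of g] show ?thesis
      by (simp add: scaleR_sum_right)
  qed
  show ?thesis using I by (intro integral_unique) (simp only: has_integral_cong[OF eq])
  qed
  ultimately show ?thesis by (simp add: scaleR_sum_right mult.assoc)
qed

lemma sum_lag_pt:
  fixes v :: "nat \<Rightarrow> 'b::real_vector"
  shows "p \<le> K \<Longrightarrow> (\<Sum>r\<le>K. X.lag i r (X.pt i p) *\<^sub>R v r) = v p"
    and "p \<le> K \<Longrightarrow> (\<Sum>r\<le>K. Y.lag j r (Y.pt j p) *\<^sub>R v r) = v p"
proof -
  assume p: "p \<le> K"
  have "(\<Sum>r\<le>K. X.lag i r (X.pt i p) *\<^sub>R v r) = (\<Sum>r\<le>K. if r = p then v r else 0)"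
    using p by (intro sum.cong) (auto simp: X.lag_pt)
  then show "(\<Sum>r\<le>K. X.lag i r (X.pt i p) *\<^sub>R v r) = v p" using p by simp
  have "(\<Sum>r\<le>K. Y.lag j r (Y.pt j p) *\<^sub>R v r) = (\<Sum>r\<le>K. if r = p then v r else 0)"
    using p by (intro sum.cong) (auto simp: Y.lag_pt)
  then show "(\<Sum>r\<le>K. Y.lag j r (Y.pt j p) *\<^sub>R v r) = v p" using p by simp
qed

text \<open>The rectangle from the mesh corner to the node consists of a strip left of the element,
  independent of \<open>p\<close>, a part below the element, independent of \<open>q\<close>, and a
  piece inside the element.\<close>

lemma integral_interpolant_both:
  fixes g :: "real \<times> real \<Rightarrow> 'b::banach"
  assumes i: "i < num1 G" "j < num2 G"
  shows "\<exists>c c'. \<forall>p\<le>K. \<forall>q\<le>K.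
    integral {org1 G .. X.pt i p} (\<lambda>x. integral {org2 G .. Y.pt j q} (\<lambda>y. interpolant K G g (x, y)))
    = c p + c' q + (step1 G * step2 G) *\<^sub>R
        (\<Sum>p'\<le>K. \<Sum>q'\<le>K. (bmat K p p' * bmat K q q') *\<^sub>R g (elem_node i j p' q'))"
proof -
  let ?cx = "org1 G + step1 G * real i" and ?cy = "org2 G + step2 G * real j"
  define H where "H y x = integral {org2 G .. y} (\<lambda>y. interpolant K G g (x, y))" for y x
  have H: "continuous_on {org1 G .. org1 G + step1 G * real (num1 G)} (H y)"
    if "y \<le> org2 G + step2 G * real (num2 G)" for y
    unfolding H_def box_real[symmetric]
    using that by (intro integral_continuous_on_param)
      (auto simp: case_prod_unfold domain_eq intro!: continuous_on_subset[OF continuous_interpolant])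
  define c where "c p = integral {?cx .. X.pt i p} (H ?cy)" for p
  define c' where "c' q = integral {org1 G .. ?cx} (H (Y.pt j q))" for q
  have "integral {org1 G .. X.pt i p} (H (Y.pt j q)) = c p + c' q + (step1 G * step2 G) *\<^sub>R
        (\<Sum>p'\<le>K. \<Sum>q'\<le>K. (bmat K p p' * bmat K q q') *\<^sub>R g (elem_node i j p' q'))"
    if pq: "p \<le> K" "q \<le> K" for p q
  proof -
    note bx = X.pt_bounds[OF pq(1) i(1)]
    note by' = Y.pt_bounds[OF pq(2) i(2)]
    have "H (Y.pt j q) integrable_on {org1 G .. X.pt i p}"
      using bx by' by (intro integrable_continuous_real continuous_on_subset[OF H]) auto
    then have 1: "integral {org1 G .. X.pt i p} (H (Y.pt j q)) = c' q + integral {?cx .. X.pt i p} (H (Y.pt j q))"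
      unfolding c'_def using bx by (intro Henstock_Kurzweil_Integration.integral_combine[symmetric]) auto
    let ?S = "\<lambda>p'. \<Sum>q'\<le>K. bmat K q q' *\<^sub>R g (elem_node i j p' q')"
    have "(H ?cy has_integral c p) {?cx .. X.pt i p}"
      unfolding c_def using bx(1,2,4) order_trans[OF by'(2,4)]
      by (intro integrable_integral integrable_continuous_real continuous_on_subset[OF H]) auto
    then have 2: "((\<lambda>x. H ?cy x + step2 G *\<^sub>R (\<Sum>p'\<le>K. X.lag i p' x *\<^sub>R ?S p')) has_integral
        c p + step2 G *\<^sub>R (\<Sum>p'\<le>K. (step1 G * bmat K p p') *\<^sub>R ?S p')) {?cx .. X.pt i p}"
      by (intro has_integral_add has_integral_cmul has_integral_sum has_integral_scaleR_left
          X.lag_has_integral pq) auto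
    have 3: "H (Y.pt j q) x = H ?cy x + step2 G *\<^sub>R (\<Sum>p'\<le>K. X.lag i p' x *\<^sub>R ?S p')"
      if "x \<in> {?cx .. X.pt i p}" for x
    proof -
      have "x \<in> X.cell i" using that bx by (auto simp: X.cell_def)
      have "(\<Sum>q'\<le>K. bmat K q q' *\<^sub>R (\<Sum>p\<le>K. X.lag i p x *\<^sub>R g (elem_node i j p q')))
          = (\<Sum>q'\<le>K. \<Sum>p\<le>K. (X.lag i p x * bmat K q q') *\<^sub>R g (elem_node i j p q'))"
        by (simp add: scaleR_sum_right mult.commute)
      also have "\<dots> = (\<Sum>p'\<le>K. X.lag i p' x *\<^sub>R ?S p')"
        by (subst sum.swap) (simp add: scaleR_sum_right)
      finally show ?thesis
        unfolding H_def integral_interpolant_snd[OF i pq(2) \<open>x \<in> X.cell i\<close>] by simp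
    qed
    have "integral {?cx .. X.pt i p} (H (Y.pt j q)) = c p + step2 G *\<^sub>R (\<Sum>p'\<le>K. (step1 G * bmat K p p') *\<^sub>R ?S p')"
      using 2 by (intro integral_unique) (simp only: has_integral_cong[OF 3])
    then show ?thesis
      unfolding 1 by (simp add: scaleR_sum_right mult_ac)
  qed
  then show ?thesis unfolding H_def by blast
qed

definition potential ::
    "(real^'s \<Rightarrow> real^'s) \<Rightarrow> (real^'s \<Rightarrow> real^'s) \<Rightarrow> (real^'s \<Rightarrow> real \<times> real \<Rightarrow> real^'s) \<Rightarrow>
     (real \<times> real \<Rightarrow> real^'s) \<Rightarrow> real \<times> real \<Rightarrow> real^'s::finite"
  where "potential F1 F2 S W y =
    flux_potential1 K G F1 W y + flux_potential2 K G F2 W y + source_potential K G S W y"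

text \<open>\<open>c\<close> and \<open>c'\<close> collect everything outside the element. This is
  the form required by \<open>mixed_potential\<close>, which discards them.\<close>

lemma potential_elem_node:
  assumes i: "i < num1 G" "j < num2 G"
  shows "\<exists>c c'. \<forall>r\<le>K. \<forall>q\<le>K. potential F1 F2 S W (elem_node i j r q) =
      step2 G *\<^sub>R (\<Sum>q'\<le>K. bmat K q q' *\<^sub>R F1 (W (elem_node i j r q')))
      + step1 G *\<^sub>R (\<Sum>r'\<le>K. bmat K r r' *\<^sub>R F2 (W (elem_node i j r' q)))
      - (step1 G * step2 G) *\<^sub>R (\<Sum>r'\<le>K. \<Sum>q'\<le>K. (bmat K r r' * bmat K q q') *\<^sub>R
          S (W (elem_node i j r' q')) (elem_node i j r' q'))
      + c r + c' q"
proof -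
  obtain d d' where d: "\<And>p q. p \<le> K \<Longrightarrow> q \<le> K \<Longrightarrow>
    integral {org1 G .. X.pt i p} (\<lambda>x. integral {org2 G .. Y.pt j q} (\<lambda>y.
        interpolant K G (\<lambda>x. S (W x) x) (x, y)))
    = d p + d' q + (step1 G * step2 G) *\<^sub>R
        (\<Sum>p'\<le>K. \<Sum>q'\<le>K. (bmat K p p' * bmat K q q') *\<^sub>R S (W (elem_node i j p' q')) (elem_node i j p' q'))"
    using integral_interpolant_both[OF i, of "\<lambda>x. S (W x) x"] by blast
  \<comment> \<open>The contributions of the source are subtracted because
    \<open>source_potential\<close> carries a minus sign.\<close>
  define c where "c r = integral {org2 G .. org2 G + step2 G * real j}
    (\<lambda>y. interpolant K G (\<lambda>x. F1 (W x)) (X.pt i r, y)) - d r" for r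
  define c' where "c' q = integral {org1 G .. org1 G + step1 G * real i}
    (\<lambda>x. interpolant K G (\<lambda>x. F2 (W x)) (x, Y.pt j q)) - d' q" for q
  have "potential F1 F2 S W (elem_node i j r q) =
      step2 G *\<^sub>R (\<Sum>q'\<le>K. bmat K q q' *\<^sub>R F1 (W (elem_node i j r q')))
      + step1 G *\<^sub>R (\<Sum>r'\<le>K. bmat K r r' *\<^sub>R F2 (W (elem_node i j r' q)))
      - (step1 G * step2 G) *\<^sub>R (\<Sum>r'\<le>K. \<Sum>q'\<le>K. (bmat K r r' * bmat K q q') *\<^sub>R
          S (W (elem_node i j r' q')) (elem_node i j r' q'))
      + c r + c' q" if rq: "r \<le> K" "q \<le> K" for r q
  proof -
    have n: "elem_node i j r q \<in> nodes K G" using elem_node_in_nodes[OF i rq] .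
    have x: "X.pt i r \<in> X.cell i" "Y.pt j q \<in> Y.cell j" using X.pt_cell Y.pt_cell rq by auto
    have f1: "flux_potential1 K G F1 W (elem_node i j r q) = c r + d r
        + step2 G *\<^sub>R (\<Sum>q'\<le>K. bmat K q q' *\<^sub>R F1 (W (elem_node i j r q')))"
      unfolding flux_potential1_def interpolant_node[OF n]
      by (simp add: elem_node_def[of i j r q] integral_interpolant_snd[OF i rq(2) x(1)] c_def
          sum_lag_pt[OF rq(1)])
    have f2: "flux_potential2 K G F2 W (elem_node i j r q) = c' q + d' q
        + step1 G *\<^sub>R (\<Sum>r'\<le>K. bmat K r r' *\<^sub>R F2 (W (elem_node i j r' q)))"
      unfolding flux_potential2_def interpolant_node[OF n]
      by (simp add: elem_node_def[of i j r q] integral_interpolant_fst[OF i rq(1) x(2)] c'_def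
          sum_lag_pt[OF rq(2)])
    have s: "source_potential K G S W (elem_node i j r q) = - (d r + d' q + (step1 G * step2 G) *\<^sub>R
        (\<Sum>p'\<le>K. \<Sum>q'\<le>K. (bmat K r p' * bmat K q q') *\<^sub>R S (W (elem_node i j p' q')) (elem_node i j p' q')))"
      unfolding source_potential_def interpolant_node[OF n]
      by (simp add: elem_node_def[of i j r q] d[OF rq])
    show ?thesis unfolding potential_def f1 f2 s by (simp add: algebra_simps)
  qed
  then show ?thesis by blast
qed

lemma potential_elem:
  assumes i: "i < num1 G" "j < num2 G" and z: "z \<in> elem G i j"
  shows "potential F1 F2 S W z =
    (\<Sum>p\<le>K. \<Sum>q\<le>K. (X.lag i p (fst z) * Y.lag j q (snd z)) *\<^sub>R potential F1 F2 S W (elem_node i j p q))"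
proof -
  have *: "interpolant K G g z = (\<Sum>p\<le>K. \<Sum>q\<le>K. (X.lag i p (fst z) * Y.lag j q (snd z)) *\<^sub>R
      interpolant K G g (elem_node i j p q))" for g :: "real \<times> real \<Rightarrow> real^'a"
    using interpolant_elem[OF i, of "fst z" "snd z" g] z
    by (simp add: interpolant_node elem_node_in_nodes[OF i])
  show ?thesis
    unfolding potential_def flux_potential1_def flux_potential2_def source_potential_def *
    by (simp add: scaleR_add_right sum.distrib)
qed

section \<open>Residual and SUPG terms at the quadrature nodes\<close>

definition residual :: "nat \<Rightarrow> nat \<Rightarrow> (real \<times> real \<Rightarrow> real^'s) \<Rightarrow> real \<times> real \<Rightarrow> real^'s::finite"
  where "residual i j U = partial1 (elem G i j) (partial2 (elem G i j) U)"

lemma residual_elem_node: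
  assumes U: "\<And>z. z \<in> elem G i j \<Longrightarrow>
    U z = (\<Sum>p\<le>K. \<Sum>q\<le>K. (X.lag i p (fst z) * Y.lag j q (snd z)) *\<^sub>R U (elem_node i j p q))"
    and ps: "p \<le> K" "s \<le> K"
  shows "residual i j U (elem_node i j p s) =
    (1 / (step1 G * step2 G)) *\<^sub>R mixed K (\<lambda>r q. U (elem_node i j r q)) p s"
proof -
  have 1: "partial2 (elem G i j) U z =
      (\<Sum>p\<le>K. \<Sum>q\<le>K. (X.lag i p (fst z) * Y.dlag j q (snd z)) *\<^sub>R U (elem_node i j p q))"
    if "z \<in> elem G i j" for z
    by (rule tensor_sum_partial(2)[OF proper_box_elem that U X.lag_deriv Y.lag_deriv])
  have "residual i j U (elem_node i j p s) = (\<Sum>r\<le>K. \<Sum>q\<le>K.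
      (X.dlag i r (fst (elem_node i j p s)) * Y.dlag j q (snd (elem_node i j p s))) *\<^sub>R U (elem_node i j r q))"
    unfolding residual_def
    by (rule tensor_sum_partial(1)[OF proper_box_elem elem_node_in_elem[OF ps] 1 X.lag_deriv Y.dlag_deriv])
  then show ?thesis
    by (simp add: elem_node_def[of i j p s] X.dlag_pt Y.dlag_pt mixed_def scaleR_sum_right)
qed

text \<open>Quadrature nodes are interpolation nodes, so each undifferentiated factor is a Kronecker
  delta and a partial derivative couples only nodes on a common mesh line.\<close>

lemma tensor_basis_partial:
  assumes i: "i < num1 G" "j < num2 G" and rt: "r \<le> K" "t \<le> K" and ps: "p \<le> K" "s \<le> K"
  shows "tensor_basis (elem_node i j r t) (elem_node i j p s) = (if p = r \<and> s = t then 1 else 0)"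
    "partial1 (elem G i j) (tensor_basis (elem_node i j r t)) (elem_node i j p s) = (if s = t then dmat K p r / step1 G else 0)"
    "partial2 (elem G i j) (tensor_basis (elem_node i j r t)) (elem_node i j p s) = (if p = r then dmat K s t / step2 G else 0)"
proof -
  show "tensor_basis (elem_node i j r t) (elem_node i j p s) = (if p = r \<and> s = t then 1 else 0)"
    using tensor_basis_elem_node[OF i rt, of "X.pt i p" "Y.pt j s"] elem_node_in_elem[OF ps, of i j] rt ps
    by (simp add: elem_node_def[of i j p s] X.lag_pt Y.lag_pt)
  have D: "((\<lambda>z. (X.lag i r (fst z) * Y.lag j t (snd z)) *\<^sub>R (1::real)) has_derivative
      (\<lambda>d. (X.dlag i r (fst (elem_node i j p s)) * fst d * Y.lag j t (snd (elem_node i j p s))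
        + X.lag i r (fst (elem_node i j p s)) * (Y.dlag j t (snd (elem_node i j p s)) * snd d)) *\<^sub>R 1))
      (at (elem_node i j p s) within elem G i j)"
    by (rule tensor_has_derivative[OF X.lag_deriv Y.lag_deriv])
  have "(tensor_basis (elem_node i j r t) has_derivative
      (\<lambda>d. (X.dlag i r (fst (elem_node i j p s)) * fst d * Y.lag j t (snd (elem_node i j p s))
        + X.lag i r (fst (elem_node i j p s)) * (Y.dlag j t (snd (elem_node i j p s)) * snd d)) *\<^sub>R 1))
      (at (elem_node i j p s) within elem G i j)"
    by (rule has_derivative_transform[OF elem_node_in_elem[OF ps] _ D]) (use tensor_basis_elem_node[OF i rt] in auto)
  note F = frechet_derivative_proper_box[OF proper_box_elem elem_node_in_elem[OF ps] this]
  show "partial1 (elem G i j) (tensor_basis (elem_node i j r t)) (elem_node i j p s) = (if s = t then dmat K p r / step1 G else 0)"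
    "partial2 (elem G i j) (tensor_basis (elem_node i j r t)) (elem_node i j p s) = (if p = r then dmat K s t / step2 G else 0)"
    unfolding partial1_def partial2_def F using rt ps
    by (auto simp: elem_node_def X.lag_pt Y.lag_pt X.dlag_pt Y.dlag_pt)
qed

lemma scaleR_matrix_vector: "(c *\<^sub>R A) *v x = c *\<^sub>R (A *v x)" for A :: "real^'m^'n"
  by (simp add: scaleR_matrix_vector_assoc)

text \<open>Summing over \<open>\<alpha>\<close> before the quadrature nodes replaces the test
  functions by the interpolant of \<open>\<psi>\<close>: its value appears in the Galerkin part and
  its two partial derivatives in the SUPG part.\<close>

lemma truncation_error_elements:
  fixes F1 F2 :: "real^'s::finite \<Rightarrow> real^'s" and S :: "real^'s \<Rightarrow> real \<times> real \<Rightarrow> real^'s"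
    and \<tau> :: "nat \<Rightarrow> nat \<Rightarrow> real \<times> real \<Rightarrow> real^'s \<Rightarrow> real^'s^'s" and W :: "real \<times> real \<Rightarrow> real^'s"
  defines "R \<equiv> \<lambda>i j p s. residual i j (potential F1 F2 S W) (elem_node i j p s)"
    and "A1 \<equiv> \<lambda>i j z. jacobian_matrix F1 (W z) ** \<tau> i j z (W z)"
    and "A2 \<equiv> \<lambda>i j z. jacobian_matrix F2 (W z) ** \<tau> i j z (W z)"
  shows "truncation_error K G F1 F2 S \<tau> W \<psi> = (\<Sum>i<num1 G. \<Sum>j<num2 G. \<Sum>p\<le>K. \<Sum>s\<le>K.
    (step1 G * bmat K K p * (step2 G * bmat K K s)) *\<^sub>R
      (\<psi> (elem_node i j p s) *\<^sub>R R i j p s +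
        (((\<Sum>r\<le>K. dmat K p r * \<psi> (elem_node i j r s)) / step1 G) *\<^sub>R (A1 i j (elem_node i j p s) *v R i j p s)
        + ((\<Sum>t\<le>K. dmat K s t * \<psi> (elem_node i j p t)) / step2 G) *\<^sub>R (A2 i j (elem_node i j p s) *v R i j p s))))"
proof -
  have "truncation_error K G F1 F2 S \<tau> W \<psi> =
      (\<Sum>i<num1 G. \<Sum>j<num2 G. \<Sum>\<alpha>\<in>nodes K G. \<psi> \<alpha> *\<^sub>R fluctuation K G F1 F2 S \<tau> W i j \<alpha>)"
    unfolding truncation_error_def scaleR_sum_right
    by (subst sum.swap, intro sum.cong refl, rule sum.swap)
  also have "\<dots> = (\<Sum>i<num1 G. \<Sum>j<num2 G. \<Sum>p\<le>K. \<Sum>s\<le>K.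
    (step1 G * bmat K K p * (step2 G * bmat K K s)) *\<^sub>R
      (\<psi> (elem_node i j p s) *\<^sub>R R i j p s +
        (((\<Sum>r\<le>K. dmat K p r * \<psi> (elem_node i j r s)) / step1 G) *\<^sub>R (A1 i j (elem_node i j p s) *v R i j p s)
        + ((\<Sum>t\<le>K. dmat K s t * \<psi> (elem_node i j p t)) / step2 G) *\<^sub>R (A2 i j (elem_node i j p s) *v R i j p s))))"
  proof (intro sum.cong refl)
    fix i j assume "i \<in> {..<num1 G}" "j \<in> {..<num2 G}"
    then have i: "i < num1 G" "j < num2 G" by auto
    let ?w = "\<lambda>p s. step1 G * bmat K K p * (step2 G * bmat K K s)"
    let ?X = "\<lambda>r t p s. (if p = r \<and> s = t then 1 else 0) *\<^sub>R R i j p s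
      + ((if s = t then dmat K p r / step1 G else 0) *\<^sub>R (A1 i j (elem_node i j p s) *v R i j p s)
      + (if p = r then dmat K s t / step2 G else 0) *\<^sub>R (A2 i j (elem_node i j p s) *v R i j p s))"
    have fl: "fluctuation K G F1 F2 S \<tau> W i j (elem_node i j r t) = (\<Sum>p\<le>K. \<Sum>s\<le>K. ?w p s *\<^sub>R ?X r t p s)"
      if rt: "r \<le> K" "t \<le> K" for r t
      unfolding fluctuation_def quadrature_def if_P[OF elem_node_in_elem[OF rt]]
    proof (intro sum.cong refl)
      fix p s assume "p \<in> {..K}" "s \<in> {..K}"
      then have ps: "p \<le> K" "s \<le> K" by auto
      have elem_node: "(node1 G K i p, node2 G K j s) = elem_node i j p s" by (simp add: elem_node_def node1_def node2_def)
      have R': "partial1 (elem G i j) (partial2 (elem G i j) (\<lambda>y. flux_potential1 K G F1 W y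
          + flux_potential2 K G F2 W y + source_potential K G S W y)) (elem_node i j p s) = R i j p s"
        by (simp add: R_def residual_def potential_def[abs_def])
      show "(cell_weight (org1 G) (step1 G) K i p * cell_weight (org2 G) (step2 G) K j s) *\<^sub>R
         ((nodal_basis K G (elem_node i j r t) (node1 G K i p, node2 G K j s) *\<^sub>R mat 1
           + (partial1 (elem G i j) (nodal_basis K G (elem_node i j r t)) (node1 G K i p, node2 G K j s) *\<^sub>R
              (jacobian_matrix F1 (W (node1 G K i p, node2 G K j s)) **
                 \<tau> i j (node1 G K i p, node2 G K j s) (W (node1 G K i p, node2 G K j s)))
             + partial2 (elem G i j) (nodal_basis K G (elem_node i j r t)) (node1 G K i p, node2 G K j s) *\<^sub>R
              (jacobian_matrix F2 (W (node1 G K i p, node2 G K j s)) **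
                 \<tau> i j (node1 G K i p, node2 G K j s) (W (node1 G K i p, node2 G K j s)))))
         *v partial1 (elem G i j) (partial2 (elem G i j)
              (\<lambda>y. flux_potential1 K G F1 W y + flux_potential2 K G F2 W y
                   + source_potential K G S W y)) (node1 G K i p, node2 G K j s))
        = ?w p s *\<^sub>R ?X r t p s"
        unfolding elem_node R' nodal_basis_tensor_basis tensor_basis_partial[OF i rt ps] X.cell_weight_bmat Y.cell_weight_bmat
        by (simp add: A1_def A2_def matrix_vector_mult_add_rdistrib scaleR_matrix_vector)
    qed
    \<comment> \<open>Fluctuations are zero by definition at nodes outside the element.\<close>
    have "(\<Sum>\<alpha>\<in>nodes K G. \<psi> \<alpha> *\<^sub>R fluctuation K G F1 F2 S \<tau> W i j \<alpha>)
        = (\<Sum>\<alpha>\<in>{\<alpha>\<in>nodes K G. \<alpha> \<in> elem G i j}. \<psi> \<alpha> *\<^sub>R fluctuation K G F1 F2 S \<tau> W i j \<alpha>)"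
      by (rule sum.mono_neutral_right[OF finite_nodes]) (auto simp: fluctuation_def)
    also have "\<dots> = (\<Sum>r\<le>K. \<Sum>t\<le>K. \<psi> (elem_node i j r t) *\<^sub>R (\<Sum>p\<le>K. \<Sum>s\<le>K. ?w p s *\<^sub>R ?X r t p s))"
      unfolding sum_nodes_elem[OF i] by (intro sum.cong refl) (simp add: fl)
    also have "\<dots> = (\<Sum>r\<le>K. \<Sum>t\<le>K. \<Sum>p\<le>K. \<Sum>s\<le>K. ?w p s *\<^sub>R \<psi> (elem_node i j r t) *\<^sub>R ?X r t p s)"
      unfolding scaleR_sum_right by (simp only: scaleR_left_commute)
    also have "\<dots> = (\<Sum>p\<le>K. \<Sum>s\<le>K. \<Sum>r\<le>K. \<Sum>t\<le>K. ?w p s *\<^sub>R \<psi> (elem_node i j r t) *\<^sub>R ?X r t p s)"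
    proof -
      have swap: "(\<Sum>t\<le>K. \<Sum>p\<le>K. \<Sum>s\<le>K. f t p s) = (\<Sum>p\<le>K. \<Sum>s\<le>K. \<Sum>t\<le>K. f t p s)"
        for f :: "nat \<Rightarrow> nat \<Rightarrow> nat \<Rightarrow> real^'s"
        by (subst sum.swap, rule sum.cong[OF refl], rule sum.swap)
      have "(\<Sum>r\<le>K. \<Sum>t\<le>K. \<Sum>p\<le>K. \<Sum>s\<le>K. f r t p s) = (\<Sum>p\<le>K. \<Sum>s\<le>K. \<Sum>r\<le>K. \<Sum>t\<le>K. f r t p s)"
        for f :: "nat \<Rightarrow> nat \<Rightarrow> nat \<Rightarrow> nat \<Rightarrow> real^'s"
        unfolding swap[of "f _"] by (rule swap)
      then show ?thesis .
    qed
    also have "\<dots> = (\<Sum>p\<le>K. \<Sum>s\<le>K. ?w p s *\<^sub>R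
      (\<psi> (elem_node i j p s) *\<^sub>R R i j p s +
        (((\<Sum>r\<le>K. dmat K p r * \<psi> (elem_node i j r s)) / step1 G) *\<^sub>R (A1 i j (elem_node i j p s) *v R i j p s)
        + ((\<Sum>t\<le>K. dmat K s t * \<psi> (elem_node i j p t)) / step2 G) *\<^sub>R (A2 i j (elem_node i j p s) *v R i j p s))))"
    proof (intro sum.cong refl)
      fix p s assume "p \<in> {..K}" "s \<in> {..K}"
      then have ps: "p \<le> K" "s \<le> K" by auto
      have 1: "(\<Sum>r\<le>K. \<Sum>t\<le>K. \<psi> (elem_node i j r t) *\<^sub>R (if p = r \<and> s = t then 1 else 0) *\<^sub>R v)
          = \<psi> (elem_node i j p s) *\<^sub>R v" for v :: "real^'s"
      proof -
        have "(\<Sum>r\<le>K. \<Sum>t\<le>K. \<psi> (elem_node i j r t) *\<^sub>R (if p = r \<and> s = t then 1 else 0) *\<^sub>R v)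
            = (\<Sum>r\<le>K. \<Sum>t\<le>K. if s = t then (if p = r then \<psi> (elem_node i j r t) *\<^sub>R v else 0) else 0)"
          by (intro sum.cong refl) auto
        then show ?thesis using ps by simp
      qed
      have 2: "(\<Sum>r\<le>K. \<Sum>t\<le>K. \<psi> (elem_node i j r t) *\<^sub>R (if s = t then dmat K p r / step1 G else 0) *\<^sub>R v)
          = ((\<Sum>r\<le>K. dmat K p r * \<psi> (elem_node i j r s)) / step1 G) *\<^sub>R v" for v :: "real^'s"
      proof -
        have "(\<Sum>r\<le>K. \<Sum>t\<le>K. \<psi> (elem_node i j r t) *\<^sub>R (if s = t then dmat K p r / step1 G else 0) *\<^sub>R v)
            = (\<Sum>r\<le>K. \<Sum>t\<le>K. if s = t then (dmat K p r * \<psi> (elem_node i j r t) / step1 G) *\<^sub>R v else 0)"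
          by (intro sum.cong refl) (simp add: mult.commute)
        then show ?thesis using ps by (simp add: sum_divide_distrib scaleR_sum_left)
      qed
      have 3: "(\<Sum>r\<le>K. \<Sum>t\<le>K. \<psi> (elem_node i j r t) *\<^sub>R (if p = r then dmat K s t / step2 G else 0) *\<^sub>R v)
          = ((\<Sum>t\<le>K. dmat K s t * \<psi> (elem_node i j p t)) / step2 G) *\<^sub>R v" for v :: "real^'s"
      proof -
        have "(\<Sum>r\<le>K. \<Sum>t\<le>K. \<psi> (elem_node i j r t) *\<^sub>R (if p = r then dmat K s t / step2 G else 0) *\<^sub>R v)
            = (\<Sum>t\<le>K. \<Sum>r\<le>K. if p = r then (dmat K s t * \<psi> (elem_node i j r t) / step2 G) *\<^sub>R v else 0)"
          by (subst sum.swap, intro sum.cong refl) (simp add: mult.commute)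
        then show ?thesis using ps by (simp add: sum_divide_distrib scaleR_sum_left)
      qed
      show "(\<Sum>r\<le>K. \<Sum>t\<le>K. ?w p s *\<^sub>R \<psi> (elem_node i j r t) *\<^sub>R ?X r t p s) = ?w p s *\<^sub>R
        (\<psi> (elem_node i j p s) *\<^sub>R R i j p s +
        (((\<Sum>r\<le>K. dmat K p r * \<psi> (elem_node i j r s)) / step1 G) *\<^sub>R (A1 i j (elem_node i j p s) *v R i j p s)
        + ((\<Sum>t\<le>K. dmat K s t * \<psi> (elem_node i j p t)) / step2 G) *\<^sub>R (A2 i j (elem_node i j p s) *v R i j p s)))"
        unfolding scaleR_sum_right[symmetric] scaleR_add_right sum.distrib 1 2 3 ..
    qed
    finally show "(\<Sum>\<alpha>\<in>nodes K G. \<psi> \<alpha> *\<^sub>R fluctuation K G F1 F2 S \<tau> W i j \<alpha>) = \<dots>" .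
  qed
  finally show ?thesis .
qed

end

section \<open>Bounds independent of the mesh\<close>

lemma norm_matrix_vector_le:
  fixes A :: "real^'m^'n"
  shows "norm (A *v x) \<le> real CARD('n) * norm A * norm x"
proof -
  have "norm (A *v x) \<le> (\<Sum>i\<in>UNIV. \<bar>(A *v x) $ i\<bar>)" by (rule norm_le_l1_cart)
  also have "\<dots> \<le> (\<Sum>i\<in>(UNIV :: 'n set). norm A * norm x)"
  proof (rule sum_mono)
    fix i
    have "\<bar>(A *v x) $ i\<bar> = \<bar>A $ i \<bullet> x\<bar>" by (simp add: matrix_vector_mul_component)
    also have "\<dots> \<le> norm (A $ i) * norm x" by (rule Cauchy_Schwarz_ineq2)
    also have "\<dots> \<le> norm A * norm x" by (intro mult_right_mono Finite_Cartesian_Product.norm_nth_le) auto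
    finally show "\<bar>(A *v x) $ i\<bar> \<le> norm A * norm x" .
  qed
  finally show ?thesis by simp
qed

text \<open>The derivative in each basis direction is continuous on \<open>Q\<close>, hence bounded
  there; expanding \<open>x\<close> in the basis bounds the whole matrix.\<close>

lemma jacobian_bounded:
  fixes F :: "real^'s::finite \<Rightarrow> real^'s"
  assumes "open D" "Ck_on 1 D F" "compact Q" "Q \<subseteq> D"
  shows "\<exists>N\<ge>0. \<forall>w\<in>Q. \<forall>x. norm (jacobian_matrix F w *v x) \<le> N * norm x"
proof -
  let ?F' = "\<lambda>w. frechet_derivative F (at w)"
  have "\<exists>B. \<forall>w\<in>Q. norm (?F' w i) \<le> B" for i
  proof -
    have "continuous_on Q (\<lambda>w. frechet_derivative F (at w within D) i)"
      using assms(2,4) by (auto intro: continuous_on_subset)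
    then have "bounded ((\<lambda>w. frechet_derivative F (at w within D) i) ` Q)"
      using assms(3) compact_continuous_image compact_imp_bounded by blast
    then obtain B where "\<forall>w\<in>Q. norm (frechet_derivative F (at w within D) i) \<le> B"
      by (auto simp: bounded_iff)
    \<comment> \<open>Openness of \<open>D\<close> links \<open>Ck_on\<close>, which differentiates
      within \<open>D\<close>, to \<open>jacobian_matrix\<close>, which does not.\<close>
    moreover have "at w within D = at w" if "w \<in> Q" for w
      using that assms at_within_open by blast
    ultimately show ?thesis by auto
  qed
  then obtain B where B: "\<And>i w. w \<in> Q \<Longrightarrow> norm (?F' w i) \<le> B i" by metis
  have "norm (jacobian_matrix F w *v x) \<le> (\<Sum>i\<in>Basis. \<bar>B i\<bar>) * norm x" if w: "w \<in> Q" for w x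
  proof -
    have "(F has_derivative ?F' w) (at w)"
      using Ck_on_has_derivative[of 0 D F w] assms w at_within_open[of w D] by (auto simp del: Ck_on.simps)
    then have lin: "linear (?F' w)" by (rule has_derivative_linear)
    then have "jacobian_matrix F w *v x = ?F' w x" by (simp add: jacobian_matrix_def matrix_works)
    also have "\<dots> = ?F' w (\<Sum>i\<in>Basis. (x \<bullet> i) *\<^sub>R i)" by (simp add: euclidean_representation)
    also have "\<dots> = (\<Sum>i\<in>Basis. (x \<bullet> i) *\<^sub>R ?F' w i)" using lin by (simp add: linear_sum linear_scale)
    also have "norm \<dots> \<le> (\<Sum>i\<in>Basis. \<bar>B i\<bar> * norm x)"
    proof (rule sum_norm_le)
      fix i :: "real^'s" assume "i \<in> Basis"
      then show "norm ((x \<bullet> i) *\<^sub>R ?F' w i) \<le> \<bar>B i\<bar> * norm x"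
        unfolding norm_scaleR using B[OF w, of i] Basis_le_norm[of i x]
        by (subst mult.commute, intro mult_mono) auto
    qed
    finally show ?thesis by (simp add: sum_distrib_right)
  qed
  then show ?thesis by (intro exI[of _ "\<Sum>i\<in>Basis. \<bar>B i\<bar>"]) (auto intro: sum_nonneg)
qed

text \<open>Compactness bounds the two partial derivatives and thereby the operator norm; the mean
  value inequality on the convex set gives the Lipschitz constant.\<close>

lemma Ck_on_1_lipschitz:
  fixes f :: "real \<times> real \<Rightarrow> 'b::real_normed_vector"
  assumes "Ck_on 1 A f" "compact A" "convex A"
  shows "\<exists>L\<ge>0. \<forall>z\<in>A. \<forall>z'\<in>A. norm (f z - f z') \<le> L * norm (z - z')"
proof -
  let ?f' = "\<lambda>z. frechet_derivative f (at z within A)"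
  have "\<exists>B. \<forall>z\<in>A. norm (?f' z v) \<le> B" for v
    using iter_deriv_bounded[OF assms(1,2), of 1 v] by simp
  then obtain B where B: "\<And>v z. z \<in> A \<Longrightarrow> norm (?f' z v) \<le> B v" by metis
  define L where "L = \<bar>B (1, 0)\<bar> + \<bar>B (0, 1)\<bar>"
  have d: "(f has_derivative ?f' z) (at z within A)" if "z \<in> A" for z
    using Ck_on_has_derivative[of 0 A f z] assms(1) that by (simp del: Ck_on.simps)
  have "onorm (?f' z) \<le> L" if z: "z \<in> A" for z
  proof (rule onorm_le)
    fix d :: "real \<times> real"
    obtain u v where uv: "d = (u, v)" by (cases d)
    have lin: "linear (?f' z)" using d[OF z] by (rule has_derivative_linear)
    have "?f' z d = ?f' z (u *\<^sub>R (1, 0) + v *\<^sub>R (0, 1))" by (simp add: uv)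
    also have "\<dots> = u *\<^sub>R ?f' z (1, 0) + v *\<^sub>R ?f' z (0, 1)"
      using lin by (simp only: linear_add linear_scale)
    also have "norm \<dots> \<le> norm d * \<bar>B (1, 0)\<bar> + norm d * \<bar>B (0, 1)\<bar>"
    proof (rule order_trans[OF norm_triangle_ineq add_mono])
      show "norm (u *\<^sub>R ?f' z (1, 0)) \<le> norm d * \<bar>B (1, 0)\<bar>"
        unfolding norm_scaleR using B[OF z, of "(1, 0)"] norm_fst_le[of u v] uv
        by (intro mult_mono) auto
      show "norm (v *\<^sub>R ?f' z (0, 1)) \<le> norm d * \<bar>B (0, 1)\<bar>"
        unfolding norm_scaleR using B[OF z, of "(0, 1)"] norm_snd_le[of v u] uv
        by (intro mult_mono) auto
    qed
    finally show "norm (?f' z d) \<le> L * norm d" by (simp add: L_def algebra_simps)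
  qed
  then have "norm (f z - f z') \<le> L * norm (z - z')" if "z \<in> A" "z' \<in> A" for z z'
    using differentiable_bound[OF assms(3) d, of L z z'] that by blast
  then show ?thesis by (intro exI[of _ L]) (auto simp: L_def)
qed

section \<open>Error bounds on a single mesh\<close>

context admissible_mesh
begin

lemma coll_err_bound_fst:
  fixes f :: "real \<times> real \<Rightarrow> 'b::banach"
  assumes f: "Ck_on (K + 3) (mesh_domain G) f"
    and ij: "i < num1 G" "j < num2 G" "r \<le> K" "q \<le> K"
    and P: "P = K + 2 \<or> P = K + 3 \<and> r = K \<and> K \<ge> 2"
    and M: "\<And>z. z \<in> mesh_domain G \<Longrightarrow> norm (iter_deriv (mesh_domain G) (1, 0) f P z) \<le> M"
    and \<Lambda>: "\<And>r'. r' \<le> K \<Longrightarrow> \<bar>bmat K r r'\<bar> \<le> \<Lambda>"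
  shows "norm (coll_err K (step1 G) (\<lambda>r'. f (elem_node i j r' q))
      (\<lambda>r'. partial1 (mesh_domain G) f (elem_node i j r' q)) r) \<le> (1 + (real K + 1) * \<Lambda>) * M * step1 G ^ P"
proof -
  let ?c = "org1 G + step1 G * real i" and ?y = "Y.pt j q"
  let ?D = "\<lambda>n t. iter_deriv (mesh_domain G) (1, 0) f n (t, ?y)"
  have sub: "(t, ?y) \<in> mesh_domain G" if "t \<in> {?c .. ?c + step1 G}" for t
  proof -
    have "(t, ?y) \<in> elem G i j"
      using that Y.pt_cell[OF ij(4)] by (auto simp: elem_eq X.cell_def algebra_simps)
    then show ?thesis using domain_elem ij by blast
  qed
  have "norm (?D 0 (?c + step1 G * ref_point K r) - ?D 0 ?c
      - step1 G *\<^sub>R (\<Sum>r'\<le>K. bmat K r r' *\<^sub>R ?D 1 (?c + step1 G * ref_point K r')))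
    \<le> (1 + (real K + 1) * \<Lambda>) * M * step1 G ^ P"
  proof (rule collocation_error[OF K1 ij(3) st(1)])
    fix n t assume n: "n < P" and t: "t \<in> {?c .. ?c + step1 G}"
    show "(?D n has_vector_derivative ?D (Suc n) t) (at t within {?c .. ?c + step1 G})"
      using n P t sub
      by (intro iter_deriv_along[OF f]) (auto intro!: derivative_eq_intros
          has_vector_derivative_Pair simp: zero_prod_def)
  next
    show "norm (?D P t) \<le> M" if "t \<in> {?c .. ?c + step1 G}" for t using M sub that by blast
  qed (use P \<Lambda> K1 in auto)
  then show ?thesis
    using ref_point_ends(1)[OF K1] by (simp add: coll_err_def elem_node_def partial1_def cell_point_ref)
qed

lemma coll_err_bound_snd:
  fixes f :: "real \<times> real \<Rightarrow> 'b::banach"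
  assumes f: "Ck_on (K + 3) (mesh_domain G) f"
    and ij: "i < num1 G" "j < num2 G" "r \<le> K" "q \<le> K"
    and P: "P = K + 2 \<or> P = K + 3 \<and> q = K \<and> K \<ge> 2"
    and M: "\<And>z. z \<in> mesh_domain G \<Longrightarrow> norm (iter_deriv (mesh_domain G) (0, 1) f P z) \<le> M"
    and \<Lambda>: "\<And>r'. r' \<le> K \<Longrightarrow> \<bar>bmat K q r'\<bar> \<le> \<Lambda>"
  shows "norm (coll_err K (step2 G) (\<lambda>q'. f (elem_node i j r q'))
      (\<lambda>q'. partial2 (mesh_domain G) f (elem_node i j r q')) q) \<le> (1 + (real K + 1) * \<Lambda>) * M * step2 G ^ P"
proof -
  let ?c = "org2 G + step2 G * real j" and ?x = "X.pt i r"
  let ?D = "\<lambda>n t. iter_deriv (mesh_domain G) (0, 1) f n (?x, t)"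
  have sub: "(?x, t) \<in> mesh_domain G" if "t \<in> {?c .. ?c + step2 G}" for t
  proof -
    have "(?x, t) \<in> elem G i j"
      using that X.pt_cell[OF ij(3)] by (auto simp: elem_eq Y.cell_def algebra_simps)
    then show ?thesis using domain_elem ij by blast
  qed
  have "norm (?D 0 (?c + step2 G * ref_point K q) - ?D 0 ?c
      - step2 G *\<^sub>R (\<Sum>r'\<le>K. bmat K q r' *\<^sub>R ?D 1 (?c + step2 G * ref_point K r')))
    \<le> (1 + (real K + 1) * \<Lambda>) * M * step2 G ^ P"
  proof (rule collocation_error[OF K1 ij(4) st(2)])
    fix n t assume n: "n < P" and t: "t \<in> {?c .. ?c + step2 G}"
    show "(?D n has_vector_derivative ?D (Suc n) t) (at t within {?c .. ?c + step2 G})"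
      using n P t sub
      by (intro iter_deriv_along[OF f]) (auto intro!: derivative_eq_intros
          has_vector_derivative_Pair simp: zero_prod_def)
  next
    show "norm (?D P t) \<le> M" if "t \<in> {?c .. ?c + step2 G}" for t using M sub that by blast
  qed (use P \<Lambda> K1 in auto)
  then show ?thesis
    using ref_point_ends(1)[OF K1] by (simp add: coll_err_def elem_node_def partial2_def cell_point_ref)
qed

lemma elem_node_dist:
  assumes "p \<le> K" "q \<le> K" "p' \<le> K" "q' \<le> K"
  shows "norm (elem_node i j p q - elem_node i j p' q) \<le> step1 G" "norm (elem_node i j p q - elem_node i j p q') \<le> step2 G"
    "norm (elem_node i j p q - elem_node i j p' q') \<le> step1 G + step2 G"
proof -
  have x: "\<bar>X.pt i p - X.pt i p'\<bar> \<le> step1 G"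
    using X.pt_cell[OF assms(1), of i] X.pt_cell[OF assms(3), of i] by (auto simp: X.cell_def algebra_simps)
  have y: "\<bar>Y.pt j q - Y.pt j q'\<bar> \<le> step2 G"
    using Y.pt_cell[OF assms(2), of j] Y.pt_cell[OF assms(4), of j] by (auto simp: Y.cell_def algebra_simps)
  show "norm (elem_node i j p q - elem_node i j p' q) \<le> step1 G" "norm (elem_node i j p q - elem_node i j p q') \<le> step2 G"
    using x y by (simp_all add: elem_node_def norm_Pair)
  have "norm (elem_node i j p q - elem_node i j p' q') \<le> norm (X.pt i p - X.pt i p') + norm (Y.pt j q - Y.pt j q')"
    by (simp add: elem_node_def norm_Pair sqrt_sum_squares_le_sum_abs)
  then show "norm (elem_node i j p q - elem_node i j p' q') \<le> step1 G + step2 G" using x y by simp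
qed

text \<open>Since the rows of \<open>dmat\<close> sum to zero, \<open>u\<close> can be replaced by
  its differences, which are of size \<open>s\<close> and compensate the division. Thus the gradient
  of the interpolated \<open>\<psi>\<close> is bounded uniformly in the mesh.\<close>

lemma sum_dmat_lipschitz:
  assumes \<Lambda>: "\<And>r. r \<le> K \<Longrightarrow> \<bar>dmat K p r\<bar> \<le> \<Lambda>"
    and u: "\<And>r. r \<le> K \<Longrightarrow> \<bar>u r - u p\<bar> \<le> L * s" and s: "s > 0"
  shows "\<bar>(\<Sum>r\<le>K. dmat K p r * u r) / s\<bar> \<le> (real K + 1) * (\<Lambda> * L)"
proof -
  have "(\<Sum>r\<le>K. dmat K p r * u r) = (\<Sum>r\<le>K. dmat K p r * (u r - u p))"
    by (simp add: right_diff_distrib sum_subtractf dmat_sum[OF K1] flip: sum_distrib_right)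
  also have "\<bar>\<dots>\<bar> \<le> (\<Sum>r\<le>K. \<Lambda> * (L * s))"
  proof (rule order_trans[OF sum_abs sum_mono])
    fix r assume "r \<in> {..K}"
    then show "\<bar>dmat K p r * (u r - u p)\<bar> \<le> \<Lambda> * (L * s)"
      unfolding abs_mult using \<Lambda>[of r] u[of r] by (intro mult_mono) auto
  qed
  finally have "\<bar>\<Sum>r\<le>K. dmat K p r * u r\<bar> \<le> (real K + 1) * (\<Lambda> * L) * s" by (simp add: algebra_simps)
  then show ?thesis using s by (simp add: abs_divide divide_le_eq)
qed

text \<open>The constant is explicit so that its independence of the mesh can be read off: besides
  uniform bounds it contains only the side lengths of the rectangle.\<close>

lemma truncation_error_bound:
  fixes F1 F2 :: "real^'s::finite \<Rightarrow> real^'s" and S :: "real^'s \<Rightarrow> real \<times> real \<Rightarrow> real^'s"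
    and \<tau> :: "nat \<Rightarrow> nat \<Rightarrow> real \<times> real \<Rightarrow> real^'s \<Rightarrow> real^'s^'s" and W :: "real \<times> real \<Rightarrow> real^'s"
    and \<psi> :: "real \<times> real \<Rightarrow> real"
  defines "\<Omega> \<equiv> mesh_domain G" and "h \<equiv> mesh_size G"
  assumes \<Lambda>: "\<Lambda> \<ge> 1" "\<And>p r. p \<le> K \<Longrightarrow> r \<le> K \<Longrightarrow> \<bar>dmat K p r\<bar> \<le> \<Lambda> \<and> \<bar>bmat K p r\<bar> \<le> \<Lambda>"
    and \<kappa>: "\<kappa> \<ge> 1" "step1 G \<le> \<kappa> * h" "step2 G \<le> \<kappa> * h"
    and F: "Ck_on (K + 3) \<Omega> (\<lambda>z. F1 (W z))" "Ck_on (K + 3) \<Omega> (\<lambda>z. F2 (W z))"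
    and M: "\<And>z n. z \<in> \<Omega> \<Longrightarrow> n \<le> K + 3 \<Longrightarrow> norm (iter_deriv \<Omega> (1, 0) (\<lambda>z. F1 (W z)) n z) \<le> M"
      "\<And>z n. z \<in> \<Omega> \<Longrightarrow> n \<le> K + 3 \<Longrightarrow> norm (iter_deriv \<Omega> (0, 1) (\<lambda>z. F2 (W z)) n z) \<le> M"
    and S: "stationary_solution \<Omega> F1 F2 S W"
    and \<psi>: "\<And>z. z \<in> \<Omega> \<Longrightarrow> \<bar>\<psi> z\<bar> \<le> B" "L \<ge> 0"
      "\<And>z z'. z \<in> \<Omega> \<Longrightarrow> z' \<in> \<Omega> \<Longrightarrow> \<bar>\<psi> z - \<psi> z'\<bar> \<le> L * norm (z - z')"
    and N: "N \<ge> 0" "\<And>z x. z \<in> \<Omega> \<Longrightarrow> norm (jacobian_matrix F1 (W z) *v x) \<le> N * norm x"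
      "\<And>z x. z \<in> \<Omega> \<Longrightarrow> norm (jacobian_matrix F2 (W z) *v x) \<le> N * norm x"
    and T: "T \<ge> 0" "\<And>i j z. i < num1 G \<Longrightarrow> j < num2 G \<Longrightarrow> z \<in> elem G i j \<Longrightarrow> norm (\<tau> i j z (W z)) \<le> T * h"
    and H: "h \<le> H" "1 \<le> H"
  shows "norm (truncation_error K G F1 F2 S \<tau> W \<psi>) \<le>
    2 * (real K + 1) ^ 5 * \<Lambda> ^ 5 * \<kappa> * ((1 + (real K + 1) * \<Lambda>) * M * \<kappa> ^ (K + 3)) *
      (B + (2 * L * \<kappa> + 2 * ((real K + 1) * (\<Lambda> * L) * (N * (real CARD('s) * T)))) * H) *
      (len1 G * len2 G) * h ^ (K + 1 + (if K = 1 then 0 else 1))"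
proof -
  define t :: nat where "t = (if K = 1 then 0 else 1)"
  \<comment> \<open>Steps are at most \<open>\<kappa>\<close> times \<open>h\<close> and enter with
    powers up to \<open>K + 3\<close>, whence the power of \<open>\<kappa>\<close>.\<close>
  define E where "E = (1 + (real K + 1) * \<Lambda>) * M * \<kappa> ^ (K + 3)"
  define A where "A = 2 * (real K + 1) ^ 5 * \<Lambda> ^ 5 * \<kappa>"
  \<comment> \<open>For each of the two SUPG terms: the bound on a derivative of the interpolated
    \<open>\<psi>\<close>, then on the Jacobian, then on \<open>\<tau>\<close> divided by
    \<open>h\<close>. The cardinality comes from \<open>norm_matrix_vector_le\<close>.\<close>
  define B' where "B' = 2 * ((real K + 1) * (\<Lambda> * L) * (N * (real CARD('s) * T)))"
  define X where "X = A * E * (B + (2 * L * \<kappa> + B') * H)"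
  have h: "0 < h" "h \<le> step1 G" "h \<le> step2 G" using st by (auto simp: h_def mesh_size_def)
  have elem_node\<Omega>: "elem_node i j p q \<in> \<Omega>" if "i < num1 G" "j < num2 G" "p \<le> K" "q \<le> K" for i j p q
    using elem_node_in_nodes[OF that] nodes_domain unfolding \<Omega>_def by blast
  have M0: "0 \<le> M" using M(1)[of "elem_node 0 0 0 0" 0] elem_node\<Omega>[of 0 0 0 0] nm by (auto intro: order_trans[OF norm_ge_zero])
  have B0: "0 \<le> B" using \<psi>(1)[of "elem_node 0 0 0 0"] elem_node\<Omega>[of 0 0 0 0] nm by force
  have E0: "0 \<le> E" unfolding E_def using M0 \<Lambda>(1) \<kappa>(1) by simp
  have A0: "0 \<le> A" unfolding A_def using \<Lambda>(1) \<kappa>(1) by simp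
  have B'0: "0 \<le> B'" unfolding B'_def using \<Lambda>(1) \<psi>(2) N(1) T(1) by simp
  have pow: "(1 + (real K + 1) * \<Lambda>) * M * s ^ P \<le> E * h ^ P"
    if "P \<le> K + 3" "0 < s" "s \<le> \<kappa> * h" for s P
  proof -
    have "s ^ P \<le> (\<kappa> * h) ^ P" using that by (intro power_mono) auto
    also have "\<dots> \<le> \<kappa> ^ (K + 3) * h ^ P"
      unfolding power_mult_distrib using \<kappa>(1) h that(1) by (intro mult_right_mono power_increasing) auto
    finally have "(1 + (real K + 1) * \<Lambda>) * M * s ^ P \<le> (1 + (real K + 1) * \<Lambda>) * M * (\<kappa> ^ (K + 3) * h ^ P)"
      using \<Lambda>(1) M0 by (intro mult_left_mono) auto
    then show ?thesis by (simp add: E_def mult.assoc)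
  qed
  have elem: "norm (\<Sum>p\<le>K. \<Sum>s\<le>K. (step1 G * bmat K K p * (step2 G * bmat K K s)) *\<^sub>R
      (\<psi> (elem_node i j p s) *\<^sub>R residual i j (potential F1 F2 S W) (elem_node i j p s) +
        (((\<Sum>r\<le>K. dmat K p r * \<psi> (elem_node i j r s)) / step1 G) *\<^sub>R
          ((jacobian_matrix F1 (W (elem_node i j p s)) ** \<tau> i j (elem_node i j p s) (W (elem_node i j p s))) *v
            residual i j (potential F1 F2 S W) (elem_node i j p s))
        + ((\<Sum>t\<le>K. dmat K s t * \<psi> (elem_node i j p t)) / step2 G) *\<^sub>R
          ((jacobian_matrix F2 (W (elem_node i j p s)) ** \<tau> i j (elem_node i j p s) (W (elem_node i j p s))) *v
            residual i j (potential F1 F2 S W) (elem_node i j p s)))))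
    \<le> X * (h\<^sup>2 * h ^ (K + 1 + t))"
    if ij: "i < num1 G" "j < num2 G" for i j
  proof -
    let ?V = "\<lambda>r q. potential F1 F2 S W (elem_node i j r q)"
    let ?R = "\<lambda>p s. (1 / (step1 G * step2 G)) *\<^sub>R mixed K ?V p s"
    let ?A1 = "\<lambda>z. jacobian_matrix F1 (W z) ** \<tau> i j z (W z)"
    let ?A2 = "\<lambda>z. jacobian_matrix F2 (W z) ** \<tau> i j z (W z)"
    let ?Z = "\<lambda>p s. ((\<Sum>r\<le>K. dmat K p r * \<psi> (elem_node i j r s)) / step1 G) *\<^sub>R (?A1 (elem_node i j p s) *v ?R p s)
        + ((\<Sum>t\<le>K. dmat K s t * \<psi> (elem_node i j p t)) / step2 G) *\<^sub>R (?A2 (elem_node i j p s) *v ?R p s)"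
    let ?g1 = "\<lambda>r q. partial1 \<Omega> (\<lambda>z. F1 (W z)) (elem_node i j r q)"
    let ?g2 = "\<lambda>r q. partial2 \<Omega> (\<lambda>z. F2 (W z)) (elem_node i j r q)"
    have R: "residual i j (potential F1 F2 S W) (elem_node i j p s) = ?R p s" if "p \<le> K" "s \<le> K" for p s
      by (rule residual_elem_node[OF potential_elem[OF ij] that])
    obtain c c' where V: "\<And>r q. r \<le> K \<Longrightarrow> q \<le> K \<Longrightarrow> ?V r q =
      step2 G *\<^sub>R (\<Sum>q'\<le>K. bmat K q q' *\<^sub>R F1 (W (elem_node i j r q')))
      + step1 G *\<^sub>R (\<Sum>r'\<le>K. bmat K r r' *\<^sub>R F2 (W (elem_node i j r' q)))
      - (step1 G * step2 G) *\<^sub>R (\<Sum>r'\<le>K. \<Sum>q'\<le>K. (bmat K r r' * bmat K q q') *\<^sub>R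
          S (W (elem_node i j r' q')) (elem_node i j r' q'))
      + c r + c' q"
      using potential_elem_node[OF ij, of F1 F2 S W] by blast
    \<comment> \<open>Here the nodal values being those of an exact solution enters: at every node
      the source is the flux divergence.\<close>
    have div: "(\<Sum>r'\<le>K. \<Sum>q'\<le>K. (bmat K r r' * bmat K q q') *\<^sub>R S (W (elem_node i j r' q')) (elem_node i j r' q'))
        = (\<Sum>r'\<le>K. \<Sum>q'\<le>K. (bmat K r r' * bmat K q q') *\<^sub>R (?g1 r' q' + ?g2 r' q'))" for r q
      using S elem_node\<Omega>[OF ij] unfolding stationary_solution_def by (intro sum.cong refl) simp
    have bound: "norm (\<Sum>p\<le>K. \<Sum>s\<le>K. (step1 G * bmat K K p * (step2 G * bmat K K s)) *\<^sub>R
      (\<psi> (elem_node i j p s) *\<^sub>R ?R p s + ?Z p s))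
      \<le> 2 * (real K + 1) ^ 5 * \<Lambda> ^ 5 * \<kappa> *
        (B * h * (E * h ^ (K + 2 + t)) + (2 * L * \<kappa> + B') * h * h * (E * h ^ (K + 2)))"
    proof (rule element_estimate[where V = ?V and Z = ?Z and \<psi> = "\<lambda>p s. \<psi> (elem_node i j p s)"
          and ?g1.0 = ?g1 and ?g2.0 = ?g2 and ?f1.0 = "\<lambda>r q. F1 (W (elem_node i j r q))"
          and ?f2.0 = "\<lambda>r q. F2 (W (elem_node i j r q))",
          OF K1 \<Lambda> h(1) st \<kappa>(2,3) V[unfolded div]])
      fix r q assume rq: "r \<le> K" "q \<le> K"
      have "norm (coll_err K (step1 G) (\<lambda>r'. F1 (W (elem_node i j r' q))) (\<lambda>r'. ?g1 r' q) r) \<le> (1 + (real K + 1) * \<Lambda>) * M * step1 G ^ (K + 2)"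
        unfolding \<Omega>_def
      proof (rule coll_err_bound_fst[OF F(1)[unfolded \<Omega>_def] ij rq])
        show "norm (iter_deriv (mesh_domain G) (1, 0) (\<lambda>z. F1 (W z)) (K + 2) z) \<le> M" if "z \<in> mesh_domain G" for z
          using M(1)[of z "K + 2"] that K1 by (simp add: \<Omega>_def)
      qed (use \<Lambda>(2) rq K1 in auto)
      also have "\<dots> \<le> E * h ^ (K + 2)" using K1 st(1) \<kappa>(2) by (intro pow) auto
      finally show "norm (coll_err K (step1 G) (\<lambda>r'. F1 (W (elem_node i j r' q))) (\<lambda>r'. ?g1 r' q) r) \<le> E * h ^ (K + 2)" .
      have "norm (coll_err K (step2 G) (\<lambda>q'. F2 (W (elem_node i j r q'))) (?g2 r) q) \<le> (1 + (real K + 1) * \<Lambda>) * M * step2 G ^ (K + 2)"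
        unfolding \<Omega>_def
      proof (rule coll_err_bound_snd[OF F(2)[unfolded \<Omega>_def] ij rq])
        show "norm (iter_deriv (mesh_domain G) (0, 1) (\<lambda>z. F2 (W z)) (K + 2) z) \<le> M" if "z \<in> mesh_domain G" for z
          using M(2)[of z "K + 2"] that K1 by (simp add: \<Omega>_def)
      qed (use \<Lambda>(2) rq K1 in auto)
      also have "\<dots> \<le> E * h ^ (K + 2)" using K1 st(2) \<kappa>(3) by (intro pow) auto
      finally show "norm (coll_err K (step2 G) (\<lambda>q'. F2 (W (elem_node i j r q'))) (?g2 r) q) \<le> E * h ^ (K + 2)" .
    next
      fix q assume q: "q \<le> K"
      have t1: "t \<le> 1" by (simp add: t_def)
      \<comment> \<open>The higher order is claimed only for \<open>K \<ge> 2\<close> and at the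
        last node, where the quadrature has its additional degree.\<close>
      have P: "K + 2 + t = K + 2 \<or> K + 2 + t = K + 3 \<and> K = K \<and> K \<ge> 2" using K1 by (auto simp: t_def)
      have "norm (coll_err K (step1 G) (\<lambda>r'. F1 (W (elem_node i j r' q))) (\<lambda>r'. ?g1 r' q) K) \<le> (1 + (real K + 1) * \<Lambda>) * M * step1 G ^ (K + 2 + t)"
        unfolding \<Omega>_def
      proof (rule coll_err_bound_fst[OF F(1)[unfolded \<Omega>_def] ij order_refl q])
        show "norm (iter_deriv (mesh_domain G) (1, 0) (\<lambda>z. F1 (W z)) (K + 2 + t) z) \<le> M" if "z \<in> mesh_domain G" for z
          using M(1)[of z "K + 2 + t"] that t1 by (simp add: \<Omega>_def)
      qed (use \<Lambda>(2) q P in auto)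
      also have "\<dots> \<le> E * h ^ (K + 2 + t)" using P st(1) \<kappa>(2) by (intro pow) auto
      finally show "norm (coll_err K (step1 G) (\<lambda>r'. F1 (W (elem_node i j r' q))) (\<lambda>r'. ?g1 r' q) K) \<le> E * h ^ (K + 2 + t)" .
      have "norm (coll_err K (step2 G) (\<lambda>q'. F2 (W (elem_node i j q q'))) (?g2 q) K) \<le> (1 + (real K + 1) * \<Lambda>) * M * step2 G ^ (K + 2 + t)"
        unfolding \<Omega>_def
      proof (rule coll_err_bound_snd[OF F(2)[unfolded \<Omega>_def] ij q order_refl])
        show "norm (iter_deriv (mesh_domain G) (0, 1) (\<lambda>z. F2 (W z)) (K + 2 + t) z) \<le> M" if "z \<in> mesh_domain G" for z
          using M(2)[of z "K + 2 + t"] that t1 by (simp add: \<Omega>_def)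
      qed (use \<Lambda>(2) q P in auto)
      also have "\<dots> \<le> E * h ^ (K + 2 + t)" using P st(2) \<kappa>(3) by (intro pow) auto
      finally show "norm (coll_err K (step2 G) (\<lambda>q'. F2 (W (elem_node i j q q'))) (?g2 q) K) \<le> E * h ^ (K + 2 + t)" .
    next
      show "0 \<le> 2 * L * \<kappa>" "0 \<le> B'" using \<psi>(2) \<kappa>(1) B'0 by auto
      show "\<bar>\<psi> (elem_node i j 0 0)\<bar> \<le> B" using \<psi>(1) elem_node\<Omega>[OF ij] by simp
      fix p s assume ps: "p \<le> K" "s \<le> K"
      have "\<bar>\<psi> (elem_node i j p s) - \<psi> (elem_node i j 0 0)\<bar> \<le> L * (step1 G + step2 G)"
        using \<psi>(3)[OF elem_node\<Omega>[OF ij ps] elem_node\<Omega>[OF ij, of 0 0]] elem_node_dist(3)[OF ps, of 0 0 i j] \<psi>(2)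
        by (auto intro: order_trans mult_left_mono)
      also have "\<dots> \<le> L * (\<kappa> * h + \<kappa> * h)" using \<psi>(2) \<kappa> by (intro mult_left_mono add_mono) auto
      finally show "\<bar>\<psi> (elem_node i j p s) - \<psi> (elem_node i j 0 0)\<bar> \<le> 2 * L * \<kappa> * h" by (simp add: algebra_simps)
      let ?z = "elem_node i j p s" and ?D = "(real K + 1) * (\<Lambda> * L)"
      have J: "norm ((J ** \<tau> i j ?z (W ?z)) *v x) \<le> N * (real CARD('s) * T) * h * norm x"
        if "\<And>x. norm (J *v x) \<le> N * norm x" for J :: "real^'s^'s" and x
      proof -
        have "norm (J *v (\<tau> i j ?z (W ?z) *v x)) \<le> N * norm (\<tau> i j ?z (W ?z) *v x)" by (rule that)
        also have "\<dots> \<le> N * (real CARD('s) * norm (\<tau> i j ?z (W ?z)) * norm x)"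
          using N(1) norm_matrix_vector_le by (intro mult_left_mono) auto
        also have "\<dots> \<le> N * (real CARD('s) * (T * h) * norm x)"
          using N(1) T(2)[OF ij elem_node_in_elem[OF ps]] by (intro mult_left_mono mult_right_mono) auto
        finally show ?thesis by (simp add: matrix_vector_mul_assoc mult.assoc)
      qed
      have D1: "\<bar>(\<Sum>r\<le>K. dmat K p r * \<psi> (elem_node i j r s)) / step1 G\<bar> \<le> ?D"
      proof (rule sum_dmat_lipschitz)
        fix r assume r: "r \<le> K"
        show "\<bar>\<psi> (elem_node i j r s) - \<psi> (elem_node i j p s)\<bar> \<le> L * step1 G"
          using \<psi>(3)[OF elem_node\<Omega>[OF ij r ps(2)] elem_node\<Omega>[OF ij ps]] elem_node_dist(1)[OF r ps(2) ps, of i j] \<psi>(2)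
          by (auto intro: order_trans mult_left_mono)
      qed (use \<Lambda> ps st in auto)
      have D2: "\<bar>(\<Sum>r\<le>K. dmat K s r * \<psi> (elem_node i j p r)) / step2 G\<bar> \<le> ?D"
      proof (rule sum_dmat_lipschitz)
        fix r assume r: "r \<le> K"
        show "\<bar>\<psi> (elem_node i j p r) - \<psi> (elem_node i j p s)\<bar> \<le> L * step2 G"
          using \<psi>(3)[OF elem_node\<Omega>[OF ij ps(1) r] elem_node\<Omega>[OF ij ps]] elem_node_dist(2)[OF ps(1) r ps, of i j] \<psi>(2)
          by (auto intro: order_trans mult_left_mono)
      qed (use \<Lambda> ps st in auto)
      have D0: "0 \<le> ?D" using \<Lambda>(1) \<psi>(2) by simp
      have "norm (?Z p s) \<le> ?D * (N * (real CARD('s) * T) * h * norm (?R p s))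
          + ?D * (N * (real CARD('s) * T) * h * norm (?R p s))"
      proof (rule order_trans[OF norm_triangle_ineq add_mono])
        show "norm (((\<Sum>r\<le>K. dmat K p r * \<psi> (elem_node i j r s)) / step1 G) *\<^sub>R (?A1 ?z *v ?R p s))
            \<le> ?D * (N * (real CARD('s) * T) * h * norm (?R p s))"
          unfolding norm_scaleR[of "(\<Sum>r\<le>K. dmat K p r * \<psi> (elem_node i j r s)) / step1 G"]
          by (intro mult_mono D1 D0 J N(2) elem_node\<Omega>[OF ij ps] norm_ge_zero)
        show "norm (((\<Sum>t\<le>K. dmat K s t * \<psi> (elem_node i j p t)) / step2 G) *\<^sub>R (?A2 ?z *v ?R p s))
            \<le> ?D * (N * (real CARD('s) * T) * h * norm (?R p s))"
          unfolding norm_scaleR[of "(\<Sum>t\<le>K. dmat K s t * \<psi> (elem_node i j p t)) / step2 G"]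
          by (intro mult_mono D2 D0 J N(3) elem_node\<Omega>[OF ij ps] norm_ge_zero)
      qed
      also have "\<dots> = B' * h * norm (?R p s)"
      proof -
        have "d * (n * h * x) + d * (n * h * x) = 2 * (d * n) * h * x" for d n x :: real
          by (simp add: algebra_simps)
        then show ?thesis unfolding B'_def .
      qed
      finally show "norm (?Z p s) \<le> B' * h * norm (?R p s)" .
    qed
    \<comment> \<open>For \<open>K = 1\<close> these terms are one order better than claimed, and
      the surplus factor \<open>h\<close> is bounded by \<open>H\<close>; for
      \<open>K \<ge> 2\<close> they have the claimed order.\<close>
    have "(2 * L * \<kappa> + B') * h * h * (E * h ^ (K + 2)) \<le> (2 * L * \<kappa> + B') * H * (E * h ^ (K + 3 + t))"
    proof -
      have "h * h * h ^ (K + 2) = h ^ (1 - t) * h ^ (K + 3 + t)"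
        by (simp add: t_def eval_nat_numeral)
      also have "h ^ (1 - t) \<le> H" using H by (simp add: t_def)
      finally have "h * h * h ^ (K + 2) \<le> H * h ^ (K + 3 + t)" using h by (simp add: mult_right_mono)
      then have "((2 * L * \<kappa> + B') * E) * (h * h * h ^ (K + 2)) \<le> ((2 * L * \<kappa> + B') * E) * (H * h ^ (K + 3 + t))"
        using \<psi>(2) \<kappa>(1) B'0 E0 by (intro mult_left_mono) auto
      then show ?thesis by (simp add: mult_ac)
    qed
    then have "B * h * (E * h ^ (K + 2 + t)) + (2 * L * \<kappa> + B') * h * h * (E * h ^ (K + 2))
        \<le> B * (E * h ^ (K + 3 + t)) + (2 * L * \<kappa> + B') * H * (E * h ^ (K + 3 + t))"
      by (simp add: eval_nat_numeral)
    also have "\<dots> = E * (B + (2 * L * \<kappa> + B') * H) * (h\<^sup>2 * h ^ (K + 1 + t))"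
      by (simp add: eval_nat_numeral algebra_simps)
    finally have "A * (B * h * (E * h ^ (K + 2 + t)) + (2 * L * \<kappa> + B') * h * h * (E * h ^ (K + 2)))
        \<le> A * (E * (B + (2 * L * \<kappa> + B') * H) * (h\<^sup>2 * h ^ (K + 1 + t)))"
      using A0 by (rule mult_left_mono)
    also have "\<dots> = X * (h\<^sup>2 * h ^ (K + 1 + t))" by (simp add: X_def mult.assoc)
    finally have "norm (\<Sum>p\<le>K. \<Sum>s\<le>K. (step1 G * bmat K K p * (step2 G * bmat K K s)) *\<^sub>R
      (\<psi> (elem_node i j p s) *\<^sub>R ?R p s + ?Z p s)) \<le> X * (h\<^sup>2 * h ^ (K + 1 + t))"
      using bound unfolding A_def by linarith
    then show ?thesis
      by (rule order_trans[OF eq_refl, rotated])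
        (intro arg_cong[where f = norm] sum.cong refl, simp only: R atMost_iff)
  qed
  have "norm (truncation_error K G F1 F2 S \<tau> W \<psi>) \<le> (\<Sum>i<num1 G. \<Sum>j<num2 G. X * (h\<^sup>2 * h ^ (K + 1 + t)))"
    unfolding truncation_error_elements by (intro sum_norm_le elem) auto
  also have "\<dots> = X * h ^ (K + 1 + t) * (real (num1 G) * real (num2 G) * h\<^sup>2)" by (simp add: mult_ac)
  \<comment> \<open>Since \<open>h\<close> is the smaller step, the number of elements times
    \<open>h\<^sup>2\<close> is at most the area of the rectangle.\<close>
  also have "\<dots> \<le> X * h ^ (K + 1 + t) * (real (num1 G) * real (num2 G) * (step1 G * step2 G))"
  proof (intro mult_left_mono)
    show "h\<^sup>2 \<le> step1 G * step2 G" unfolding power2_eq_square using h by (intro mult_mono) auto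
    show "0 \<le> X * h ^ (K + 1 + t)"
      unfolding X_def using A0 E0 B0 \<psi>(2) \<kappa>(1) B'0 H h by simp
  qed auto
  also have "\<dots> = X * (len1 G * len2 G) * h ^ (K + 1 + t)" by (simp add: len mult_ac)
  finally show ?thesis unfolding X_def A_def E_def B'_def t_def .
qed

end

section \<open>Uniform constants for the mesh family\<close>

theorem proposition12:
  fixes a b l m :: real and K :: nat
    and \<M> :: "mesh set"
    and D :: "(real^'s::finite) set"
    and F1 F2 :: "real^'s \<Rightarrow> real^'s"
    and S :: "real^'s \<Rightarrow> real \<times> real \<Rightarrow> real^'s"
    and \<tau> :: "mesh \<Rightarrow> nat \<Rightarrow> nat \<Rightarrow> real \<times> real \<Rightarrow> real^'s \<Rightarrow> real^'s^'s"
    and We :: "real \<times> real \<Rightarrow> real^'s"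
    and \<psi> :: "real \<times> real \<Rightarrow> real"
  defines "\<Omega> \<equiv> rectangle a b l m"
  assumes "l > 0" and "m > 0" and "K \<ge> 1"
    and "mesh_family a b l m \<M>"
    and "open D" and "smooth_on D F1" and "smooth_on D F2"
    and "smooth_on (D \<times> \<Omega>) (\<lambda>(w, x). S w x)"
    and "stabilization_scaling D \<M> \<tau>"
    and "We ` \<Omega> \<subseteq> D" and "Ck_on (K + 3) \<Omega> We"
    and "stationary_solution \<Omega> F1 F2 S We"
    and "test_function \<Omega> \<psi>"
  shows "\<exists>C. \<forall>G\<in>\<M>.
    norm (truncation_error K G F1 F2 S (\<tau> G) We \<psi>)
      \<le> C * mesh_size G ^ (K + 1 + (if K = 1 then 0 else 1))"
proof -
  have \<Omega>: "proper_box \<Omega>" "compact \<Omega>" "convex \<Omega>"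
    unfolding \<Omega>_def rectangle_def using assms(2,3)
    by (auto intro!: proper_box_rectangle compact_Times convex_Times)
  have Ck: "Ck_on n D F1" "Ck_on n D F2" for n using assms(7,8) by (auto simp: smooth_on_def)
  \<comment> \<open>\<open>K + 3\<close> derivatives of the fluxes are what the collocation
    remainder at the last node consumes.\<close>
  have F: "Ck_on (K + 3) \<Omega> (\<lambda>z. F1 (We z))" "Ck_on (K + 3) \<Omega> (\<lambda>z. F2 (We z))"
    by (intro Ck_on_compose[OF \<Omega>(1) _ assms(12,11)] Ck)+
  have bd: "\<exists>M. \<forall>z\<in>\<Omega>. \<forall>n\<le>K + 3. norm (iter_deriv \<Omega> v f n z) \<le> M"
    if "Ck_on (K + 3) \<Omega> f" for v and f :: "real \<times> real \<Rightarrow> real^'s"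
  proof -
    have "\<forall>n. \<exists>M. n \<le> K + 3 \<longrightarrow> (\<forall>z\<in>\<Omega>. norm (iter_deriv \<Omega> v f n z) \<le> M)"
      using iter_deriv_bounded[OF that \<Omega>(2)] by blast
    then obtain M where M: "\<And>n z. n \<le> K + 3 \<Longrightarrow> z \<in> \<Omega> \<Longrightarrow> norm (iter_deriv \<Omega> v f n z) \<le> M n" by metis
    have "norm (iter_deriv \<Omega> v f n z) \<le> Max (M ` {..K + 3})" if "n \<le> K + 3" "z \<in> \<Omega>" for n z
      using M[OF that] that(1) by (intro order_trans[OF _ Max_ge]) auto
    then show ?thesis by blast
  qed
  obtain M1 where M1: "\<And>z n. z \<in> \<Omega> \<Longrightarrow> n \<le> K + 3 \<Longrightarrow> norm (iter_deriv \<Omega> (1, 0) (\<lambda>z. F1 (We z)) n z) \<le> M1"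
    using bd[OF F(1), of "(1, 0)"] by blast
  obtain M2 where M2: "\<And>z n. z \<in> \<Omega> \<Longrightarrow> n \<le> K + 3 \<Longrightarrow> norm (iter_deriv \<Omega> (0, 1) (\<lambda>z. F2 (We z)) n z) \<le> M2"
    using bd[OF F(2), of "(0, 1)"] by blast
  define M where "M = max M1 M2"
  have \<psi>1: "Ck_on 1 \<Omega> \<psi>" using assms(14) by (simp add: test_function_def)
  obtain B where B: "\<And>z. z \<in> \<Omega> \<Longrightarrow> \<bar>\<psi> z\<bar> \<le> B"
    using iter_deriv_bounded[OF \<psi>1 \<Omega>(2), of 0] by auto
  obtain L where L: "L \<ge> 0" "\<And>z z'. z \<in> \<Omega> \<Longrightarrow> z' \<in> \<Omega> \<Longrightarrow> \<bar>\<psi> z - \<psi> z'\<bar> \<le> L * norm (z - z')"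
    using Ck_on_1_lipschitz[OF \<psi>1 \<Omega>(2,3)] by auto
  \<comment> \<open>Jacobians and \<open>\<tau>\<close> are controlled only on compact sets of
    states; the exact solution takes its values in one of them.\<close>
  have Q: "compact (We ` \<Omega>)"
    using Ck_on_imp_continuous_on[OF assms(12)] \<Omega>(2) by (rule compact_continuous_image)
  obtain N1 where N1: "N1 \<ge> 0" "\<And>z x. z \<in> \<Omega> \<Longrightarrow> norm (jacobian_matrix F1 (We z) *v x) \<le> N1 * norm x"
    using jacobian_bounded[OF assms(6) Ck(1) Q assms(11)] by auto
  obtain N2 where N2: "N2 \<ge> 0" "\<And>z x. z \<in> \<Omega> \<Longrightarrow> norm (jacobian_matrix F2 (We z) *v x) \<le> N2 * norm x"
    using jacobian_bounded[OF assms(6) Ck(2) Q assms(11)] by auto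
  define N where "N = max N1 N2"
  obtain T where T: "\<And>G i j x w. G \<in> \<M> \<Longrightarrow> i < num1 G \<Longrightarrow> j < num2 G \<Longrightarrow> x \<in> elem G i j \<Longrightarrow> w \<in> We ` \<Omega> \<Longrightarrow>
      norm (\<tau> G i j x w) \<le> T * mesh_size G"
    using assms(10) Q assms(11) unfolding stabilization_scaling_def by meson
  obtain \<kappa> where \<kappa>: "\<And>G. G \<in> \<M> \<Longrightarrow> step1 G \<le> \<kappa> * step2 G \<and> step2 G \<le> \<kappa> * step1 G"
    using assms(5) unfolding mesh_family_def by blast
  obtain \<Lambda> where \<Lambda>: "\<Lambda> \<ge> 1" "\<And>p r. p \<le> K \<Longrightarrow> r \<le> K \<Longrightarrow> \<bar>dmat K p r\<bar> \<le> \<Lambda> \<and> \<bar>bmat K p r\<bar> \<le> \<Lambda>"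
    using ref_bounds[of K] by blast
  show ?thesis
  proof (intro exI ballI)
    fix G assume G: "G \<in> \<M>"
    have G': "org1 G = a" "org2 G = b" "len1 G = l" "len2 G = m" "num1 G \<ge> 1" "num2 G \<ge> 1"
      using assms(5) G unfolding mesh_family_def by auto
    have steps: "step1 G > 0" "step2 G > 0" "step1 G \<le> l"
      using G' assms(2,3) by (auto simp: step1_def step2_def divide_le_eq)
    interpret admissible_mesh K G using assms(4) steps G' by unfold_locales auto
    have dom: "mesh_domain G = \<Omega>" by (simp add: mesh_domain_def \<Omega>_def G')
    have sz: "0 < mesh_size G" "mesh_size G \<le> max 1 l" using steps by (auto simp: mesh_size_def min_le_iff_disj le_max_iff_disj)
    \<comment> \<open>Comparability bounds the larger step by the smaller one; the maximum with 1
      covers the smaller step itself.\<close>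
    have k: "s \<le> max 1 \<kappa> * mesh_size G" if "s = step1 G \<or> s = step2 G" for s
    proof -
      have "\<kappa> * u \<le> max 1 \<kappa> * u" "u \<le> max 1 \<kappa> * u" if "u > 0" for u
        using that by (auto intro!: mult_right_mono simp: mult_le_cancel_right1)
      then show ?thesis using that \<kappa>[OF G] steps by (auto simp: mesh_size_def min_def intro: order_trans)
    qed
    have \<tau>: "norm (\<tau> G i j z (We z)) \<le> max 0 T * mesh_size G"
      if "i < num1 G" "j < num2 G" "z \<in> elem G i j" for i j z
    proof -
      have "z \<in> \<Omega>" using that domain_elem dom by blast
      then have "norm (\<tau> G i j z (We z)) \<le> T * mesh_size G" using T[OF G that] by blast
      also have "\<dots> \<le> max 0 T * mesh_size G" using sz by (intro mult_right_mono) auto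
      finally show ?thesis .
    qed
    have Nx: "N1 * norm x \<le> N * norm x" "N2 * norm x \<le> N * norm x" for x :: "real^'s"
      by (auto simp: N_def intro: mult_right_mono)
    show "norm (truncation_error K G F1 F2 S (\<tau> G) We \<psi>) \<le>
      2 * (real K + 1) ^ 5 * \<Lambda> ^ 5 * max 1 \<kappa> * ((1 + (real K + 1) * \<Lambda>) * M * max 1 \<kappa> ^ (K + 3)) *
      (B + (2 * L * max 1 \<kappa> + 2 * ((real K + 1) * (\<Lambda> * L) * (N * (real CARD('s) * max 0 T)))) * max 1 l) *
      (l * m) * mesh_size G ^ (K + 1 + (if K = 1 then 0 else 1))"
      unfolding G'(3,4)[symmetric]
    proof (rule truncation_error_bound[unfolded dom, OF \<Lambda> _ _ _ F])
      show "norm (iter_deriv \<Omega> (1, 0) (\<lambda>z. F1 (We z)) n z) \<le> M"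
        "norm (iter_deriv \<Omega> (0, 1) (\<lambda>z. F2 (We z)) n z) \<le> M" if "z \<in> \<Omega>" "n \<le> K + 3" for z n
        using M1[OF that] M2[OF that] by (auto simp: M_def)
      show "norm (jacobian_matrix F1 (We z) *v x) \<le> N * norm x"
        "norm (jacobian_matrix F2 (We z) *v x) \<le> N * norm x" if "z \<in> \<Omega>" for z x
        using N1(2)[OF that, of x] N2(2)[OF that, of x] Nx[of x] by auto
    qed (use assms(13) B L N1(1) \<tau> sz k G' in \<open>auto simp: N_def\<close>)
  qed
qed

end
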